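(* Let $X=\mathbb R^n$ and let $L\subset X$ be a uniformly discrete set. Let $S$ be a bounded operator on $L^2(X)$ such that on the region $x\ne y$ its distribution kernel is a function satisfying the estimate $|S(x,y)|\le c|x-y|^{-m}$ for some $m>n$. Then $S$ is $\mathcal F_L$-decay preserving.
   Context: $L\subset X$ is uniformly discrete if $\inf|a-b|>0$, the infimum being over couples of distinct points $a,b\in L$. Let $L_\varepsilon$ be the set of points at distance $<\varepsilon$ from $L$ and $B(r)=\{x:|x|<r\}$. A subset $N\subset X$ is $L$-thin if for each $\varepsilon>0$ there is $r<\infty$ such that $N\setminus B(r)\subset L_\varepsilon$. $\mathcal F_L$ is the filter of complements of $L$-thin sets. $B_L(X)$ is the $C^*$-algebra of bounded Borel functions $\varphi:X\to\mathbb C$ with $\lim_{\mathcal F_L}\varphi=0$, i.e. such that $\{|\varphi|\ge\lambda\}$ is $L$-thin for each $\lambda>0$. $\varphi(Q)$ is multiplication by $\varphi$ on $L^2(X)$. $S\in\mathcal B(L^2(X))$ is $\mathcal F_L$-decay preserving if for every $\varphi\in B_L(X)$: $S\varphi(Q)$ belongs to the norm-closed linear span of the operators $\psi(Q)T$ with $\psi\in B_L(X)$, $T\in\mathcal B(L^2(X))$, and $\varphi(Q)S$ belongs to the norm-closed linear span of the operators $T\psi(Q)$ with $\psi\in B_L(X)$, $T\in\mathcal B(L^2(X))$. *)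

theory Defs
  imports "HOL-Analysis.Analysis"
begin

section \<open>The Hilbert space \<open>L\<^sup>2(X)\<close>\<close>

definition square_integrable :: "('a::euclidean_space \<Rightarrow> complex) \<Rightarrow> bool" where
  "square_integrable f \<longleftrightarrow>
     f \<in> borel_measurable borel \<and> integrable lborel (\<lambda>x. (cmod (f x))\<^sup>2)"

definition L2_eq :: "('a::euclidean_space \<Rightarrow> complex) \<Rightarrow> ('a \<Rightarrow> complex) \<Rightarrow> bool" where
  "L2_eq f g \<longleftrightarrow> square_integrable f \<and> square_integrable g \<and> (AE x in lborel. f x = g x)"

lemma square_integrable_zero [simp]: "square_integrable (\<lambda>_. 0)"
  by (simp add: square_integrable_def)

lemma square_integrable_measurable:
  "square_integrable f \<Longrightarrow> f \<in> borel_measurable borel"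
  by (simp add: square_integrable_def)

lemma square_integrable_dominated:
  assumes "f \<in> borel_measurable borel" "integrable lborel g"
    "\<And>x. (cmod (f x))\<^sup>2 \<le> g x"
  shows "square_integrable f"
  unfolding square_integrable_def
proof
  show "f \<in> borel_measurable borel" by fact
  have "norm ((cmod (f x))\<^sup>2) \<le> norm (g x)" for x
    using assms(3)[of x] by (simp add: order_trans[OF _ abs_ge_self])
  then show "integrable lborel (\<lambda>x. (cmod (f x))\<^sup>2)"
    using assms by (intro Bochner_Integration.integrable_bound[OF assms(2)]) auto
qed

lemma square_integrable_add:
  assumes "square_integrable f" "square_integrable g"
  shows "square_integrable (\<lambda>x. f x + g x)"
proof (rule square_integrable_dominated)
  show "integrable lborel (\<lambda>x. 2 * (cmod (f x))\<^sup>2 + 2 * (cmod (g x))\<^sup>2)"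
    using assms by (auto simp: square_integrable_def)
  show "(cmod (f x + g x))\<^sup>2 \<le> 2 * (cmod (f x))\<^sup>2 + 2 * (cmod (g x))\<^sup>2" for x
  proof -
    have "(cmod (f x + g x))\<^sup>2 \<le> (cmod (f x) + cmod (g x))\<^sup>2"
      by (intro power_mono norm_triangle_ineq) auto
    moreover have "0 \<le> (cmod (f x) - cmod (g x))\<^sup>2" by simp
    ultimately show ?thesis by (simp add: power2_eq_square algebra_simps)
  qed
qed (use assms in \<open>auto simp: square_integrable_def\<close>)

lemma square_integrable_bounded_mult:
  assumes "\<phi> \<in> borel_measurable borel" "bounded (range \<phi>)" "square_integrable f"
  shows "square_integrable (\<lambda>x. \<phi> x * f x)"
proof -
  obtain B where B: "\<And>x. cmod (\<phi> x) \<le> B"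
    using assms(2) by (auto simp: bounded_iff)
  show ?thesis
  proof (rule square_integrable_dominated)
    show "integrable lborel (\<lambda>x. B\<^sup>2 * (cmod (f x))\<^sup>2)"
      using assms by (auto simp: square_integrable_def)
    show "(cmod (\<phi> x * f x))\<^sup>2 \<le> B\<^sup>2 * (cmod (f x))\<^sup>2" for x
      by (simp add: norm_mult power_mult_distrib B mult_right_mono power_mono)
  qed (use assms in \<open>auto simp: square_integrable_def\<close>)
qed

lemma square_integrable_minus:
  "square_integrable f \<Longrightarrow> square_integrable (\<lambda>x. - f x)"
  by (simp add: square_integrable_def)

lemma square_integrable_diff:
  "square_integrable f \<Longrightarrow> square_integrable g \<Longrightarrow> square_integrable (\<lambda>x. f x - g x)"
  using square_integrable_add[OF _ square_integrable_minus] by fastforce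

lemma square_integrable_scaleR:
  "square_integrable f \<Longrightarrow> square_integrable (\<lambda>x. r *\<^sub>R f x)"
  by (auto simp: square_integrable_def power_mult_distrib intro!: borel_measurable_scaleR)

lemma square_integrable_inner:
  assumes "square_integrable f" "square_integrable g"
  shows "integrable lborel (\<lambda>x. inner (f x) (g x))"
proof (rule Bochner_Integration.integrable_bound)
  show "integrable lborel (\<lambda>x. (cmod (f x))\<^sup>2 + (cmod (g x))\<^sup>2)"
    using assms by (auto simp: square_integrable_def)
  show "(\<lambda>x. inner (f x) (g x)) \<in> borel_measurable lborel"
    using assms by (auto simp: square_integrable_def)
  show "AE x in lborel. norm (inner (f x) (g x)) \<le> norm ((cmod (f x))\<^sup>2 + (cmod (g x))\<^sup>2)"
  proof (rule AE_I2)
    fix x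
    have "\<bar>inner (f x) (g x)\<bar> \<le> cmod (f x) * cmod (g x)"
      by (rule Cauchy_Schwarz_ineq2)
    also have "\<dots> \<le> (cmod (f x))\<^sup>2 + (cmod (g x))\<^sup>2"
    proof -
      have "0 \<le> (cmod (f x) - cmod (g x))\<^sup>2" "0 \<le> cmod (f x) * cmod (g x)"
        by simp_all
      then show ?thesis unfolding power2_diff by linarith
    qed
    finally show "norm (inner (f x) (g x)) \<le> norm ((cmod (f x))\<^sup>2 + (cmod (g x))\<^sup>2)"
      by simp
  qed
qed

quotient_type (overloaded) 'a L2 = "'a::euclidean_space \<Rightarrow> complex" / partial: L2_eq
proof (rule part_equivpI)
  show "\<exists>f::'a \<Rightarrow> complex. L2_eq f f"
    by (rule exI[of _ "\<lambda>_. 0"]) (simp add: L2_eq_def)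
  show "symp (L2_eq :: ('a \<Rightarrow> complex) \<Rightarrow> _)"
    by (rule sympI) (auto simp: L2_eq_def elim: AE_mp)
  show "transp (L2_eq :: ('a \<Rightarrow> complex) \<Rightarrow> _)"
    by (rule transpI) (auto simp: L2_eq_def elim: AE_mp)
qed

instantiation L2 :: (euclidean_space) real_inner
begin

lift_definition zero_L2 :: "'a L2" is "\<lambda>_. 0"
  by (simp add: L2_eq_def)

lift_definition plus_L2 :: "'a L2 \<Rightarrow> 'a L2 \<Rightarrow> 'a L2" is "\<lambda>f g x. f x + g x"
  by (auto simp: L2_eq_def square_integrable_add elim: AE_mp)

lift_definition minus_L2 :: "'a L2 \<Rightarrow> 'a L2 \<Rightarrow> 'a L2" is "\<lambda>f g x. f x - g x"
  by (auto simp: L2_eq_def square_integrable_diff elim: AE_mp)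

lift_definition uminus_L2 :: "'a L2 \<Rightarrow> 'a L2" is "\<lambda>f x. - f x"
  by (auto simp: L2_eq_def square_integrable_minus elim: AE_mp)

lift_definition scaleR_L2 :: "real \<Rightarrow> 'a L2 \<Rightarrow> 'a L2" is "\<lambda>r f x. r *\<^sub>R f x"
  by (auto simp: L2_eq_def intro: square_integrable_scaleR elim: AE_mp)

text \<open>The real part of the complex scalar product; it induces the usual norm.\<close>
lift_definition inner_L2 :: "'a L2 \<Rightarrow> 'a L2 \<Rightarrow> real" is
  "\<lambda>f g. \<integral>x. inner (f x) (g x) \<partial>lborel"
proof -
  fix f f' g g' :: "'a \<Rightarrow> complex"
  assume a: "L2_eq f f'" "L2_eq g g'"
  show "(\<integral>x. inner (f x) (g x) \<partial>lborel) = (\<integral>x. inner (f' x) (g' x) \<partial>lborel)"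
  proof (rule integral_cong_AE)
    show "AE x in lborel. inner (f x) (g x) = inner (f' x) (g' x)"
      using a by (auto simp: L2_eq_def elim: AE_mp)
  qed (use a in \<open>auto simp: L2_eq_def square_integrable_def\<close>)
qed

lift_definition norm_L2 :: "'a L2 \<Rightarrow> real" is "\<lambda>f. sqrt (\<integral>x. (cmod (f x))\<^sup>2 \<partial>lborel)"
proof -
  fix f g :: "'a \<Rightarrow> complex"
  assume a: "L2_eq f g"
  have "(\<integral>x. (cmod (f x))\<^sup>2 \<partial>lborel) = (\<integral>x. (cmod (g x))\<^sup>2 \<partial>lborel)"
  proof (rule integral_cong_AE)
    show "AE x in lborel. (cmod (f x))\<^sup>2 = (cmod (g x))\<^sup>2"
      using a by (auto simp: L2_eq_def elim: AE_mp)
  qed (use a in \<open>auto simp: L2_eq_def square_integrable_def\<close>)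
  then show "sqrt (\<integral>x. (cmod (f x))\<^sup>2 \<partial>lborel) = sqrt (\<integral>x. (cmod (g x))\<^sup>2 \<partial>lborel)"
    by simp
qed

definition dist_L2 :: "'a L2 \<Rightarrow> 'a L2 \<Rightarrow> real" where
  "dist_L2 f g = norm (f - g)"

definition sgn_L2 :: "'a L2 \<Rightarrow> 'a L2" where
  "sgn_L2 f = inverse (norm f) *\<^sub>R f"

definition uniformity_L2 :: "('a L2 \<times> 'a L2) filter" where
  "uniformity_L2 = (INF e\<in>{0<..}. principal {(f, g). dist f g < e})"

definition open_L2 :: "'a L2 set \<Rightarrow> bool" where
  "open_L2 U \<longleftrightarrow> (\<forall>f\<in>U. \<forall>\<^sub>F (f', g) in uniformity. f' = f \<longrightarrow> g \<in> U)"

instance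
proof
  fix f g h :: "'a L2" and r s :: real
  show "f + g + h = f + (g + h)"
    by transfer (auto simp: L2_eq_def square_integrable_add add.assoc)
  show "f + g = g + f"
    by transfer (auto simp: L2_eq_def square_integrable_add add.commute)
  show "0 + f = f"
    by transfer (auto simp: L2_eq_def)
  show "- f + f = 0"
    by transfer (auto simp: L2_eq_def)
  show "f - g = f + - g"
    by transfer (auto simp: L2_eq_def square_integrable_diff)
  show "r *\<^sub>R (f + g) = r *\<^sub>R f + r *\<^sub>R g"
    by transfer (simp add: L2_eq_def square_integrable_add
        square_integrable_scaleR scaleR_add_left scaleR_add_right)
  show "(r + s) *\<^sub>R f = r *\<^sub>R f + s *\<^sub>R f"
    by transfer (simp add: L2_eq_def square_integrable_add
        square_integrable_scaleR scaleR_add_left scaleR_add_right)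
  show "r *\<^sub>R s *\<^sub>R f = (r * s) *\<^sub>R f"
    by transfer (simp add: L2_eq_def square_integrable_scaleR)
  show "1 *\<^sub>R f = f"
    by transfer (simp add: L2_eq_def)
  show "inner f g = inner g f"
    by transfer (simp add: inner_commute)
  show "inner (f + g) h = inner f h + inner g h"
    by transfer (simp add: inner_add_left square_integrable_inner L2_eq_def)
  show "inner (r *\<^sub>R f) g = r * inner f g"
    by transfer simp
  show "0 \<le> inner f f"
    by transfer simp
  show "inner f f = 0 \<longleftrightarrow> f = 0"
  proof transfer
    fix f :: "'a \<Rightarrow> complex"
    assume "L2_eq f f"
    then have f: "square_integrable f" by (simp add: L2_eq_def)
    have "(\<integral>x. inner (f x) (f x) \<partial>lborel) = 0 \<longleftrightarrow> (AE x in lborel. inner (f x) (f x) = 0)"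
      by (rule integral_nonneg_eq_0_iff_AE[OF square_integrable_inner[OF f f]]) simp
    then show "(\<integral>x. inner (f x) (f x) \<partial>lborel) = 0 \<longleftrightarrow> L2_eq f (\<lambda>_. 0)"
      using f by (simp add: L2_eq_def)
  qed
  show "norm f = sqrt (inner f f)"
    by transfer (simp add: power2_norm_eq_inner)
qed (simp_all add: dist_L2_def sgn_L2_def uniformity_L2_def open_L2_def)

end

section \<open>Bounded operators on \<open>L\<^sup>2(X)\<close>\<close>

lift_definition L2_times :: "('a::euclidean_space \<Rightarrow> complex) \<Rightarrow> 'a L2 \<Rightarrow> 'a L2" is
  "\<lambda>\<phi> f. if \<phi> \<in> borel_measurable borel \<and> bounded (range \<phi>) then (\<lambda>x. \<phi> x * f x) else (\<lambda>_. 0)"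
  by (auto simp: L2_eq_def square_integrable_bounded_mult elim: AE_mp)

lemma bounded_linear_L2_times:
  fixes \<phi> :: "'a::euclidean_space \<Rightarrow> complex"
  shows "bounded_linear (L2_times \<phi>)"
proof (cases "\<phi> \<in> borel_measurable borel \<and> bounded (range \<phi>)")
  case True
  then have m: "\<phi> \<in> borel_measurable borel" and bd: "bounded (range \<phi>)" by auto
  then obtain B where B: "\<And>x. cmod (\<phi> x) \<le> B" 
    by (auto simp: bounded_iff)
  then have B0: "0 \<le> B" using norm_ge_zero order_trans by blast
  show ?thesis
  proof (rule bounded_linear_intro[of _ B])
    show "L2_times \<phi> (f + g) = L2_times \<phi> f + L2_times \<phi> g" for f g
      using m bd by transfer
        (auto simp: L2_eq_def square_integrable_add square_integrable_bounded_mult algebra_simps)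
    show "L2_times \<phi> (r *\<^sub>R f) = r *\<^sub>R L2_times \<phi> f" for r f
      using m bd by transfer
        (auto simp: L2_eq_def square_integrable_bounded_mult
          intro!: square_integrable_bounded_mult square_integrable_scaleR)
    show "norm (L2_times \<phi> f) \<le> norm f * B" for f
    proof (transfer fixing: \<phi> B)
      fix f :: "'a \<Rightarrow> complex"
      assume "L2_eq f f"
      then have f: "square_integrable f" by (simp add: L2_eq_def)
      have "(\<integral>x. (cmod (\<phi> x * f x))\<^sup>2 \<partial>lborel) \<le> (\<integral>x. B\<^sup>2 * (cmod (f x))\<^sup>2 \<partial>lborel)"
      proof (rule integral_mono)
        show "integrable lborel (\<lambda>x. (cmod (\<phi> x * f x))\<^sup>2)"
          using square_integrable_bounded_mult[OF m bd f] by (simp add: square_integrable_def)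
        show "integrable lborel (\<lambda>x. B\<^sup>2 * (cmod (f x))\<^sup>2)"
          using f by (simp add: square_integrable_def)
        show "(cmod (\<phi> x * f x))\<^sup>2 \<le> B\<^sup>2 * (cmod (f x))\<^sup>2" for x
          by (simp add: norm_mult power_mult_distrib B mult_right_mono power_mono)
      qed
      also have "\<dots> = B\<^sup>2 * (\<integral>x. (cmod (f x))\<^sup>2 \<partial>lborel)" by simp
      finally have "sqrt (\<integral>x. (cmod (\<phi> x * f x))\<^sup>2 \<partial>lborel)
          \<le> sqrt (B\<^sup>2 * (\<integral>x. (cmod (f x))\<^sup>2 \<partial>lborel))"
        by simp
      also have "\<dots> = sqrt (\<integral>x. (cmod (f x))\<^sup>2 \<partial>lborel) * B"
        using B0 by (simp add: real_sqrt_mult)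
      finally show "sqrt (\<integral>x. (cmod ((if \<phi> \<in> borel_measurable borel \<and> bounded (range \<phi>)
            then \<lambda>x. \<phi> x * f x else (\<lambda>_. 0)) x))\<^sup>2 \<partial>lborel)
          \<le> sqrt (\<integral>x. (cmod (f x))\<^sup>2 \<partial>lborel) * B"
        using m bd by simp
    qed
  qed
next
  case False
  then have "L2_times \<phi> = (\<lambda>_. 0)"
    by (intro ext, transfer) (auto simp: L2_eq_def)
  then show ?thesis by simp
qed

text \<open>The operator \<open>\<phi>(Q)\<close>. The fallback value for \<open>\<phi>\<close> that is not a bounded Borel function is \<open>0\<close>.\<close>
lift_definition mult_op :: "('a::euclidean_space \<Rightarrow> complex) \<Rightarrow> 'a L2 \<Rightarrow>\<^sub>L 'a L2" is L2_times
  by (rule bounded_linear_L2_times)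

lemma mult_op_apply:
  fixes \<phi> f :: "'a::euclidean_space \<Rightarrow> complex"
  assumes "\<phi> \<in> borel_measurable borel" "bounded (range \<phi>)" "square_integrable f"
  shows "blinfun_apply (mult_op \<phi>) (abs_L2 f) = abs_L2 (\<lambda>x. \<phi> x * f x)"
proof -
  have "L2_eq f f" using assms by (simp add: L2_eq_def)
  then show ?thesis
    using assms by (simp add: mult_op.rep_eq L2_times.abs_eq)
qed

text \<open>The type \<open>'a L2 \<Rightarrow>\<^sub>L 'a L2\<close> consists of the bounded real-linear operators. Scalar
  multiplication by \<open>c \<in> \<complex>\<close> on \<open>L\<^sup>2(X)\<close> is multiplication by a constant function, and
  \<open>\<B>(L\<^sup>2(X))\<close> is the set of the operators which commute with all of these.\<close>
definition L2_operators :: "('a::euclidean_space L2 \<Rightarrow>\<^sub>L 'a L2) set" where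
  "L2_operators = {T. \<forall>c f. blinfun_apply T (L2_times (\<lambda>_. c) f) = L2_times (\<lambda>_. c) (blinfun_apply T f)}"

definition scaleC_op :: "complex \<Rightarrow> ('a::euclidean_space L2 \<Rightarrow>\<^sub>L 'a L2) \<Rightarrow> ('a L2 \<Rightarrow>\<^sub>L 'a L2)" where
  "scaleC_op c T = mult_op (\<lambda>_. c) o\<^sub>L T"

lemma mult_op_const_add: "mult_op (\<lambda>_. a + b) = mult_op (\<lambda>_. a) + mult_op (\<lambda>_. b)"
  by (rule blinfun_eqI, simp add: plus_blinfun.rep_eq mult_op.rep_eq, transfer)
    (auto simp: L2_eq_def square_integrable_add square_integrable_bounded_mult algebra_simps)

lemma mult_op_const_mult: "mult_op (\<lambda>_. a * b) = mult_op (\<lambda>_. a) o\<^sub>L mult_op (\<lambda>_. b)"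
  by (rule blinfun_eqI, simp add: mult_op.rep_eq, transfer)
    (auto simp: L2_eq_def square_integrable_bounded_mult mult.assoc)

lemma mult_op_const_one: "mult_op (\<lambda>_. 1) = id_blinfun"
  by (rule blinfun_eqI, simp add: mult_op.rep_eq, transfer) (auto simp: L2_eq_def)

global_interpretation op_C: vector_space
  "scaleC_op :: complex \<Rightarrow> ('a::euclidean_space L2 \<Rightarrow>\<^sub>L 'a L2) \<Rightarrow> _"
proof
  fix a b :: complex and T U :: "'a L2 \<Rightarrow>\<^sub>L 'a L2"
  show "scaleC_op a (T + U) = scaleC_op a T + scaleC_op a U"
    by (rule blinfun_eqI) (simp add: scaleC_op_def plus_blinfun.rep_eq blinfun.add_right)
  show "scaleC_op (a + b) T = scaleC_op a T + scaleC_op b T"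
    by (rule blinfun_eqI) (simp add: scaleC_op_def mult_op_const_add plus_blinfun.rep_eq)
  show "scaleC_op a (scaleC_op b T) = scaleC_op (a * b) T"
    by (rule blinfun_eqI) (simp add: scaleC_op_def mult_op_const_mult)
  show "scaleC_op 1 T = T"
    by (rule blinfun_eqI) (simp add: scaleC_op_def mult_op_const_one)
qed

definition closed_span :: "('a::euclidean_space L2 \<Rightarrow>\<^sub>L 'a L2) set \<Rightarrow> ('a L2 \<Rightarrow>\<^sub>L 'a L2) set" where
  "closed_span A = closure (op_C.span A)"

section \<open>The filter \<open>\<F>\<^sub>L\<close> and decay preserving operators\<close>

text \<open>The \<open>\<epsilon>\<close>-neighbourhood is written as a union of balls rather than with \<open>infdist\<close>, as
  \<open>infdist x {} = 0\<close>.\<close>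
definition thin :: "'a::euclidean_space set \<Rightarrow> 'a set \<Rightarrow> bool" where
  "thin L N \<longleftrightarrow> (\<forall>\<epsilon>>0. \<exists>r. N - ball 0 r \<subseteq> (\<Union>a\<in>L. ball a \<epsilon>))"

lemma thin_empty: "thin L {}"
  by (simp add: thin_def)

lemma thin_subset: "thin L N \<Longrightarrow> M \<subseteq> N \<Longrightarrow> thin L M"
  unfolding thin_def by (meson Diff_mono order_refl order_trans)

lemma thin_Un:
  assumes "thin L M" "thin L N"
  shows "thin L (M \<union> N)"
  unfolding thin_def
proof (intro allI impI)
  fix \<epsilon> :: real
  assume "\<epsilon> > 0"
  then obtain r s where "M - ball 0 r \<subseteq> (\<Union>a\<in>L. ball a \<epsilon>)" "N - ball 0 s \<subseteq> (\<Union>a\<in>L. ball a \<epsilon>)"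
    using assms unfolding thin_def by meson
  moreover have "ball 0 r \<subseteq> ball (0::'a) (max r s)" "ball 0 s \<subseteq> ball (0::'a) (max r s)"
    by (auto intro: subset_ball)
  ultimately show "\<exists>t. M \<union> N - ball 0 t \<subseteq> (\<Union>a\<in>L. ball a \<epsilon>)"
    by (intro exI[of _ "max r s"]) blast
qed

definition thin_filter :: "'a::euclidean_space set \<Rightarrow> 'a filter" where
  "thin_filter L = Abs_filter (\<lambda>P. thin L {x. \<not> P x})"

lemma eventually_thin_filter: "eventually P (thin_filter L) \<longleftrightarrow> thin L {x. \<not> P x}"
  unfolding thin_filter_def
proof (rule eventually_Abs_filter, rule is_filter.intro)
  show "thin L {x. \<not> True}" by (simp add: thin_empty)
  show "thin L {x. \<not> (P x \<and> Q x)}" if "thin L {x. \<not> P x}" "thin L {x. \<not> Q x}" for P Q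
    by (rule thin_subset[OF thin_Un[OF that]]) auto
  show "thin L {x. \<not> Q x}" if "\<forall>x. P x \<longrightarrow> Q x" "thin L {x. \<not> P x}" for P Q
    by (rule thin_subset[OF that(2)]) (use that(1) in auto)
qed

definition B_space :: "'a::euclidean_space set \<Rightarrow> ('a \<Rightarrow> complex) set" where
  "B_space L = {\<phi>. \<phi> \<in> borel_measurable borel \<and> bounded (range \<phi>) \<and> (\<phi> \<longlongrightarrow> 0) (thin_filter L)}"

lemma tendsto_thin_filter_iff:
  fixes \<phi> :: "'a::euclidean_space \<Rightarrow> complex"
  shows "(\<phi> \<longlongrightarrow> 0) (thin_filter L) \<longleftrightarrow> (\<forall>t>0. thin L {x. cmod (\<phi> x) \<ge> t})"
  by (simp add: tendsto_iff eventually_thin_filter not_less)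

definition decay_preserving ::
  "'a::euclidean_space set \<Rightarrow> ('a L2 \<Rightarrow>\<^sub>L 'a L2) \<Rightarrow> bool" where
  "decay_preserving L S \<longleftrightarrow> (\<forall>\<phi>\<in>B_space L.
     S o\<^sub>L mult_op \<phi> \<in> closed_span {mult_op \<psi> o\<^sub>L T | \<psi> T. \<psi> \<in> B_space L \<and> T \<in> L2_operators} \<and>
     mult_op \<phi> o\<^sub>L S \<in> closed_span {T o\<^sub>L mult_op \<psi> | \<psi> T. \<psi> \<in> B_space L \<and> T \<in> L2_operators})"

section \<open>Distributions and distribution kernels\<close>

fun partial_deriv :: "'a::euclidean_space list \<Rightarrow> ('a \<Rightarrow> complex) \<Rightarrow> 'a \<Rightarrow> complex" where
  "partial_deriv [] f = f"
| "partial_deriv (b # bs) f = (\<lambda>x. frechet_derivative (partial_deriv bs f) (at x) b)"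

text \<open>The multi-indices of order at most \<open>N\<close>, as lists of directions.\<close>
definition multi_indices :: "nat \<Rightarrow> 'a::euclidean_space list set" where
  "multi_indices N = {bs. set bs \<subseteq> Basis \<and> length bs \<le> N}"

lemma finite_multi_indices: "finite (multi_indices N)"
  unfolding multi_indices_def by (rule finite_lists_length_le) simp

definition smooth :: "('a::euclidean_space \<Rightarrow> complex) \<Rightarrow> bool" where
  "smooth f \<longleftrightarrow> (\<forall>bs. set bs \<subseteq> Basis \<longrightarrow> (\<forall>x. partial_deriv bs f differentiable (at x)))"

definition supp :: "('a::euclidean_space \<Rightarrow> complex) \<Rightarrow> 'a set" where
  "supp f = closure {x. f x \<noteq> 0}"

definition test_functions :: "'a::euclidean_space set \<Rightarrow> ('a \<Rightarrow> complex) set" where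
  "test_functions U = {f. smooth f \<and> compact (supp f) \<and> supp f \<subseteq> U}"

definition distribution :: "(('a::euclidean_space \<Rightarrow> complex) \<Rightarrow> complex) \<Rightarrow> bool" where
  "distribution u \<longleftrightarrow>
     (\<forall>f\<in>test_functions UNIV. \<forall>g\<in>test_functions UNIV. u (\<lambda>x. f x + g x) = u f + u g) \<and>
     (\<forall>c. \<forall>f\<in>test_functions UNIV. u (\<lambda>x. c * f x) = c * u f) \<and>
     (\<forall>K. compact K \<longrightarrow> (\<exists>C N. \<forall>f\<in>test_functions K.
        cmod (u f) \<le> C * (\<Sum>bs\<in>multi_indices N. SUP x. cmod (partial_deriv bs f x))))"

text \<open>The distribution \<open>u\<close> is, on the open set \<open>U\<close>, the locally integrable function \<open>k\<close>.
  The values of \<open>k\<close> outside \<open>U\<close> are irrelevant.\<close>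
definition is_function_on ::
  "(('a::euclidean_space \<Rightarrow> complex) \<Rightarrow> complex) \<Rightarrow> 'a set \<Rightarrow> ('a \<Rightarrow> complex) \<Rightarrow> bool" where
  "is_function_on u U k \<longleftrightarrow>
     (\<forall>K. compact K \<longrightarrow> K \<subseteq> U \<longrightarrow> set_integrable lborel K k) \<and>
     (\<forall>f\<in>test_functions U. u f = (LINT x:U|lborel. k x * f x))"

text \<open>The kernel of \<open>S\<close> in the sense of the Schwartz kernel theorem: the distribution on \<open>X \<times> X\<close>
  with \<open>\<langle>K, g \<otimes> f\<rangle> = \<integral> g(x) (S f)(x) dx\<close>, formally \<open>(S f)(x) = \<integral> K(x,y) f(y) dy\<close>.\<close>
definition distribution_kernel ::
  "('a::euclidean_space L2 \<Rightarrow>\<^sub>L 'a L2) \<Rightarrow> (('a \<times> 'a \<Rightarrow> complex) \<Rightarrow> complex) \<Rightarrow> bool" where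
  "distribution_kernel S K \<longleftrightarrow> distribution K \<and>
     (\<forall>f\<in>test_functions UNIV. \<forall>g\<in>test_functions UNIV.
        K (\<lambda>(x, y). g x * f y) = (\<integral>x. g x * rep_L2 (blinfun_apply S (abs_L2 f)) x \<partial>lborel))"

lemma test_functions_square_integrable:
  assumes "f \<in> test_functions U"
  shows "square_integrable f"
proof -
  have d: "f differentiable (at x)" for x
    using assms by (auto simp: test_functions_def smooth_def dest!: spec[of _ "[]"])
  then have c: "continuous_on A f" for A
    by (meson continuous_at_imp_continuous_on differentiable_imp_continuous_within)
  have K: "compact (supp f)" using assms by (simp add: test_functions_def)
  have "integrable lborel (\<lambda>x. indicator (supp f) x *\<^sub>R (cmod (f x))\<^sup>2)"
    by (rule borel_integrable_compact[OF K]) (intro continuous_intros c)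
  moreover have "(\<lambda>x. indicator (supp f) x *\<^sub>R (cmod (f x))\<^sup>2) = (\<lambda>x. (cmod (f x))\<^sup>2)"
    using closure_subset[of "{x. f x \<noteq> 0}"] by (auto simp: supp_def indicator_def fun_eq_iff)
  ultimately show ?thesis
    using borel_measurable_continuous_onI[OF c] by (simp add: square_integrable_def)
qed

end

theory Submission
  imports Defs
begin

text \<open>Let \<open>1\<^sub>E\<close> be multiplication by the indicator function of \<open>E\<close>. A function \<open>\<phi>\<close> in \<open>B\<^sub>L(X)\<close> is
  uniformly small off the thin set \<open>N = {\<bar>\<phi>\<bar> \<ge> \<lambda>}\<close>, so it suffices to find for each thin \<open>N\<close> and each
  \<open>\<eta> > 0\<close> a thin \<open>M\<close> such that \<open>1\<^sub>X\<^sub>-\<^sub>M S 1\<^sub>N\<close> and \<open>1\<^sub>N S 1\<^sub>X\<^sub>-\<^sub>M\<close> have norm at most \<open>\<eta>\<close>.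

  If \<open>A\<close> and \<open>B\<close> are at positive distance, the kernel bound and the Schur test estimate \<open>1\<^sub>A S 1\<^sub>B\<close>.
  Since \<open>m > n\<close> the tails of \<open>|x - y|\<^sup>-\<^sup>m\<close> are integrable, and since \<open>L\<close> is uniformly discrete its
  \<open>\<epsilon>\<close>-neighbourhood has small measure in each ball of fixed radius; so for fixed \<open>\<delta>\<close> the norm for
  \<open>A\<close> the complement of \<open>L\<^sub>\<delta>\<close> and \<open>B = L\<^sub>\<epsilon>\<close> tends to \<open>0\<close> with \<open>\<epsilon>\<close>. It also tends to \<open>0\<close> when \<open>B\<close> is
  bounded and \<open>A\<close> is the complement of a ball of growing radius. Now let \<open>\<delta>\<^sub>j \<rightarrow> 0\<close> and cut \<open>N\<close> into bounded
  shells \<open>N\<^sub>j\<close> contained in \<open>L\<^sub>\<epsilon>\<close> for \<open>\<epsilon> = \<epsilon>\<^sub>j\<close> so small that the errors form a geometric series. Then the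
  union of the bounded sets \<open>L\<^sub>\<delta> \<inter> B(R\<^sub>j)\<close>, \<open>\<delta> = \<delta>\<^sub>j\<close>, with \<open>R\<^sub>j\<close> large, is a suitable \<open>M\<close>.\<close>

section \<open>Smooth bump functions on boxes\<close>

text \<open>The factor \<open>1 / s ^ k\<close> is there because differentiating
  \<open>exp (- c / s)\<close> produces negative powers of \<open>s\<close>. With it the family is
  closed under differentiation up to linear combinations.\<close>

definition flat_exp :: "real \<Rightarrow> nat \<Rightarrow> real \<Rightarrow> real" where
  "flat_exp c k s = (if 0 < s then exp (- c / s) / s ^ k else 0)"

lemma flat_exp_mult_power: "s ^ j * flat_exp c (j + k) s = flat_exp c k s"
  by (simp add: flat_exp_def power_add)

text \<open>To the right of 0, the substitution \<open>v = c / s\<close> gives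
  \<open>v ^ k / exp v\<close>, up to the factor \<open>1 / c ^ k\<close>, with \<open>v\<close>
  tending to infinity. To the left the function vanishes.\<close>

lemma flat_exp_tendsto_0:
  assumes "c > 0"
  shows "(flat_exp c k \<longlongrightarrow> 0) (at 0)"
proof (rule filterlim_split_at)
  have "\<forall>\<^sub>F s in at_left 0. flat_exp c k s = 0"
    by (auto simp: flat_exp_def eventually_at_filter)
  then show "(flat_exp c k \<longlongrightarrow> 0) (at_left 0)"
    by (rule tendsto_eventually)
  have "filterlim (\<lambda>s::real. c / s) at_top (at_right 0)"
    unfolding divide_inverse
    by (rule filterlim_tendsto_pos_mult_at_top[OF tendsto_const assms filterlim_inverse_at_top_right])
  then have "((\<lambda>s. (c / s) ^ k / exp (c / s)) \<longlongrightarrow> 0) (at_right 0)"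
    by (rule filterlim_compose[OF tendsto_power_div_exp_0])
  then have "((\<lambda>s. (c / s) ^ k / exp (c / s) / c ^ k) \<longlongrightarrow> 0 / c ^ k) (at_right 0)"
    by (rule tendsto_divide) (use assms in auto)
  moreover have "\<forall>\<^sub>F s in at_right 0. (c / s) ^ k / exp (c / s) / c ^ k = flat_exp c k s"
    using assms by (auto simp: flat_exp_def eventually_at_filter exp_minus field_simps)
  ultimately show "(flat_exp c k \<longlongrightarrow> 0) (at_right 0)"
    by (simp add: tendsto_cong)
qed

lemma DERIV_flat_exp:
  assumes "c > 0"
  shows "(flat_exp c k has_real_derivative c * flat_exp c (k + 2) s - k * flat_exp c (k + 1) s) (at s)"
proof -
  consider "s > 0" | "s < 0" | "s = 0" by linarith
  then show ?thesis
  proof cases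
    case 1
    have "((\<lambda>s. inverse (s ^ k)) has_real_derivative - (real k / s ^ (k + 1))) (at s)"
    proof -
      have "((\<lambda>s. inverse (s ^ k)) has_real_derivative
          - (inverse (s ^ k) * (real k * s ^ (k - Suc 0)) * inverse (s ^ k))) (at s)"
        using 1 by (auto intro!: derivative_eq_intros)
      moreover have "inverse (s ^ k) * (real k * s ^ (k - Suc 0)) * inverse (s ^ k) = real k / s ^ (k + 1)"
        using 1 by (cases k) (auto simp: field_simps)
      ultimately show ?thesis by simp
    qed
    moreover have "((\<lambda>s. exp (- c / s)) has_real_derivative exp (- c / s) * (c / s\<^sup>2)) (at s)"
      using 1 by (auto intro!: derivative_eq_intros simp: power2_eq_square)
    ultimately have "((\<lambda>s. exp (- c / s) * inverse (s ^ k)) has_real_derivative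
        exp (- c / s) * (c / s\<^sup>2) * inverse (s ^ k) + - (real k / s ^ (k + 1)) * exp (- c / s)) (at s)"
      by (rule DERIV_mult[rotated])
    moreover have "exp (- c / s) * (c / s\<^sup>2) * inverse (s ^ k) + - (real k / s ^ (k + 1)) * exp (- c / s)
        = c * flat_exp c (k + 2) s - k * flat_exp c (k + 1) s"
      using 1 by (simp add: flat_exp_def power_add power2_eq_square divide_inverse algebra_simps)
    ultimately have "((\<lambda>s. exp (- c / s) * inverse (s ^ k)) has_real_derivative
        c * flat_exp c (k + 2) s - k * flat_exp c (k + 1) s) (at s)"
      by simp
    then show ?thesis
      by (rule has_field_derivative_transform_within_open[where S = "{0<..}"])
        (use 1 in \<open>auto simp: flat_exp_def field_simps\<close>)
  next
    case 2
    have "((\<lambda>s. 0) has_real_derivative c * flat_exp c (k + 2) s - k * flat_exp c (k + 1) s) (at s)"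
      using 2 by (auto simp: flat_exp_def)
    then show ?thesis
      by (rule has_field_derivative_transform_within_open[where S = "{..<0}"])
        (use 2 in \<open>auto simp: flat_exp_def\<close>)
  next
    case 3
    \<comment> \<open>At 0 the difference quotient is again a member of the family, with
      \<open>k\<close> raised by one, so it tends to 0, which is the value of the claimed derivative
      there.\<close>
    have "\<forall>\<^sub>F h in at 0. flat_exp c (Suc k) h = flat_exp c k h / h"
      by (auto simp: flat_exp_def eventually_at_filter)
    then have "((\<lambda>h. flat_exp c k h / h) \<longlongrightarrow> 0) (at 0)"
      using flat_exp_tendsto_0[OF assms, of "Suc k"] by (rule Lim_transform_eventually[rotated])
    then show ?thesis
      using 3 by (simp add: DERIV_def flat_exp_def)
  qed
qed

text \<open>With \<open>w j\<close> for \<open>flat_exp c j (poly u t)\<close>, the derivative of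
  \<open>q * w (2 * n)\<close> is \<open>q' * w (2 * n) + q * u' * (c * w (2 * n + 2) - 2 * n * w (2
  * n + 1))\<close>. Each \<open>w\<close> here is a power of \<open>u\<close> times
  \<open>w (2 * n + 2)\<close>; the factor that remains is given by this recursion.\<close>

primrec bump_poly :: "real \<Rightarrow> real poly \<Rightarrow> nat \<Rightarrow> real poly" where
  "bump_poly c u 0 = 1"
| "bump_poly c u (Suc n) = pderiv (bump_poly c u n) * u\<^sup>2
     + bump_poly c u n * pderiv u * ([:c:] - of_nat (2 * n) * u)"

text \<open>The \<open>n\<close>-th derivative of \<open>exp (- c / u)\<close>, extended by \<open>0\<close> to where \<open>u \<le> 0\<close>, is a polynomial
  times \<open>exp (- c / u) / u ^ (2 * n)\<close>.\<close>
definition bump_deriv :: "real \<Rightarrow> real poly \<Rightarrow> nat \<Rightarrow> real \<Rightarrow> real" where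
  "bump_deriv c u n t = poly (bump_poly c u n) t * flat_exp c (2 * n) (poly u t)"

lemma DERIV_bump_deriv:
  assumes "c > 0"
  shows "(bump_deriv c u n has_real_derivative bump_deriv c u (Suc n) t) (at t)"
proof -
  let ?q = "bump_poly c u n" and ?s = "poly u t"
  let ?w = "flat_exp c (2 * n)" and ?w2 = "flat_exp c (2 * n + 2) ?s"
  have w: "?w ?s = ?s\<^sup>2 * ?w2" "flat_exp c (2 * n + 1) ?s = ?s * ?w2"
    using flat_exp_mult_power[of ?s 2 c "2 * n"] flat_exp_mult_power[of ?s 1 c "2 * n + 1"]
    by (simp_all add: add.commute)
  have "((\<lambda>t. poly ?q t * ?w (poly u t)) has_real_derivative
      poly (pderiv ?q) t * ?w ?s + (c * ?w2 - real (2 * n) * flat_exp c (2 * n + 1) ?s) * poly (pderiv u) t * poly ?q t) (at t)"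
    by (intro DERIV_mult poly_DERIV DERIV_chain2[OF DERIV_flat_exp[OF assms]])
  moreover have "poly (pderiv ?q) t * ?w ?s + (c * ?w2 - real (2 * n) * flat_exp c (2 * n + 1) ?s) * poly (pderiv u) t * poly ?q t
      = bump_deriv c u (Suc n) t"
    unfolding bump_deriv_def w by (simp add: algebra_simps power2_eq_square)
  ultimately show ?thesis unfolding bump_deriv_def by simp
qed

text \<open>A derivative in a basis direction acts on one factor only and raises its order by one,
  so a list of directions matters only through its multiplicities. The orders
  \<open>\<kappa>\<close> are arbitrary in the first claim so that it covers every iterated
  derivative.\<close>

lemma partial_deriv_prod:
  fixes G :: "'a::euclidean_space \<Rightarrow> nat \<Rightarrow> real \<Rightarrow> real"
  assumes G: "\<And>i n t. (G i n has_real_derivative G i (Suc n) t) (at t)"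
  shows "\<And>x. (\<lambda>x. complex_of_real (\<Prod>i\<in>Basis. G i (\<kappa> i) (x \<bullet> i))) differentiable (at x)"
    and "set bs \<subseteq> Basis \<Longrightarrow> partial_deriv bs (\<lambda>x. complex_of_real (\<Prod>i\<in>Basis. G i 0 (x \<bullet> i)))
      = (\<lambda>x. complex_of_real (\<Prod>i\<in>Basis. G i (count_list bs i) (x \<bullet> i)))"
proof -
  have d: "((\<lambda>x. complex_of_real (\<Prod>i\<in>Basis. G i (\<kappa> i) (x \<bullet> i))) has_derivative
      (\<lambda>h. complex_of_real (\<Sum>i\<in>Basis. G i (Suc (\<kappa> i)) (x \<bullet> i) * (h \<bullet> i) * (\<Prod>j\<in>Basis - {i}. G j (\<kappa> j) (x \<bullet> j))))) (at x)"
    for \<kappa> x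
  proof (intro has_derivative_of_real has_derivative_prod)
    fix i :: 'a
    have "((\<lambda>x. x \<bullet> i) has_derivative (\<lambda>h. h \<bullet> i)) (at x)"
      by (intro derivative_eq_intros) auto
    from has_derivative_compose[OF this G[unfolded has_field_derivative_def]]
    show "((\<lambda>x. G i (\<kappa> i) (x \<bullet> i)) has_derivative (\<lambda>h. G i (Suc (\<kappa> i)) (x \<bullet> i) * (h \<bullet> i))) (at x)"
      by simp
  qed
  then show "\<And>x. (\<lambda>x. complex_of_real (\<Prod>i\<in>Basis. G i (\<kappa> i) (x \<bullet> i))) differentiable (at x)"
    unfolding differentiable_def by blast
  show "partial_deriv bs (\<lambda>x. complex_of_real (\<Prod>i\<in>Basis. G i 0 (x \<bullet> i)))
      = (\<lambda>x. complex_of_real (\<Prod>i\<in>Basis. G i (count_list bs i) (x \<bullet> i)))" if "set bs \<subseteq> Basis"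
    using that
  proof (induction bs)
    case (Cons b bs)
    then have b: "b \<in> Basis" by simp
    have "frechet_derivative (\<lambda>x. complex_of_real (\<Prod>i\<in>Basis. G i (count_list bs i) (x \<bullet> i))) (at x) b
      = complex_of_real (\<Prod>i\<in>Basis. G i (count_list (b # bs) i) (x \<bullet> i))" for x
    proof -
      have "(\<Sum>i\<in>Basis. G i (Suc (count_list bs i)) (x \<bullet> i) * (b \<bullet> i) * (\<Prod>j\<in>Basis - {i}. G j (count_list bs j) (x \<bullet> j)))
        = (\<Sum>i\<in>Basis. if i = b then G i (Suc (count_list bs i)) (x \<bullet> i) * (\<Prod>j\<in>Basis - {i}. G j (count_list bs j) (x \<bullet> j)) else 0)"
        using b by (intro sum.cong) (auto simp: inner_Basis)
      also have "\<dots> = G b (Suc (count_list bs b)) (x \<bullet> b) * (\<Prod>j\<in>Basis - {b}. G j (count_list bs j) (x \<bullet> j))"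
        using b by simp
      also have "(\<Prod>j\<in>Basis - {b}. G j (count_list bs j) (x \<bullet> j))
          = (\<Prod>j\<in>Basis - {b}. G j (count_list (b # bs) j) (x \<bullet> j))"
        by (intro prod.cong) auto
      also have "G b (Suc (count_list bs b)) (x \<bullet> b) * \<dots>
          = (\<Prod>i\<in>Basis. G i (count_list (b # bs) i) (x \<bullet> i))"
        by (subst prod.remove[OF _ b]) simp_all
      finally show ?thesis
        by (subst frechet_derivative_at[OF d, symmetric]) simp
    qed
    then show ?case using Cons by simp
  qed simp
qed

definition box_poly :: "'a::euclidean_space \<Rightarrow> 'a \<Rightarrow> 'a \<Rightarrow> real poly" where
  "box_poly a b i = [:- (a \<bullet> i) * (b \<bullet> i), a \<bullet> i + b \<bullet> i, -1:]"

lemma poly_box_poly: "poly (box_poly a b i) t = (t - a \<bullet> i) * (b \<bullet> i - t)"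
  by (simp add: box_poly_def algebra_simps)

text \<open>\<open>c\<close> stays a parameter because the bumps tend to the indicator of the open
  box as \<open>c\<close> tends to 0. The product over coordinates lets bumps on product boxes
  factor.\<close>

definition box_bump :: "real \<Rightarrow> 'a::euclidean_space \<Rightarrow> 'a \<Rightarrow> 'a \<Rightarrow> complex" where
  "box_bump c a b x =
     complex_of_real (\<Prod>i\<in>Basis. bump_deriv c (box_poly a b i) 0 (x \<bullet> i))"

lemma box_bump_eq:
  assumes "\<And>i. i \<in> Basis \<Longrightarrow> a \<bullet> i < b \<bullet> i"
  shows "box_bump c a b x =
    (if x \<in> box a b then exp (- c * (\<Sum>i\<in>Basis. 1 / ((x \<bullet> i - a \<bullet> i) * (b \<bullet> i - x \<bullet> i)))) else 0)"
proof -
  have f: "bump_deriv c (box_poly a b i) 0 (x \<bullet> i)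
      = (if a \<bullet> i < x \<bullet> i \<and> x \<bullet> i < b \<bullet> i then exp (- c * (1 / ((x \<bullet> i - a \<bullet> i) * (b \<bullet> i - x \<bullet> i)))) else 0)"
    if "i \<in> Basis" for i
    using assms[OF that] unfolding bump_deriv_def poly_box_poly flat_exp_def
    by (auto simp: zero_less_mult_iff)
  show ?thesis
  proof (cases "x \<in> box a b")
    case True
    then have "(\<Prod>i\<in>Basis. bump_deriv c (box_poly a b i) 0 (x \<bullet> i))
       = (\<Prod>i\<in>Basis. exp (- c * (1 / ((x \<bullet> i - a \<bullet> i) * (b \<bullet> i - x \<bullet> i)))))"
      by (intro prod.cong) (auto simp: f mem_box)
    also have "\<dots> = exp (- c * (\<Sum>i\<in>Basis. 1 / ((x \<bullet> i - a \<bullet> i) * (b \<bullet> i - x \<bullet> i))))"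
      by (simp add: exp_sum[symmetric] sum_distrib_left sum_negf)
    finally show ?thesis using True by (simp add: box_bump_def exp_of_real)
  next
    case False
    then obtain i where "i \<in> Basis" "\<not> (a \<bullet> i < x \<bullet> i \<and> x \<bullet> i < b \<bullet> i)"
      by (auto simp: mem_box)
    then have "(\<Prod>i\<in>Basis. bump_deriv c (box_poly a b i) 0 (x \<bullet> i)) = 0"
      by (intro prod_zero) (auto simp: f intro!: bexI[of _ i])
    then show ?thesis using False by (simp add: box_bump_def)
  qed
qed

lemma box_bump_test_function:
  assumes "\<And>i. i \<in> Basis \<Longrightarrow> a \<bullet> i < b \<bullet> i" "c > 0" "cbox a b \<subseteq> U"
  shows "box_bump c a b \<in> test_functions U"
proof -
  have "smooth (box_bump c a b)"
    unfolding smooth_def box_bump_def[abs_def]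
  proof (intro allI impI)
    fix bs :: "'a list" and x
    assume "set bs \<subseteq> Basis"
    note eq = partial_deriv_prod(2)[where G = "\<lambda>i. bump_deriv c (box_poly a b i)",
        OF DERIV_bump_deriv[OF assms(2)] this]
    show "partial_deriv bs (\<lambda>x. complex_of_real (\<Prod>i\<in>Basis. bump_deriv c (box_poly a b i) 0 (x \<bullet> i)))
        differentiable (at x)"
      unfolding eq by (rule partial_deriv_prod(1)[where G = "\<lambda>i. bump_deriv c (box_poly a b i)",
            OF DERIV_bump_deriv[OF assms(2)]])
  qed
  moreover have "supp (box_bump c a b) \<subseteq> cbox a b"
    unfolding supp_def using box_subset_cbox
    by (intro closure_minimal) (auto simp: box_bump_eq[OF assms(1)] split: if_splits)
  moreover from this have "compact (supp (box_bump c a b))"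
    unfolding supp_def by (metis closed_closure compact_cbox compact_Int_closed inf.absorb_iff2)
  ultimately show ?thesis using assms(3) by (auto simp: test_functions_def)
qed

text \<open>This makes the tensor product of two bumps a test function on the product space, so that
  both \<open>distribution_kernel\<close> and \<open>is_function_on\<close> can be applied to
  it.\<close>

lemma box_bump_Pair:
  "box_bump c (a, a') (b, b') (x, y) = box_bump c a b x * box_bump c a' b' y"
proof -
  have "(\<Prod>i\<in>Basis. f i) = (\<Prod>i\<in>Basis. f (i, 0)) * (\<Prod>i\<in>Basis. f (0, i))"
    for f :: "'a \<times> 'b \<Rightarrow> real"
    unfolding Basis_prod_def
    by (subst prod.union_disjoint) (auto simp: prod.reindex inj_on_def)
  then show ?thesis
    by (simp add: box_bump_def box_poly_def)
qed

lemma box_bump_norm_le: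
  assumes "\<And>i. i \<in> Basis \<Longrightarrow> a \<bullet> i < b \<bullet> i" "c > 0"
  shows "cmod (box_bump c a b x) \<le> indicator (box a b) x"
proof (cases "x \<in> box a b")
  case True
  then have "0 \<le> (\<Sum>i\<in>Basis. 1 / ((x \<bullet> i - a \<bullet> i) * (b \<bullet> i - x \<bullet> i)))"
    by (intro sum_nonneg) (auto simp: mem_box intro!: mult_nonneg_nonneg less_imp_le)
  then show ?thesis using True assms(2) by (simp add: box_bump_eq[OF assms(1)])
qed (simp add: box_bump_eq[OF assms(1)])

lemma box_bump_tendsto:
  assumes "\<And>i. i \<in> Basis \<Longrightarrow> a \<bullet> i < b \<bullet> i"
  shows "(\<lambda>n. box_bump (1 / real (Suc n)) a b x) \<longlonglongrightarrow> indicator (box a b) x"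
proof (cases "x \<in> box a b")
  case True
  let ?s = "\<Sum>i\<in>Basis. 1 / ((x \<bullet> i - a \<bullet> i) * (b \<bullet> i - x \<bullet> i))"
  have "(\<lambda>n. complex_of_real (exp (- (1 / real (Suc n)) * ?s))) \<longlonglongrightarrow> complex_of_real (exp (- 0 * ?s))"
    by (intro tendsto_intros LIMSEQ_Suc[OF lim_1_over_n])
  then show ?thesis using True
    by (simp only: box_bump_eq[OF assms] if_True indicator_simps) simp
qed (simp add: box_bump_eq[OF assms])

section \<open>Convergence and duality in \<open>L\<^sup>2\<close>\<close>

lemma square_integrable_rep_L2: "square_integrable (rep_L2 F)"
  using Quotient3_rep_reflp[OF Quotient3_L2, of F] by (simp add: L2_eq_def)

lemma borel_measurable_rep_L2 [measurable]: "rep_L2 F \<in> borel_measurable borel"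
  by (rule square_integrable_measurable[OF square_integrable_rep_L2])

lemma abs_rep_L2 [simp]: "abs_L2 (rep_L2 F) = F"
  by (rule Quotient3_abs_rep[OF Quotient3_L2])

lemma rep_abs_L2_AE: "square_integrable f \<Longrightarrow> AE x in lborel. rep_L2 (abs_L2 f) x = f x"
  using Quotient3_rep_abs[OF Quotient3_L2, of f] by (simp add: L2_eq_def)

lemma norm_abs_L2:
  "square_integrable f \<Longrightarrow> norm (abs_L2 f) = sqrt (\<integral>x. (cmod (f x))\<^sup>2 \<partial>lborel)"
  by (simp add: norm_L2.abs_eq L2_eq_def)

lemma abs_L2_add:
  "square_integrable f \<Longrightarrow> square_integrable g \<Longrightarrow> abs_L2 (\<lambda>x. f x + g x) = abs_L2 f + abs_L2 g"
  by (simp add: plus_L2.abs_eq L2_eq_def)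

lemma abs_L2_diff:
  "square_integrable f \<Longrightarrow> square_integrable g \<Longrightarrow> abs_L2 (\<lambda>x. f x - g x) = abs_L2 f - abs_L2 g"
  by (simp add: minus_L2.abs_eq L2_eq_def)

lemma L2_times_abs_L2:
  "\<phi> \<in> borel_measurable borel \<Longrightarrow> bounded (range \<phi>) \<Longrightarrow> square_integrable f \<Longrightarrow>
    L2_times \<phi> (abs_L2 f) = abs_L2 (\<lambda>x. \<phi> x * f x)"
  by (simp add: L2_times.abs_eq L2_eq_def)

lemma square_integrable_scaleC:
  "square_integrable f \<Longrightarrow> square_integrable (\<lambda>x. c * f x)"
  using square_integrable_bounded_mult[of "\<lambda>_. c" f] by simp

lemma L2_operator_scaleC:
  assumes "S \<in> L2_operators" "square_integrable f"
  shows "blinfun_apply S (abs_L2 (\<lambda>x. c * f x)) = abs_L2 (\<lambda>x. c * rep_L2 (blinfun_apply S (abs_L2 f)) x)"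
proof -
  have "abs_L2 (\<lambda>x. c * g x) = L2_times (\<lambda>_. c) (abs_L2 g)" if "square_integrable g" for g :: "'a \<Rightarrow> complex"
    using L2_times_abs_L2[of "\<lambda>_. c" g] that by simp
  then show ?thesis
    using assms by (simp add: L2_operators_def square_integrable_rep_L2)
qed

lemma square_integrable_mono:
  assumes "square_integrable g" "f \<in> borel_measurable borel" "\<And>x. cmod (f x) \<le> cmod (g x)"
  shows "square_integrable f"
  by (rule square_integrable_dominated[OF assms(2), where g = "\<lambda>x. (cmod (g x))\<^sup>2"])
    (use assms in \<open>auto simp: square_integrable_def intro: power_mono\<close>)

lemma integrable_mult_square_integrable:
  assumes "square_integrable f" "square_integrable g"
  shows "integrable lborel (\<lambda>x. f x * g x)"
proof (rule Bochner_Integration.integrable_bound)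
  show "integrable lborel (\<lambda>x. (cmod (f x))\<^sup>2 + (cmod (g x))\<^sup>2)"
    using assms by (auto simp: square_integrable_def)
  show "(\<lambda>x. f x * g x) \<in> borel_measurable lborel"
    using assms by (auto simp: square_integrable_def)
  have "a * b \<le> a\<^sup>2 + b\<^sup>2" if "0 \<le> a" "0 \<le> b" for a b :: real
  proof -
    have "0 \<le> (a - b)\<^sup>2" "0 \<le> a * b" using that by simp_all
    then show ?thesis unfolding power2_diff by linarith
  qed
  then show "AE x in lborel. norm (f x * g x) \<le> norm ((cmod (f x))\<^sup>2 + (cmod (g x))\<^sup>2)"
    by (simp add: norm_mult)
qed

lemma integral_mult_le_norm:
  assumes "square_integrable f" "square_integrable g"
  shows "cmod (\<integral>x. f x * g x \<partial>lborel) \<le> norm (abs_L2 f) * norm (abs_L2 g)"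
proof -
  let ?n = "\<lambda>f x. complex_of_real (cmod (f x))"
  have sq: "square_integrable (?n f)" "square_integrable (?n g)"
    using assms by (auto simp: square_integrable_def)
  have "cmod (\<integral>x. f x * g x \<partial>lborel) \<le> (\<integral>x. cmod (f x * g x) \<partial>lborel)"
    by (rule integral_norm_bound)
  also have "\<dots> = (\<integral>x. inner (?n f x) (?n g x) \<partial>lborel)"
    by (simp add: norm_mult inner_complex_def)
  also have "\<dots> = inner (abs_L2 (?n f)) (abs_L2 (?n g))"
    using sq by (simp add: inner_L2.abs_eq L2_eq_def)
  also have "\<dots> \<le> norm (abs_L2 (?n f)) * norm (abs_L2 (?n g))"
    by (rule norm_cauchy_schwarz)
  also have "\<dots> = norm (abs_L2 f) * norm (abs_L2 g)"
    using sq assms by (simp add: norm_abs_L2)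
  finally show ?thesis .
qed

text \<open>Bilinear, with no conjugation, to match the integral in
  \<open>distribution_kernel\<close>.\<close>

definition pairing :: "('a::euclidean_space \<Rightarrow> complex) \<Rightarrow> 'a L2 \<Rightarrow> complex" where
  "pairing g F = (\<integral>x. g x * rep_L2 F x \<partial>lborel)"

lemma pairing_abs_L2:
  assumes "square_integrable g" "square_integrable f"
  shows "pairing g (abs_L2 f) = (\<integral>x. g x * f x \<partial>lborel)"
  unfolding pairing_def
proof (rule integral_cong_AE)
  show "AE x in lborel. g x * rep_L2 (abs_L2 f) x = g x * f x"
    using rep_abs_L2_AE[OF assms(2)] by eventually_elim simp
qed (use assms in \<open>auto simp: square_integrable_def\<close>)

lemma norm_pairing_le:
  "square_integrable g \<Longrightarrow> cmod (pairing g F) \<le> norm (abs_L2 g) * norm F"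
  unfolding pairing_def using integral_mult_le_norm[OF _ square_integrable_rep_L2, of g F] by simp

lemma pairing_add_left:
  "square_integrable g \<Longrightarrow> square_integrable h \<Longrightarrow> pairing (\<lambda>x. g x + h x) F = pairing g F + pairing h F"
  unfolding pairing_def
  by (simp add: distrib_right integrable_mult_square_integrable square_integrable_rep_L2)

lemma pairing_diff_left:
  "square_integrable g \<Longrightarrow> square_integrable h \<Longrightarrow> pairing (\<lambda>x. g x - h x) F = pairing g F - pairing h F"
  unfolding pairing_def
  by (simp add: left_diff_distrib integrable_mult_square_integrable square_integrable_rep_L2)

lemma pairing_scale_left: "pairing (\<lambda>x. c * g x) F = c * pairing g F"
  unfolding pairing_def by (simp add: mult.assoc)

text \<open>\<open>rep_L2\<close> is additive only almost everywhere, so \<open>F + G\<close> is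
  first written as the class of the sum of the representatives.\<close>

lemma pairing_add:
  assumes "square_integrable g"
  shows "pairing g (F + G) = pairing g F + pairing g G"
proof -
  have "F + G = abs_L2 (\<lambda>x. rep_L2 F x + rep_L2 G x)"
    by (simp add: abs_L2_add square_integrable_rep_L2)
  then have "pairing g (F + G) = (\<integral>x. g x * (rep_L2 F x + rep_L2 G x) \<partial>lborel)"
    by (simp add: pairing_abs_L2 assms square_integrable_add square_integrable_rep_L2)
  then show ?thesis
    by (simp add: pairing_def distrib_left assms integrable_mult_square_integrable square_integrable_rep_L2)
qed

lemma pairing_diff:
  assumes "square_integrable g"
  shows "pairing g (F - G) = pairing g F - pairing g G"
  using pairing_add[OF assms, of "F - G" G] unfolding diff_add_cancel by (simp only: add_diff_cancel_right')

lemma pairing_zero_left: "pairing (\<lambda>_. 0) F = 0"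
  by (simp add: pairing_def)

lemma blinfun_abs_L2_zero: "blinfun_apply T (abs_L2 (\<lambda>_. 0)) = 0"
  by (metis blinfun.zero_right zero_L2_def)

lemma pairing_zero_right: "square_integrable g \<Longrightarrow> pairing g 0 = 0"
  using pairing_diff[of g 0 0] by simp

lemma indicator_split: "f = (\<lambda>x. indicator E x * f x + indicator (- E) x * f x)" for f :: "'b \<Rightarrow> complex"
  by (auto simp: indicator_def)

lemma pairing_L2_operator_scaleC:
  assumes "S \<in> L2_operators" "square_integrable f" "square_integrable g"
  shows "pairing g (blinfun_apply S (abs_L2 (\<lambda>x. c * f x))) = c * pairing g (blinfun_apply S (abs_L2 f))"
proof -
  let ?u = "rep_L2 (blinfun_apply S (abs_L2 f))"
  have "pairing g (blinfun_apply S (abs_L2 (\<lambda>x. c * f x))) = (\<integral>x. g x * (c * ?u x) \<partial>lborel)"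
    unfolding L2_operator_scaleC[OF assms(1,2)]
    by (intro pairing_abs_L2 assms square_integrable_scaleC square_integrable_rep_L2)
  also have "(\<lambda>x. g x * (c * ?u x)) = (\<lambda>x. c * (g x * ?u x))"
    by (simp add: mult_ac)
  finally show ?thesis by (simp add: pairing_def)
qed

lemma pairing_tendsto:
  assumes g: "\<And>n. square_integrable (g n)" "square_integrable g'"
    and "(\<lambda>n. abs_L2 (g n)) \<longlonglongrightarrow> abs_L2 g'" "F \<longlonglongrightarrow> F'"
  shows "(\<lambda>n. pairing (g n) (F n)) \<longlonglongrightarrow> pairing g' F'"
proof -
  have "(\<lambda>n. norm (abs_L2 (g n) - abs_L2 g') * norm (F n) + norm (abs_L2 g') * norm (F n - F'))
      \<longlonglongrightarrow> norm (abs_L2 g' - abs_L2 g') * norm F' + norm (abs_L2 g') * norm (F' - F')"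
    by (intro tendsto_intros assms)
  then have lim: "(\<lambda>n. norm (abs_L2 (g n) - abs_L2 g') * norm (F n) + norm (abs_L2 g') * norm (F n - F')) \<longlonglongrightarrow> 0"
    by simp
  have "cmod (pairing (g n) (F n) - pairing g' F')
      \<le> norm (abs_L2 (g n) - abs_L2 g') * norm (F n) + norm (abs_L2 g') * norm (F n - F')" for n
  proof -
    have "pairing (g n) (F n) - pairing g' F' = pairing (\<lambda>x. g n x - g' x) (F n) + pairing g' (F n - F')"
      by (simp add: pairing_diff_left pairing_diff g)
    also have "cmod \<dots> \<le> norm (abs_L2 (\<lambda>x. g n x - g' x)) * norm (F n) + norm (abs_L2 g') * norm (F n - F')"
      by (intro norm_triangle_mono norm_pairing_le square_integrable_diff g)
    finally show ?thesis by (simp add: abs_L2_diff g)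
  qed
  then show ?thesis
    by (subst Lim_null) (rule Lim_null_comparison[OF _ lim], simp)
qed

text \<open>Dominated convergence, applied to the squared differences with the square of
  \<open>2 * cmod (h x)\<close> as majorant.\<close>

lemma abs_L2_tendsto:
  fixes f :: "nat \<Rightarrow> 'a::euclidean_space \<Rightarrow> complex"
  assumes f: "\<And>n. f n \<in> borel_measurable borel" "f' \<in> borel_measurable borel"
    and h: "square_integrable h" "\<And>n x. cmod (f n x) \<le> cmod (h x)" "\<And>x. cmod (f' x) \<le> cmod (h x)"
    and lim: "\<And>x. (\<lambda>n. f n x) \<longlonglongrightarrow> f' x"
  shows "(\<lambda>n. abs_L2 (f n)) \<longlonglongrightarrow> abs_L2 f'"
proof -
  have sq: "square_integrable (f n)" "square_integrable f'" for n
    using square_integrable_mono[OF h(1)] f h(2,3) by auto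
  have "(\<lambda>n. \<integral>x. (cmod (f n x - f' x))\<^sup>2 \<partial>lborel) \<longlonglongrightarrow> integral\<^sup>L lborel (\<lambda>x::'a. 0)"
  proof (rule integral_dominated_convergence[where w = "\<lambda>x. (2 * cmod (h x))\<^sup>2"])
    show "integrable lborel (\<lambda>x. (2 * cmod (h x))\<^sup>2)"
      using h(1) by (simp add: square_integrable_def power_mult_distrib)
    show "AE x in lborel. (\<lambda>n. (cmod (f n x - f' x))\<^sup>2) \<longlonglongrightarrow> 0"
    proof (rule AE_I2)
      fix x
      have "(\<lambda>n. (cmod (f n x - f' x))\<^sup>2) \<longlonglongrightarrow> (cmod (f' x - f' x))\<^sup>2"
        by (intro tendsto_intros lim)
      then show "(\<lambda>n. (cmod (f n x - f' x))\<^sup>2) \<longlonglongrightarrow> 0" by simp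
    qed
    show "AE x in lborel. norm ((cmod (f n x - f' x))\<^sup>2) \<le> (2 * cmod (h x))\<^sup>2" for n
    proof (rule AE_I2)
      fix x
      have "cmod (f n x - f' x) \<le> 2 * cmod (h x)"
        using norm_triangle_ineq4[of "f n x" "f' x"] h(2)[of n x] h(3)[of x] by linarith
      then show "norm ((cmod (f n x - f' x))\<^sup>2) \<le> (2 * cmod (h x))\<^sup>2"
        unfolding real_norm_def abs_power2 by (rule power_mono) simp
    qed
  qed (use f in auto)
  then have "(\<lambda>n. sqrt (\<integral>x. (cmod (f n x - f' x))\<^sup>2 \<partial>lborel)) \<longlonglongrightarrow> sqrt 0"
    by (intro tendsto_real_sqrt) simp
  moreover have "norm (abs_L2 (f n) - abs_L2 f') = sqrt (\<integral>x. (cmod (f n x - f' x))\<^sup>2 \<partial>lborel)" for n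
    using norm_abs_L2[OF square_integrable_diff[OF sq]] by (simp add: abs_L2_diff sq)
  ultimately show ?thesis
    by (subst tendsto_dist_iff) (simp add: dist_norm)
qed

lemma blinfun_abs_L2_add:
  "square_integrable f \<Longrightarrow> square_integrable g \<Longrightarrow>
    blinfun_apply S (abs_L2 (\<lambda>x. f x + g x)) = blinfun_apply S (abs_L2 f) + blinfun_apply S (abs_L2 g)"
  by (simp add: abs_L2_add blinfun.add_right)

lemma square_integrable_indicator:
  assumes "E \<in> sets borel" "bounded E"
  shows "square_integrable (indicator E :: 'a::euclidean_space \<Rightarrow> complex)"
proof -
  obtain a b where "E \<subseteq> cbox a b" using bounded_subset_cbox_symmetric[OF assms(2)] by metis
  then have "emeasure lborel E < \<infinity>"
    using emeasure_mono[of E "cbox a b" lborel] emeasure_lborel_cbox_finite[of a b] by (auto simp: le_less_trans)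
  then have "integrable lborel (indicat_real E)"
    using assms(1) by (simp add: integrable_indicator_iff)
  moreover have "(cmod (indicator E x))\<^sup>2 = indicat_real E x" for x
    by (simp add: indicator_def)
  ultimately show ?thesis using assms(1) by (simp add: square_integrable_def)
qed

section \<open>Matrix coefficients of operators with an off-diagonal kernel\<close>

text \<open>Open boxes are an intersection-stable generator of the Borel sets, so a Dynkin argument
  leads from boxes to all Borel subsets of the given box. Simple functions follow by linearity and
  the general case by a dominated limit.\<close>

lemma L2_box_induct [consumes 2, case_names box add scale lim]:
  fixes f :: "'a::euclidean_space \<Rightarrow> complex"
  assumes f: "square_integrable f" "\<forall>x. x \<notin> box a b \<longrightarrow> f x = 0"
    and box: "\<And>u v. box u v \<subseteq> box a b \<Longrightarrow> V (indicator (box u v))"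
    and add: "\<And>f g. V f \<Longrightarrow> V g \<Longrightarrow> V (\<lambda>x. f x + g x)"
    and scale: "\<And>t f. V f \<Longrightarrow> V (\<lambda>x. t * f x)"
    and lim: "\<And>F h f. (\<And>n. V (F n)) \<Longrightarrow> square_integrable h \<Longrightarrow> (\<And>x. x \<notin> box a b \<Longrightarrow> h x = 0) \<Longrightarrow>
      (\<And>n x. cmod (F n x) \<le> cmod (h x)) \<Longrightarrow> (\<And>x. (\<lambda>n. F n x) \<longlonglongrightarrow> f x) \<Longrightarrow> V f"
  shows "V f"
proof -
  let ?B = "box a b"
  have V0: "V (\<lambda>_. 0)" using scale[OF box[OF subset_refl], of 0] by simp
  have sets_eq: "sets (borel :: 'a measure) = sigma_sets UNIV (range (\<lambda>(a, b). box a b))"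
    by (simp add: borel_eq_box)
  have stable: "Int_stable (range (\<lambda>(a, b). box a b :: 'a set))"
    by (auto simp: Int_stable_def box_Int_box)
  have sub: "range (\<lambda>(a, b). box a b :: 'a set) \<subseteq> Pow UNIV" by simp
  \<comment> \<open>All sets are intersected with \<open>?B\<close> to keep the functions supported
    in that box; this preserves the generator, as a box meets \<open>?B\<close> in a box.\<close>
  have ind: "V (indicator (E \<inter> ?B))" if "E \<in> sets borel" for E
    using stable sub that[unfolded sets_eq]
  proof (induction rule: sigma_sets_induct_disjoint)
    case (basic A)
    then obtain u v where "A = box u v" by auto
    then obtain w z where wz: "A \<inter> ?B = box w z" by (simp add: box_Int_box)
    then show ?case using box[of w z] by (metis inf_le2)
  next
    case empty
    then show ?case using V0 by (simp add: indicator_def)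
  next
    case (compl A)
    have "indicator ((UNIV - A) \<inter> ?B) = (\<lambda>x. indicator ?B x + (- 1) * indicator (A \<inter> ?B) x :: complex)"
      by (auto simp: indicator_def)
    then show ?case using add[OF box[OF subset_refl] scale[OF compl(2)], of "-1"] by simp
  next
    case (union A)
    have "V (indicator ((\<Union>i<n. A i) \<inter> ?B))" for n
    proof (induction n)
      case 0
      then show ?case using V0 by (simp add: indicator_def)
    next
      case (Suc n)
      have "x \<notin> A n" if "x \<in> A i" "i < n" for x i
        using disjoint_family_onD[OF union(1), of i n] that by auto
      then have "indicator ((\<Union>i<Suc n. A i) \<inter> ?B)
          = (\<lambda>x. indicator ((\<Union>i<n. A i) \<inter> ?B) x + indicator (A n \<inter> ?B) x :: complex)"
        by (auto simp: indicator_def fun_eq_iff less_Suc_eq)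
      then show ?case using add[OF Suc union(3)[of n]] by simp
    qed
    then show ?case
    proof (rule lim)
      show "square_integrable (indicator ?B)"
        by (rule square_integrable_indicator) auto
      show "(\<lambda>n. indicator ((\<Union>i<n. A i) \<inter> ?B) x :: complex) \<longlonglongrightarrow> indicator (\<Union> (range A) \<inter> ?B) x" for x
        unfolding indicator_inter_arith by (intro tendsto_mult LIMSEQ_indicator_UN tendsto_const)
    qed (auto simp: indicator_def)
  qed
  \<comment> \<open>Approximating relative to the base point 0 gives
    \<open>cmod (F i x) \<le> 2 * cmod (f x)\<close>. So each \<open>F i\<close> vanishes off the
    box, and \<open>2 * f\<close> can serve as the dominating function.\<close>
  obtain F where F: "\<And>i. simple_function borel (F i)" "\<And>x. (\<lambda>i. F i x) \<longlonglongrightarrow> f x"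
    "\<And>i x. cmod (F i x) \<le> 2 * cmod (f x)"
    using borel_measurable_implies_sequence_metric[OF square_integrable_measurable[OF f(1)], of 0]
    by (auto simp: dist_norm)
  have "V (F i)" for i
  proof -
    have fin: "finite (range (F i))" using simple_functionD(1)[OF F(1)] by simp
    have V_sum: "V (\<lambda>x. \<Sum>y\<in>Y. y * indicator (F i -` {y} \<inter> ?B) x)" if "finite Y" for Y
      using that
    proof (induction Y)
      case (insert y Y)
      have "F i -` {y} \<in> sets borel"
        using simple_functionD(2)[OF F(1), of i "{y}"] by simp
      from add[OF scale[OF ind[OF this]] insert(3)] show ?case
        by (simp only: sum.insert[OF insert(1,2)])
    qed (simp add: V0)
    have F_eq: "F i = (\<lambda>x. \<Sum>y\<in>range (F i). y * indicator (F i -` {y} \<inter> ?B) x)"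
    proof
      fix x
      show "F i x = (\<Sum>y\<in>range (F i). y * indicator (F i -` {y} \<inter> ?B) x)"
      proof (cases "x \<in> ?B")
        case True
        then have "(\<Sum>y\<in>range (F i). y * indicator (F i -` {y} \<inter> ?B) x) = (\<Sum>y\<in>range (F i). if y = F i x then y else 0)"
          by (intro sum.cong) (auto simp: indicator_def)
        then show ?thesis using fin by simp
      next
        case False
        then show ?thesis using F(3)[of i x] f(2) by simp
      qed
    qed
    show ?thesis by (subst F_eq) (rule V_sum[OF fin])
  qed
  then show "V f"
  proof (rule lim)
    show "square_integrable (\<lambda>x. 2 * f x)" using f(1) by (rule square_integrable_scaleC)
  qed (use F f(2) in \<open>auto simp: norm_mult\<close>)
qed

lemma integrable_lborel_mult_Pair:
  fixes f :: "'a::euclidean_space \<Rightarrow> real" and g :: "'b::euclidean_space \<Rightarrow> real"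
  assumes "integrable lborel f" "integrable lborel g"
  shows "integrable lborel (\<lambda>z. f (fst z) * g (snd z))"
  unfolding lborel_prod[symmetric]
proof (rule lborel_pair.Fubini_integrable)
  show "(\<lambda>z. f (fst z) * g (snd z)) \<in> borel_measurable (lborel \<Otimes>\<^sub>M lborel)"
    using assms by measurable
  show "integrable lborel (\<lambda>x. \<integral>y. norm (f (fst (x, y)) * g (snd (x, y))) \<partial>lborel)"
    using assms by (simp add: abs_mult)
  show "AE x in lborel. integrable lborel (\<lambda>y. f (fst (x, y)) * g (snd (x, y)))"
    using assms by simp
qed

section \<open>Agreement of \<open>S\<close> with its kernel on separated boxes\<close>

locale off_diagonal_kernel =
  fixes S :: "'a::euclidean_space L2 \<Rightarrow>\<^sub>L 'a L2"
    and K :: "('a \<times> 'a \<Rightarrow> complex) \<Rightarrow> complex"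
    and k :: "'a \<times> 'a \<Rightarrow> complex"
    and c m :: real
  assumes S: "S \<in> L2_operators"
    and K: "distribution_kernel S K" "is_function_on K {(x, y). x \<noteq> y} k"
    and c: "c \<ge> 0"
    and m: "m > real DIM('a)"
    and k_bound: "\<And>x y. x \<noteq> y \<Longrightarrow> cmod (k (x, y)) \<le> c * norm (x - y) powr (- m)"
begin

text \<open>The integral runs over the whole product space although \<open>k\<close> is controlled
  only off the diagonal: in the applications \<open>g\<close> and \<open>f\<close> live in boxes
  with disjoint closures, and the integrand vanishes near the diagonal.\<close>

definition kernel_form :: "('a \<Rightarrow> complex) \<Rightarrow> ('a \<Rightarrow> complex) \<Rightarrow> complex" where
  "kernel_form g f = (\<integral>z. k z * (g (fst z) * f (snd z)) \<partial>lborel)"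

text \<open>Disjoint closed boxes have a positive distance \<open>\<rho>\<close>, so
  \<open>k\<close> is bounded by \<open>c * \<rho> powr (- m)\<close> on their product, and square
  integrable functions supported in bounded boxes are integrable.\<close>

lemma kernel_integrable:
  assumes disj: "cbox a b \<inter> cbox a' b' = {}"
    and g: "square_integrable g" "\<And>x. x \<notin> box a b \<Longrightarrow> g x = 0"
    and f: "square_integrable f" "\<And>x. x \<notin> box a' b' \<Longrightarrow> f x = 0"
  shows "(\<lambda>z. k z * (g (fst z) * f (snd z))) \<in> borel_measurable borel" (is ?m)
    and "integrable lborel (\<lambda>z. cmod (k z) * (cmod (g (fst z)) * cmod (f (snd z))))" (is ?i)
proof -
  let ?R = "cbox (a, a') (b, b')"
  \<comment> \<open>Measurability of \<open>k\<close> is available only on compact sets off the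
    diagonal, so \<open>k\<close> is replaced by its restriction to \<open>?R\<close>, which leaves
    the integrand unchanged.\<close>
  let ?\<kappa> = "\<lambda>z. indicat_real ?R z *\<^sub>R k z"
  have "?R \<subseteq> {(x, y). x \<noteq> y}" using disj by (auto simp: cbox_Pair_eq)
  then have \<kappa>: "integrable lborel ?\<kappa>"
    using K(2) by (simp add: is_function_on_def set_integrable_def)
  then have \<kappa>m [measurable]: "?\<kappa> \<in> borel_measurable borel"
    using borel_measurable_integrable by force
  have meas [measurable]: "g \<in> borel_measurable borel" "f \<in> borel_measurable borel"
    using f g by (auto intro: square_integrable_measurable)
  have eq: "g (fst z) * f (snd z) = 0" if "z \<notin> ?R" for z
    using that f(2)[of "snd z"] g(2)[of "fst z"] box_subset_cbox[of a b] box_subset_cbox[of a' b']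
    by (cases z) (auto simp: cbox_Pair_eq)
  then have eqk: "k z * (g (fst z) * f (snd z)) = ?\<kappa> z * (g (fst z) * f (snd z))" for z
    by (cases "z \<in> ?R") auto
  have "(fst :: 'a \<times> 'a \<Rightarrow> 'a) \<in> borel_measurable borel" "(snd :: 'a \<times> 'a \<Rightarrow> 'a) \<in> borel_measurable borel"
    by (intro borel_measurable_continuous_onI continuous_on_fst continuous_on_snd continuous_on_id)+
  then have mgf: "(\<lambda>z :: 'a \<times> 'a. g (fst z)) \<in> borel_measurable borel" "(\<lambda>z :: 'a \<times> 'a. f (snd z)) \<in> borel_measurable borel"
    using measurable_compose meas by blast+
  show meas_k: ?m unfolding eqk using mgf by measurable
  obtain \<rho> where \<rho>: "\<rho> > 0" "\<And>x y. x \<in> cbox a b \<Longrightarrow> y \<in> cbox a' b' \<Longrightarrow> \<rho> \<le> dist x y"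
    using separate_compact_closed[OF compact_cbox closed_cbox disj] by blast
  have k_le: "cmod (k z) \<le> c * \<rho> powr (- m)" if "z \<in> ?R" for z
  proof -
    obtain x y where z: "z = (x, y)" by (cases z)
    have xy: "\<rho> \<le> norm (x - y)" using \<rho>(2) that by (auto simp: z cbox_Pair_eq dist_norm)
    then have "cmod (k z) \<le> c * norm (x - y) powr (- m)"
      using k_bound[of x y] \<rho>(1) by (cases "x = y") (simp_all add: z)
    also have "\<dots> \<le> c * \<rho> powr (- m)"
      using xy \<rho>(1) m by (intro mult_left_mono c powr_mono2') auto
    finally show ?thesis .
  qed
  have int1: "integrable lborel (\<lambda>x. cmod (h x))"
    if "square_integrable h" "\<And>x. x \<notin> box u v \<Longrightarrow> h x = 0" for h :: "'a \<Rightarrow> complex" and u v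
  proof -
    have "square_integrable (indicator (box u v) :: 'a \<Rightarrow> complex)"
      by (rule square_integrable_indicator) auto
    moreover have "(\<lambda>x. h x * indicator (box u v) x) = h"
      using that(2) by (auto simp: indicator_def fun_eq_iff)
    ultimately show ?thesis
      using integrable_mult_square_integrable[OF that(1)] by (metis integrable_norm)
  qed
  show ?i
  proof (rule Bochner_Integration.integrable_bound)
    show "integrable lborel (\<lambda>z. c * \<rho> powr (- m) * (cmod (g (fst z)) * cmod (f (snd z))))"
      by (intro integrable_mult_right integrable_lborel_mult_Pair int1[OF g] int1[OF f])
    show "(\<lambda>z. cmod (k z) * (cmod (g (fst z)) * cmod (f (snd z)))) \<in> borel_measurable lborel"
      using measurable_compose[OF meas_k borel_measurable_norm] by (simp add: norm_mult)
    have "cmod (k z) * (cmod (g (fst z)) * cmod (f (snd z)))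
        \<le> c * \<rho> powr (- m) * (cmod (g (fst z)) * cmod (f (snd z)))" for z
    proof (cases "z \<in> ?R")
      case True
      then show ?thesis by (intro mult_right_mono k_le) auto
    next
      case False
      then have "cmod (g (fst z)) * cmod (f (snd z)) = 0"
        using eq[of z] by (simp flip: norm_mult)
      then show ?thesis by (simp only: mult_zero_right order_refl)
    qed
    then show "AE z in lborel. norm (cmod (k z) * (cmod (g (fst z)) * cmod (f (snd z))))
        \<le> norm (c * \<rho> powr (- m) * (cmod (g (fst z)) * cmod (f (snd z))))"
      using c by auto
  qed
qed

lemma kernel_integrable_complex:
  assumes "cbox a b \<inter> cbox a' b' = {}"
    and "square_integrable g" "\<And>x. x \<notin> box a b \<Longrightarrow> g x = 0"
    and "square_integrable f" "\<And>x. x \<notin> box a' b' \<Longrightarrow> f x = 0"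
  shows "integrable lborel (\<lambda>z. k z * (g (fst z) * f (snd z)))"
  by (rule integrable_norm_cancel)
    (use kernel_integrable[OF assms] in \<open>simp_all add: norm_mult\<close>)

lemma kernel_form_tendsto:
  assumes disj: "cbox a b \<inter> cbox a' b' = {}"
    and g: "square_integrable h" "\<And>x. x \<notin> box a b \<Longrightarrow> h x = 0"
      "\<And>n. g n \<in> borel_measurable borel" "g' \<in> borel_measurable borel"
      "\<And>n x. cmod (g n x) \<le> cmod (h x)" "\<And>x. (\<lambda>n. g n x) \<longlonglongrightarrow> g' x"
    and f: "square_integrable h'" "\<And>x. x \<notin> box a' b' \<Longrightarrow> h' x = 0"
      "\<And>n. f n \<in> borel_measurable borel" "f' \<in> borel_measurable borel"
      "\<And>n x. cmod (f n x) \<le> cmod (h' x)" "\<And>x. (\<lambda>n. f n x) \<longlonglongrightarrow> f' x"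
  shows "(\<lambda>n. kernel_form (g n) (f n)) \<longlonglongrightarrow> kernel_form g' f'"
proof -
  have le': "cmod (g' x) \<le> cmod (h x)" "cmod (f' x) \<le> cmod (h' x)" for x
    by (rule Lim_norm_ubound[OF sequentially_bot g(6) always_eventually], simp add: g,
        rule Lim_norm_ubound[OF sequentially_bot f(6) always_eventually], simp add: f)
  have sq: "square_integrable (g n)" "square_integrable (f n)" "square_integrable g'" "square_integrable f'" for n
    using g f le' by (auto intro: square_integrable_mono)
  have van: "g n x = 0" "g' x = 0" if "x \<notin> box a b" for n x
    using g(2)[OF that] g(5)[of n x] le'(1)[of x] by simp_all
  have van': "f n x = 0" "f' x = 0" if "x \<notin> box a' b'" for n x
    using f(2)[OF that] f(5)[of n x] le'(2)[of x] by simp_all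
  show ?thesis
    unfolding kernel_form_def
  proof (rule integral_dominated_convergence)
    show "integrable lborel (\<lambda>z. cmod (k z) * (cmod (h (fst z)) * cmod (h' (snd z))))"
      by (rule kernel_integrable(2)[OF disj g(1,2) f(1,2)])
    show "(\<lambda>z. k z * (g' (fst z) * f' (snd z))) \<in> borel_measurable lborel"
      using kernel_integrable(1)[OF disj sq(3) van(2) sq(4) van'(2)] by simp
    show "(\<lambda>z. k z * (g n (fst z) * f n (snd z))) \<in> borel_measurable lborel" for n
      using kernel_integrable(1)[OF disj sq(1) van(1) sq(2) van'(1)] by simp
    show "AE z in lborel. (\<lambda>n. k z * (g n (fst z) * f n (snd z))) \<longlonglongrightarrow> k z * (g' (fst z) * f' (snd z))"
      by (intro AE_I2 tendsto_mult tendsto_const g(6) f(6))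
    show "AE z in lborel. norm (k z * (g n (fst z) * f n (snd z))) \<le> cmod (k z) * (cmod (h (fst z)) * cmod (h' (snd z)))" for n
      by (auto simp: norm_mult intro!: mult_mono mult_nonneg_nonneg g f)
  qed
qed

lemma kernel_form_add_left:
  assumes "cbox a b \<inter> cbox a' b' = {}"
    and "square_integrable g" "\<And>x. x \<notin> box a b \<Longrightarrow> g x = 0"
    and "square_integrable h" "\<And>x. x \<notin> box a b \<Longrightarrow> h x = 0"
    and "square_integrable f" "\<And>x. x \<notin> box a' b' \<Longrightarrow> f x = 0"
  shows "kernel_form (\<lambda>x. g x + h x) f = kernel_form g f + kernel_form h f"
proof -
  have "integrable lborel (\<lambda>z. k z * (g (fst z) * f (snd z)))" "integrable lborel (\<lambda>z. k z * (h (fst z) * f (snd z)))"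
    using kernel_integrable_complex[OF assms(1-3,6-7)] kernel_integrable_complex[OF assms(1,4-7)] by simp_all
  then show ?thesis unfolding kernel_form_def by (simp add: algebra_simps)
qed

lemma kernel_form_add_right:
  assumes "cbox a b \<inter> cbox a' b' = {}"
    and "square_integrable g" "\<And>x. x \<notin> box a b \<Longrightarrow> g x = 0"
    and "square_integrable f" "\<And>x. x \<notin> box a' b' \<Longrightarrow> f x = 0"
    and "square_integrable h" "\<And>x. x \<notin> box a' b' \<Longrightarrow> h x = 0"
  shows "kernel_form g (\<lambda>x. f x + h x) = kernel_form g f + kernel_form g h"
proof -
  have "integrable lborel (\<lambda>z. k z * (g (fst z) * f (snd z)))" "integrable lborel (\<lambda>z. k z * (g (fst z) * h (snd z)))"
    using kernel_integrable_complex[OF assms(1-5)] kernel_integrable_complex[OF assms(1-3,6-7)] by simp_all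
  then show ?thesis unfolding kernel_form_def by (simp add: algebra_simps)
qed

lemma kernel_form_scale:
  "kernel_form (\<lambda>x. t * g x) f = t * kernel_form g f"
  "kernel_form g (\<lambda>x. t * f x) = t * kernel_form g f"
proof -
  have "kernel_form (\<lambda>x. t * g x) f = (\<integral>z. t * (k z * (g (fst z) * f (snd z))) \<partial>lborel)"
    unfolding kernel_form_def by (rule Bochner_Integration.integral_cong) auto
  then show "kernel_form (\<lambda>x. t * g x) f = t * kernel_form g f"
    by (simp add: kernel_form_def)
  have "kernel_form g (\<lambda>x. t * f x) = (\<integral>z. t * (k z * (g (fst z) * f (snd z))) \<partial>lborel)"
    unfolding kernel_form_def by (rule Bochner_Integration.integral_cong) auto
  then show "kernel_form g (\<lambda>x. t * f x) = t * kernel_form g f"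
    by (simp add: kernel_form_def)
qed

text \<open>For bumps supported in the two closed boxes the identity is the definition of the
  kernel; letting their parameter tend to 0 gives the indicators. Disjointness is asked only for
  nonempty open boxes, since an empty open box may have a nonempty degenerate
  \<open>cbox\<close>.\<close>

lemma pairing_boxes:
  assumes disj: "box a b \<noteq> {} \<Longrightarrow> box a' b' \<noteq> {} \<Longrightarrow> cbox a b \<inter> cbox a' b' = {}"
  shows "pairing (indicator (box a b)) (blinfun_apply S (abs_L2 (indicator (box a' b'))))
    = kernel_form (indicator (box a b)) (indicator (box a' b'))"
proof (cases "box a b = {} \<or> box a' b' = {}")
  case True
  have "indicator {} = (\<lambda>_ :: 'a. 0 :: complex)" by (simp add: fun_eq_iff)
  moreover have "pairing (indicator (box a b)) (0 :: 'a L2) = 0"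
    by (rule pairing_zero_right[OF square_integrable_indicator]) auto
  ultimately show ?thesis using True
    by (auto simp: pairing_zero_left blinfun_abs_L2_zero kernel_form_def)
next
  case False
  with disj have disj: "cbox a b \<inter> cbox a' b' = {}" by blast
  from False have lt: "\<And>i. i \<in> Basis \<Longrightarrow> a \<bullet> i < b \<bullet> i" "\<And>i. i \<in> Basis \<Longrightarrow> a' \<bullet> i < b' \<bullet> i"
    by (auto simp: box_eq_empty not_le)
  then have lt2: "\<And>i. i \<in> Basis \<Longrightarrow> (a, a') \<bullet> i < (b, b') \<bullet> i"
    by (auto simp: Basis_prod_def)
  let ?g = "\<lambda>n. box_bump (1 / real (Suc n)) a b" and ?f = "\<lambda>n. box_bump (1 / real (Suc n)) a' b'"
  have tf: "?g n \<in> test_functions UNIV" "?f n \<in> test_functions UNIV" for n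
    using lt by (auto intro: box_bump_test_function)
  have sq: "square_integrable (?g n)" "square_integrable (?f n)" for n
    using tf by (auto intro: test_functions_square_integrable)
  have meas: "?g n \<in> borel_measurable borel" "?f n \<in> borel_measurable borel" for n
    using sq by (auto intro: square_integrable_measurable)
  have sqi: "square_integrable (indicator (box u v) :: 'a \<Rightarrow> complex)" for u v
    by (rule square_integrable_indicator) auto
  have le: "cmod (?g n x) \<le> cmod (indicator (box a b) x)" "cmod (?f n x) \<le> cmod (indicator (box a' b') x)" for n x
    using box_bump_norm_le[OF lt(1), of "1 / real (Suc n)" x] box_bump_norm_le[OF lt(2), of "1 / real (Suc n)" x]
    by (auto simp: indicator_def split: if_splits)
  have lim: "(\<lambda>n. ?g n x) \<longlonglongrightarrow> indicator (box a b) x" "(\<lambda>n. ?f n x) \<longlonglongrightarrow> indicator (box a' b') x" for x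
    using box_bump_tendsto[OF lt(1), where x = x] box_bump_tendsto[OF lt(2), where x = x] by auto
  have "pairing (?g n) (blinfun_apply S (abs_L2 (?f n))) = kernel_form (?g n) (?f n)" for n
  proof -
    let ?U = "{(x, y :: 'a). x \<noteq> y}"
    have eq: "(\<lambda>(x, y). ?g n x * ?f n y) = box_bump (1 / real (Suc n)) (a, a') (b, b')"
      by (auto simp: box_bump_Pair)
    have "cbox (a, a') (b, b') \<subseteq> ?U" using disj by (auto simp: cbox_Pair_eq)
    then have tU: "(\<lambda>(x, y). ?g n x * ?f n y) \<in> test_functions ?U"
      unfolding eq by (intro box_bump_test_function lt2) auto
    have "pairing (?g n) (blinfun_apply S (abs_L2 (?f n))) = K (\<lambda>(x, y). ?g n x * ?f n y)"
      using K(1) tf by (simp add: distribution_kernel_def pairing_def)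
    also have "\<dots> = (LINT z:?U|lborel. k z * (\<lambda>(x, y). ?g n x * ?f n y) z)"
      using K(2) tU unfolding is_function_on_def by blast
    also have "\<dots> = kernel_form (?g n) (?f n)"
      unfolding kernel_form_def set_lebesgue_integral_def
    proof (rule Bochner_Integration.integral_cong)
      fix z :: "'a \<times> 'a"
      \<comment> \<open>The bumps are nowhere both nonzero, so their tensor product vanishes on the
        diagonal and the integral over \<open>?U\<close> is the integral over the whole
        space.\<close>
      have "?g n x * ?f n x = 0" for x
      proof (cases "x \<in> box a b")
        case True
        then have "x \<notin> box a' b'" using disj box_subset_cbox by blast
        then show ?thesis using le(2)[of n x] by simp
      qed (use le(1)[of n x] in simp)
      then show "indicat_real ?U z *\<^sub>R (k z * (case z of (x, y) \<Rightarrow> ?g n x * ?f n y)) = k z * (?g n (fst z) * ?f n (snd z))"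
        by (cases z) (auto simp: indicator_def)
    qed simp
    finally show ?thesis .
  qed
  moreover have "(\<lambda>n. kernel_form (?g n) (?f n)) \<longlonglongrightarrow> kernel_form (indicator (box a b)) (indicator (box a' b'))"
    by (rule kernel_form_tendsto[OF disj sqi _ meas(1) _ le(1) lim(1) sqi _ meas(2) _ le(2) lim(2)]) auto
  moreover have "(\<lambda>n. pairing (?g n) (blinfun_apply S (abs_L2 (?f n))))
      \<longlonglongrightarrow> pairing (indicator (box a b)) (blinfun_apply S (abs_L2 (indicator (box a' b'))))"
  proof (rule pairing_tendsto[OF sq(1) sqi])
    show "(\<lambda>n. abs_L2 (?g n)) \<longlonglongrightarrow> abs_L2 (indicator (box a b))"
      by (rule abs_L2_tendsto[OF meas(1) _ sqi le(1) _ lim(1)]) auto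
    have "(\<lambda>n. abs_L2 (?f n)) \<longlonglongrightarrow> abs_L2 (indicator (box a' b'))"
      by (rule abs_L2_tendsto[OF meas(2) _ sqi le(2) _ lim(2)]) auto
    then show "(\<lambda>n. blinfun_apply S (abs_L2 (?f n))) \<longlonglongrightarrow> blinfun_apply S (abs_L2 (indicator (box a' b')))"
      by (rule blinfun.tendsto[OF tendsto_const])
  qed
  ultimately show ?thesis
    using LIMSEQ_unique by simp
qed

text \<open>Both sides are bilinear and continuous under dominated limits.
  \<open>L2_box_induct\<close> is used twice: \<open>V\<close> varies \<open>g\<close> while the
  other function is the indicator of a box, then \<open>W\<close> varies \<open>f\<close> with
  \<open>g\<close> fixed.\<close>

lemma pairing_eq_kernel_form:
  assumes disj: "cbox a b \<inter> cbox a' b' = {}"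
    and g: "square_integrable g" "\<And>x. x \<notin> box a b \<Longrightarrow> g x = 0"
    and f: "square_integrable f" "\<And>x. x \<notin> box a' b' \<Longrightarrow> f x = 0"
  shows "pairing g (blinfun_apply S (abs_L2 f)) = kernel_form g f"
proof -
  have sub: "cbox u v \<subseteq> cbox a b" if "box u v \<subseteq> box a b" "box u v \<noteq> {}" for u v a b :: 'a
    using closure_mono[OF that(1)] that by (cases "box a b = {}") (simp_all add: closure_box)
  define V where "V a b f g \<longleftrightarrow> square_integrable g \<and> (\<forall>x. x \<notin> box a b \<longrightarrow> g x = 0) \<and>
      pairing g (blinfun_apply S (abs_L2 f)) = kernel_form g f" for a b f g
  define W where "W f \<longleftrightarrow> square_integrable f \<and> (\<forall>x. x \<notin> box a' b' \<longrightarrow> f x = 0) \<and>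
      pairing g (blinfun_apply S (abs_L2 f)) = kernel_form g f" for f
  have sqi: "square_integrable (indicator (box u v) :: 'a \<Rightarrow> complex)" for u v
    by (rule square_integrable_indicator) auto
  have ind0: "indicator (box u v) x = (0 :: complex)" if "box u v \<subseteq> B" "x \<notin> B" for u v x and B :: "'a set"
    using that by (auto simp: indicator_def)
  have base: "pairing (indicator (box u v)) (blinfun_apply S (abs_L2 (indicator (box w z))))
    = kernel_form (indicator (box u v)) (indicator (box w z))"
    if "box u v \<subseteq> box a b" "box w z \<subseteq> box a' b'" for u v w z
    using sub[OF that(1)] sub[OF that(2)] disj by (intro pairing_boxes) blast
  have van_g: "\<forall>x. x \<notin> box a b \<longrightarrow> g x = 0" and van_f: "\<forall>x. x \<notin> box a' b' \<longrightarrow> f x = 0"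
    using g(2) f(2) by auto
  have V: "V a b (indicator (box w z)) g" if wz: "box w z \<subseteq> box a' b'" for w z
    using g(1) van_g
  proof (induction rule: L2_box_induct)
    case (box u v)
    then show ?case using base[OF box wz] sqi[of u v] ind0[OF box] unfolding V_def by blast
  next
    case (add g h)
    then have "kernel_form (\<lambda>x. g x + h x) (indicator (box w z))
        = kernel_form g (indicator (box w z)) + kernel_form h (indicator (box w z))"
      by (intro kernel_form_add_left[OF disj]) (auto simp: V_def sqi ind0[OF wz])
    with add show ?case unfolding V_def
      by (simp add: pairing_add_left square_integrable_add)
  next
    case (scale t g)
    then show ?case by (simp add: V_def pairing_scale_left kernel_form_scale square_integrable_scaleC)
  next
    case (lim F h g)
    have F: "square_integrable (F n)" "F n \<in> borel_measurable borel"
      "pairing (F n) (blinfun_apply S (abs_L2 (indicator (box w z)))) = kernel_form (F n) (indicator (box w z))" for n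
      using lim(1)[of n] by (auto simp: V_def intro: square_integrable_measurable)
    have le: "cmod (g x) \<le> cmod (h x)" for x
      by (rule Lim_norm_ubound[OF sequentially_bot lim(5) always_eventually]) (simp add: lim(4))
    have gm: "g \<in> borel_measurable borel"
      by (rule borel_measurable_LIMSEQ_metric[OF F(2) lim(5)])
    have gi: "square_integrable g" by (rule square_integrable_mono[OF lim(2) gm le])
    have "(\<lambda>n. kernel_form (F n) (indicator (box w z))) \<longlonglongrightarrow> kernel_form g (indicator (box w z))"
      by (rule kernel_form_tendsto[OF disj lim(2,3) F(2) gm lim(4,5) sqi[of w z] ind0[OF wz]]) auto
    moreover have "(\<lambda>n. pairing (F n) (blinfun_apply S (abs_L2 (indicator (box w z)))))
        \<longlonglongrightarrow> pairing g (blinfun_apply S (abs_L2 (indicator (box w z))))"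
      by (rule pairing_tendsto[OF F(1) gi abs_L2_tendsto[OF F(2) gm lim(2,4) le lim(5)] tendsto_const])
    ultimately have "pairing g (blinfun_apply S (abs_L2 (indicator (box w z)))) = kernel_form g (indicator (box w z))"
      using LIMSEQ_unique by (simp add: F(3))
    moreover have "g x = 0" if "x \<notin> box a b" for x
      using le[of x] lim(3)[OF that] by simp
    ultimately show ?case using gi by (simp add: V_def)
  qed
  have "W f" using f(1) van_f
  proof (induction rule: L2_box_induct)
    case (box u v)
    then show ?case using V[OF box] sqi[of u v] ind0[OF box] unfolding V_def W_def by blast
  next
    case (add f h)
    then have "kernel_form g (\<lambda>x. f x + h x) = kernel_form g f + kernel_form g h"
      by (intro kernel_form_add_right[OF disj g]) (auto simp: W_def)
    with add show ?case unfolding W_def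
      by (simp add: blinfun_abs_L2_add pairing_add g square_integrable_add)
  next
    case (scale t f)
    then show ?case by (simp add: W_def pairing_L2_operator_scaleC[OF S] g kernel_form_scale square_integrable_scaleC)
  next
    case (lim F h f)
    have F: "square_integrable (F n)" "F n \<in> borel_measurable borel"
      "pairing g (blinfun_apply S (abs_L2 (F n))) = kernel_form g (F n)" for n
      using lim(1)[of n] by (auto simp: W_def intro: square_integrable_measurable)
    have le: "cmod (f x) \<le> cmod (h x)" for x
      by (rule Lim_norm_ubound[OF sequentially_bot lim(5) always_eventually]) (simp add: lim(4))
    have fm: "f \<in> borel_measurable borel"
      by (rule borel_measurable_LIMSEQ_metric[OF F(2) lim(5)])
    have fi: "square_integrable f" by (rule square_integrable_mono[OF lim(2) fm le])
    have gm: "g \<in> borel_measurable borel" by (rule square_integrable_measurable[OF g(1)])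
    have "(\<lambda>n. kernel_form g (F n)) \<longlonglongrightarrow> kernel_form g f"
      by (rule kernel_form_tendsto[OF disj g gm gm order_refl tendsto_const lim(2,3) F(2) fm lim(4,5)])
    moreover have "(\<lambda>n. pairing g (blinfun_apply S (abs_L2 (F n)))) \<longlonglongrightarrow> pairing g (blinfun_apply S (abs_L2 f))"
      by (rule pairing_tendsto[OF g(1) g(1) tendsto_const
            blinfun.tendsto[OF tendsto_const abs_L2_tendsto[OF F(2) fm lim(2,4) le lim(5)]]])
    ultimately have "pairing g (blinfun_apply S (abs_L2 f)) = kernel_form g f"
      using LIMSEQ_unique by (simp add: F(3))
    moreover have "f x = 0" if "x \<notin> box a' b'" for x
      using le[of x] lim(3)[OF that] by simp
    ultimately show ?case using fi by (simp add: W_def)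
  qed
  then show ?thesis by (simp add: W_def)
qed

end

text \<open>Compactness of \<open>closure A\<close>. The diameters of the closed boxes are
  controlled so that pieces of two sets at positive distance get disjoint closed boxes.\<close>

lemma finite_small_box_cover:
  fixes A :: "'a::euclidean_space set"
  assumes "bounded A" "e > 0"
  obtains \<P> :: "('a \<times> 'a) set" where "finite \<P>" "A \<subseteq> (\<Union>(a, b)\<in>\<P>. box a b)"
    "\<And>a b x y. (a, b) \<in> \<P> \<Longrightarrow> x \<in> cbox a b \<Longrightarrow> y \<in> cbox a b \<Longrightarrow> dist x y < e"
proof -
  let ?C = "{(a, b). \<forall>x\<in>cbox a b. \<forall>y\<in>cbox a b. dist x y < e} :: ('a \<times> 'a) set"
  have "\<exists>p\<in>?C. x \<in> box (fst p) (snd p)" for x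
  proof -
    obtain a b where ab: "cbox a b \<subseteq> ball x (e / 2)" "x \<in> box a b"
      using assms(2) by (metis open_contains_cbox open_ball centre_in_ball half_gt_zero)
    have "dist y z < e" if "y \<in> cbox a b" "z \<in> cbox a b" for y z
    proof -
      have "dist x y < e / 2" "dist x z < e / 2" using ab(1) that by auto
      then show ?thesis using dist_triangle3[of y z x] by linarith
    qed
    then show ?thesis using ab(2) by (intro bexI[of _ "(a, b)"]) auto
  qed
  then have "closure A \<subseteq> (\<Union>p\<in>?C. box (fst p) (snd p))" by blast
  moreover have "compact (closure A)" using assms(1) by (simp add: compact_closure)
  ultimately obtain \<P> where \<P>: "\<P> \<subseteq> ?C" "finite \<P>" "closure A \<subseteq> (\<Union>p\<in>\<P>. box (fst p) (snd p))"
    using compactE_image[of "closure A" ?C "\<lambda>p. box (fst p) (snd p)", OF _ open_box] by blast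
  show thesis
  proof (rule that[OF \<P>(2)])
    show "A \<subseteq> (\<Union>(a, b)\<in>\<P>. box a b)"
      using \<P>(3) closure_subset[of A] by (force simp: split_beta)
  qed (use \<P>(1) in auto)
qed

section \<open>Cutoffs and the Schur test\<close>

definition cutoff :: "'a::euclidean_space set \<Rightarrow> 'a L2 \<Rightarrow>\<^sub>L 'a L2" where
  "cutoff E = mult_op (indicator E)"

lemma bounded_range_indicator: "bounded (range (indicator E :: 'a \<Rightarrow> complex))"
  by (rule bounded_subset[of "{0, 1}"]) (auto simp: indicator_def)

lemma square_integrable_indicator_mult:
  "E \<in> sets borel \<Longrightarrow> square_integrable f \<Longrightarrow> square_integrable (\<lambda>x. indicator E x * f x)"
  by (intro square_integrable_bounded_mult bounded_range_indicator) auto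

lemma cutoff_apply:
  "E \<in> sets borel \<Longrightarrow> square_integrable f \<Longrightarrow>
    blinfun_apply (cutoff E) (abs_L2 f) = abs_L2 (\<lambda>x. indicator E x * f x)"
  unfolding cutoff_def by (intro mult_op_apply bounded_range_indicator) auto

lemma norm_abs_L2_mono:
  assumes "square_integrable f" "square_integrable g" "\<And>x. cmod (f x) \<le> cmod (g x)"
  shows "norm (abs_L2 f) \<le> norm (abs_L2 g)"
  unfolding norm_abs_L2[OF assms(1)] norm_abs_L2[OF assms(2)]
  by (intro real_sqrt_le_mono integral_mono power_mono)
    (use assms in \<open>auto simp: square_integrable_def\<close>)

lemma norm_cutoff_le:
  assumes "E \<in> sets borel"
  shows "norm (blinfun_apply (cutoff E) F) \<le> norm F"
proof -
  have "norm (blinfun_apply (cutoff E) (abs_L2 (rep_L2 F))) \<le> norm (abs_L2 (rep_L2 F))"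
    unfolding cutoff_apply[OF assms square_integrable_rep_L2]
    by (intro norm_abs_L2_mono square_integrable_indicator_mult assms square_integrable_rep_L2)
      (auto simp: indicator_def)
  then show ?thesis by simp
qed

lemma cutoff_tendsto:
  assumes "\<And>n. E n \<in> sets borel" "E' \<in> sets borel" "\<And>x. \<forall>\<^sub>F n in sequentially. x \<in> E n \<longleftrightarrow> x \<in> E'"
  shows "(\<lambda>n. blinfun_apply (cutoff (E n)) F) \<longlonglongrightarrow> blinfun_apply (cutoff E') F"
proof -
  let ?f = "rep_L2 F"
  have "(\<lambda>n. abs_L2 (\<lambda>x. indicator (E n) x * ?f x)) \<longlonglongrightarrow> abs_L2 (\<lambda>x. indicator E' x * ?f x)"
  proof (rule abs_L2_tendsto[OF _ _ square_integrable_rep_L2[of F]])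
    fix x
    have "\<forall>\<^sub>F n in sequentially. indicator (E n) x * ?f x = indicator E' x * ?f x"
      using assms(3)[of x] by eventually_elim (simp add: indicator_def)
    then show "(\<lambda>n. indicator (E n) x * ?f x) \<longlonglongrightarrow> indicator E' x * ?f x"
      by (rule tendsto_eventually)
  qed (use assms in \<open>auto simp: indicator_def\<close>)
  then show ?thesis
    using cutoff_apply[OF assms(1) square_integrable_rep_L2[of F]] cutoff_apply[OF assms(2) square_integrable_rep_L2[of F]]
    by simp
qed

text \<open>One half of the Schur test: by Tonelli the variable on which \<open>g\<close> does not
  depend is integrated first. The arithmetic-geometric mean inequality later combines it with its
  mirror image \<open>Schur_test_snd\<close>.\<close>

lemma Schur_test:
  fixes H :: "'a::euclidean_space \<times> 'a \<Rightarrow> ennreal"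
  assumes meas [measurable]: "H \<in> borel_measurable (lborel \<Otimes>\<^sub>M lborel)"
    "A \<in> sets borel" "g \<in> borel_measurable borel"
    and \<alpha>: "\<And>x. x \<in> A \<Longrightarrow> (\<integral>\<^sup>+y. H (x, y) \<partial>lborel) \<le> \<alpha>"
    and g: "\<And>x. x \<notin> A \<Longrightarrow> g x = 0"
  shows "(\<integral>\<^sup>+z. H z * g (fst z) \<partial>(lborel \<Otimes>\<^sub>M lborel)) \<le> \<alpha> * (\<integral>\<^sup>+x. g x \<partial>lborel)"
proof -
  have "(\<integral>\<^sup>+z. H z * g (fst z) \<partial>(lborel \<Otimes>\<^sub>M lborel)) = (\<integral>\<^sup>+x. \<integral>\<^sup>+y. H (x, y) * g x \<partial>lborel \<partial>lborel)"
    by (subst lborel.nn_integral_fst[symmetric]) auto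
  also have "\<dots> = (\<integral>\<^sup>+x. (\<integral>\<^sup>+y. H (x, y) \<partial>lborel) * g x \<partial>lborel)"
    by (intro nn_integral_cong nn_integral_multc) measurable
  also have "\<dots> \<le> (\<integral>\<^sup>+x. \<alpha> * g x \<partial>lborel)"
  proof (intro nn_integral_mono)
    fix x
    show "(\<integral>\<^sup>+y. H (x, y) \<partial>lborel) * g x \<le> \<alpha> * g x"
      using \<alpha>[of x] g[of x] by (cases "x \<in> A") (auto intro: mult_right_mono)
  qed
  also have "\<dots> = \<alpha> * (\<integral>\<^sup>+x. g x \<partial>lborel)"
    by (rule nn_integral_cmult) auto
  finally show ?thesis .
qed

lemma Schur_test_snd:
  fixes H :: "'a::euclidean_space \<times> 'a \<Rightarrow> ennreal"
  assumes meas [measurable]: "H \<in> borel_measurable (lborel \<Otimes>\<^sub>M lborel)"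
    "B \<in> sets borel" "f \<in> borel_measurable borel"
    and \<beta>: "\<And>y. y \<in> B \<Longrightarrow> (\<integral>\<^sup>+x. H (x, y) \<partial>lborel) \<le> \<beta>"
    and f: "\<And>y. y \<notin> B \<Longrightarrow> f y = 0"
  shows "(\<integral>\<^sup>+z. H z * f (snd z) \<partial>(lborel \<Otimes>\<^sub>M lborel)) \<le> \<beta> * (\<integral>\<^sup>+y. f y \<partial>lborel)"
proof -
  have "(\<integral>\<^sup>+z. H z * f (snd z) \<partial>(lborel \<Otimes>\<^sub>M lborel))
      = (\<integral>\<^sup>+z. H (snd z, fst z) * f (fst z) \<partial>(lborel \<Otimes>\<^sub>M lborel))"
    by (subst lborel_pair.distr_pair_swap, subst nn_integral_distr) (auto simp: split_beta')
  also have "\<dots> \<le> \<beta> * (\<integral>\<^sup>+y. f y \<partial>lborel)"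
    by (rule Schur_test[where H = "\<lambda>z. H (snd z, fst z)", OF _ meas(2,3) _ f]) (use \<beta> in auto)
  finally show ?thesis .
qed

section \<open>Kernel bounds for matrix coefficients between separated bounded sets\<close>

context off_diagonal_kernel
begin

text \<open>On the diagonal the value is 0, because \<open>0 powr (- m) = 0\<close>.\<close>

definition majorant :: "'a \<Rightarrow> 'a \<Rightarrow> real" where
  "majorant x y = c * norm (x - y) powr (- m)"

lemma majorant_nonneg: "0 \<le> majorant x y"
  unfolding majorant_def using c by simp

lemma majorant_commute: "majorant x y = majorant y x"
  by (simp add: majorant_def norm_minus_commute)

lemma majorant_measurable [measurable]:
  "(\<lambda>z. majorant (fst z) (snd z)) \<in> borel_measurable (borel \<Otimes>\<^sub>M borel)"
  unfolding majorant_def by measurable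

text \<open>Taking values in \<open>ennreal\<close> allows splitting and estimating the form before
  it is known to be finite.\<close>

definition majorant_form :: "('a \<Rightarrow> complex) \<Rightarrow> ('a \<Rightarrow> complex) \<Rightarrow> ennreal" where
  "majorant_form g f = (\<integral>\<^sup>+z. ennreal (majorant (fst z) (snd z) * (cmod (g (fst z)) * cmod (f (snd z)))) \<partial>(lborel \<Otimes>\<^sub>M lborel))"

lemma majorant_form_split:
  assumes [measurable]: "g \<in> borel_measurable borel" "f \<in> borel_measurable borel" "E \<in> sets borel"
  shows "majorant_form g f = majorant_form (\<lambda>x. indicator E x * g x) f + majorant_form (\<lambda>x. indicator (- E) x * g x) f"
    and "majorant_form g f = majorant_form g (\<lambda>x. indicator E x * f x) + majorant_form g (\<lambda>x. indicator (- E) x * f x)"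
proof -
  have [measurable]: "- E \<in> sets borel" using assms(3) by (simp add: Compl_eq_Diff_UNIV sets.Diff)
  show "majorant_form g f = majorant_form (\<lambda>x. indicator E x * g x) f + majorant_form (\<lambda>x. indicator (- E) x * g x) f"
    unfolding majorant_form_def
    by (subst nn_integral_add[symmetric]) (auto intro!: nn_integral_cong simp: indicator_def)
  show "majorant_form g f = majorant_form g (\<lambda>x. indicator E x * f x) + majorant_form g (\<lambda>x. indicator (- E) x * f x)"
    unfolding majorant_form_def
    by (subst nn_integral_add[symmetric]) (auto intro!: nn_integral_cong simp: indicator_def)
qed

lemma pairing_bound_box:
  assumes disj: "cbox a b \<inter> cbox a' b' = {}"
    and g: "square_integrable g" "\<And>x. x \<notin> box a b \<Longrightarrow> g x = 0"
    and f: "square_integrable f" "\<And>x. x \<notin> box a' b' \<Longrightarrow> f x = 0"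
  shows "ennreal (cmod (pairing g (blinfun_apply S (abs_L2 f)))) \<le> majorant_form g f"
proof -
  have "ennreal (cmod (pairing g (blinfun_apply S (abs_L2 f)))) = ennreal (cmod (kernel_form g f))"
    using pairing_eq_kernel_form[OF assms] by simp
  also have "\<dots> \<le> (\<integral>\<^sup>+z. ennreal (cmod (k z * (g (fst z) * f (snd z)))) \<partial>lborel)"
    unfolding kernel_form_def
    by (rule integral_norm_bound_ennreal[OF kernel_integrable_complex[OF assms]])
  also have "\<dots> \<le> (\<integral>\<^sup>+z. ennreal (majorant (fst z) (snd z) * (cmod (g (fst z)) * cmod (f (snd z)))) \<partial>lborel)"
  proof (intro nn_integral_mono ennreal_leI)
    fix z :: "'a \<times> 'a"
    obtain x y where z: "z = (x, y)" by (cases z)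
    have "g x * f y = 0" if "x = y"
    proof (cases "x \<in> box a b")
      case True
      then have "y \<notin> box a' b'" using disj box_subset_cbox that by blast
      then show ?thesis by (simp add: f)
    qed (simp add: g)
    then have "x \<noteq> y \<or> g x * f y = 0" by blast
    then show "cmod (k z * (g (fst z) * f (snd z))) \<le> majorant (fst z) (snd z) * (cmod (g (fst z)) * cmod (f (snd z)))"
    proof
      assume "x \<noteq> y"
      then have "cmod (k (x, y)) * cmod (g x * f y) \<le> majorant x y * cmod (g x * f y)"
        unfolding majorant_def by (intro mult_right_mono k_bound) auto
      then show ?thesis by (simp add: z norm_mult)
    qed (auto simp: z)
  qed
  finally show ?thesis by (simp add: majorant_form_def lborel_prod)
qed

text \<open>Both functions are cut along finitely many small boxes. The left side is subadditive
  under such cuts while \<open>majorant_form\<close> is exactly additive, so the number of boxes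
  does not enter the bound.\<close>

lemma pairing_bound:
  assumes A: "bounded A" and B: "bounded B"
    and d: "d > 0" "\<And>x y. x \<in> A \<Longrightarrow> y \<in> B \<Longrightarrow> d \<le> dist x y"
    and g: "square_integrable g" "\<And>x. x \<notin> A \<Longrightarrow> g x = 0"
    and f: "square_integrable f" "\<And>x. x \<notin> B \<Longrightarrow> f x = 0"
  shows "ennreal (cmod (pairing g (blinfun_apply S (abs_L2 f)))) \<le> majorant_form g f"
proof -
  let ?small = "\<lambda>\<P>. \<forall>(a, b)\<in>\<P>. \<forall>x\<in>cbox a b. \<forall>y\<in>cbox a b. dist x y < d / 2"
  let ?bound = "\<lambda>g f. ennreal (cmod (pairing g (blinfun_apply S (abs_L2 f)))) \<le> majorant_form g f"
  have small_boxes: "?bound g f"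
    if "?small {(a, b)}" "?small {(a', b')}"
      and g: "square_integrable g" "\<And>x. x \<notin> A \<inter> box a b \<Longrightarrow> g x = 0"
      and f: "square_integrable f" "\<And>x. x \<notin> B \<inter> box a' b' \<Longrightarrow> f x = 0" for a b a' b' g f
  proof (cases "A \<inter> box a b = {} \<or> B \<inter> box a' b' = {}")
    case True
    then have "(\<forall>x. g x = 0) \<or> (\<forall>x. f x = 0)" using g(2) f(2) by blast
    then have "g = (\<lambda>_. 0) \<or> f = (\<lambda>_. 0)" by (simp add: fun_eq_iff)
    then show ?thesis using g(1) by (auto simp: pairing_zero_left blinfun_abs_L2_zero pairing_zero_right)
  next
    case False
    then obtain u v where u: "u \<in> A" "u \<in> cbox a b" and v: "v \<in> B" "v \<in> cbox a' b'"
      using box_subset_cbox by blast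
    \<comment> \<open>With box diameters below \<open>d / 2\<close>, a common point of the two
      closed boxes would bring a point of \<open>A\<close> closer than \<open>d\<close> to a point
      of \<open>B\<close>.\<close>
    have "w \<notin> cbox a' b'" if "w \<in> cbox a b" for w
    proof
      assume "w \<in> cbox a' b'"
      then have "dist u w < d / 2" "dist w v < d / 2" using \<open>?small {(a, b)}\<close> \<open>?small {(a', b')}\<close> u v that by auto
      then show False using d(2)[OF u(1) v(1)] dist_triangle[of u v w] by linarith
    qed
    then have "cbox a b \<inter> cbox a' b' = {}" by auto
    then show ?thesis by (rule pairing_bound_box) (use g f in auto)
  qed
  \<comment> \<open>First \<open>g\<close> is cut up while \<open>f\<close> stays in one small box;
    \<open>right\<close> then cuts up \<open>f\<close>, with this claim as its one-box case.\<close>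
  have left: "?bound g f"
    if "finite \<P>" "?small \<P>" "?small {(a', b')}"
      and "square_integrable g" "\<And>x. x \<notin> A \<inter> (\<Union>(a, b)\<in>\<P>. box a b) \<Longrightarrow> g x = 0"
      and f: "square_integrable f" "\<And>x. x \<notin> B \<inter> box a' b' \<Longrightarrow> f x = 0" for \<P> a' b' g f
    using that(1,2,4,5)
  proof (induction \<P> arbitrary: g)
    case empty
    then have "g = (\<lambda>_. 0)" by auto
    then show ?case by (simp add: pairing_zero_left)
  next
    case (insert p \<P>)
    obtain a b where p: "p = (a, b)" by (cases p)
    let ?g1 = "\<lambda>x. indicator (box a b) x * g x" and ?g2 = "\<lambda>x. indicator (- box a b) x * g x"
    have sq: "square_integrable ?g1" "square_integrable ?g2"
      using insert by (auto intro!: square_integrable_indicator_mult simp: Compl_eq_Diff_UNIV)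
    have "?bound ?g1 f"
      by (rule small_boxes[OF _ \<open>?small {(a', b')}\<close> sq(1) _ f])
        (use insert.prems(1,3) p in \<open>auto simp: indicator_def\<close>)
    moreover have "?bound ?g2 f"
      by (rule insert.IH[OF _ sq(2)]) (use insert.prems(1,3) p in \<open>auto simp: indicator_def\<close>)
    moreover have "pairing g (blinfun_apply S (abs_L2 f))
        = pairing ?g1 (blinfun_apply S (abs_L2 f)) + pairing ?g2 (blinfun_apply S (abs_L2 f))"
      by (subst indicator_split[of g "box a b"]) (rule pairing_add_left[OF sq])
    moreover have "majorant_form g f = majorant_form ?g1 f + majorant_form ?g2 f"
      by (rule majorant_form_split) (use insert.prems(2) f(1) in \<open>auto intro: square_integrable_measurable\<close>)
    ultimately show ?case
      by (simp add: order_trans[OF ennreal_leI[OF norm_triangle_ineq]] add_mono)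
  qed
  obtain \<P> where \<P>: "finite \<P>" "A \<subseteq> (\<Union>(a, b)\<in>\<P>. box a b)" "?small \<P>"
    using finite_small_box_cover[OF A, of "d / 2"] d(1) by (smt (verit) case_prodI2 half_gt_zero)
  obtain \<Q> where \<Q>: "finite \<Q>" "B \<subseteq> (\<Union>(a, b)\<in>\<Q>. box a b)" "?small \<Q>"
    using finite_small_box_cover[OF B, of "d / 2"] d(1) by (smt (verit) case_prodI2 half_gt_zero)
  have g': "g x = 0" if "x \<notin> A \<inter> (\<Union>(a, b)\<in>\<P>. box a b)" for x
    using g(2) \<P>(2) that by blast
  have right: "?bound g f"
    if "finite \<Q>" "?small \<Q>"
      and "square_integrable f" "\<And>x. x \<notin> B \<inter> (\<Union>(a, b)\<in>\<Q>. box a b) \<Longrightarrow> f x = 0" for \<Q> f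
    using that
  proof (induction \<Q> arbitrary: f)
    case empty
    then have "f = (\<lambda>_. 0)" by auto
    then show ?case using g(1) by (simp add: blinfun_abs_L2_zero pairing_zero_right)
  next
    case (insert p \<Q>)
    obtain a b where p: "p = (a, b)" by (cases p)
    let ?f1 = "\<lambda>x. indicator (box a b) x * f x" and ?f2 = "\<lambda>x. indicator (- box a b) x * f x"
    have sq: "square_integrable ?f1" "square_integrable ?f2"
      using insert by (auto intro!: square_integrable_indicator_mult simp: Compl_eq_Diff_UNIV)
    have "?bound g ?f1"
      by (rule left[OF \<P>(1,3) _ g(1) g' sq(1)])
        (use insert.prems(1,3) p in \<open>auto simp: indicator_def\<close>)
    moreover have "?bound g ?f2"
      by (rule insert.IH[OF _ sq(2)]) (use insert.prems(1,3) p in \<open>auto simp: indicator_def\<close>)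
    moreover have "pairing g (blinfun_apply S (abs_L2 f))
        = pairing g (blinfun_apply S (abs_L2 ?f1)) + pairing g (blinfun_apply S (abs_L2 ?f2))"
      by (subst indicator_split[of f "box a b"])
        (simp add: blinfun_abs_L2_add[OF sq] pairing_add[OF g(1)])
    moreover have "majorant_form g f = majorant_form g ?f1 + majorant_form g ?f2"
      by (rule majorant_form_split) (use insert.prems(2) g(1) in \<open>auto intro: square_integrable_measurable\<close>)
    ultimately show ?case
      by (simp add: order_trans[OF ennreal_leI[OF norm_triangle_ineq]] add_mono)
  qed
  show ?thesis
    by (rule right[OF \<Q>(1,3) f(1)]) (use f(2) \<Q>(2) in blast)
qed

end

section \<open>Calculus of off-diagonal norm bounds\<close>

lemma cutoff_cutoff:
  assumes "A \<in> sets borel" "B \<in> sets borel"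
  shows "blinfun_apply (cutoff A) (blinfun_apply (cutoff B) F) = blinfun_apply (cutoff (A \<inter> B)) F"
proof -
  have "blinfun_apply (cutoff A) (blinfun_apply (cutoff B) (abs_L2 (rep_L2 F)))
      = blinfun_apply (cutoff (A \<inter> B)) (abs_L2 (rep_L2 F))"
    using assms by (simp only: cutoff_apply square_integrable_rep_L2 square_integrable_indicator_mult sets.Int)
      (simp add: indicator_inter_arith mult.assoc)
  then show ?thesis by simp
qed

lemma cutoff_disjoint_Un:
  assumes "A \<in> sets borel" "B \<in> sets borel" "A \<inter> B = {}"
  shows "blinfun_apply (cutoff (A \<union> B)) F = blinfun_apply (cutoff A) F + blinfun_apply (cutoff B) F"
proof -
  have "(\<lambda>x. indicator (A \<union> B) x * f x) = (\<lambda>x. indicator A x * f x + indicator B x * f x)"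
    for f :: "'a \<Rightarrow> complex"
    using assms(3) by (auto simp: indicator_def fun_eq_iff)
  then have "blinfun_apply (cutoff (A \<union> B)) (abs_L2 (rep_L2 F))
      = blinfun_apply (cutoff A) (abs_L2 (rep_L2 F)) + blinfun_apply (cutoff B) (abs_L2 (rep_L2 F))"
    using assms by (simp only: cutoff_apply square_integrable_rep_L2 sets.Un)
      (simp add: abs_L2_add square_integrable_indicator_mult square_integrable_rep_L2)
  then show ?thesis by simp
qed

text \<open>Both orders are recorded because the adjoint of \<open>S\<close>, whose kernel satisfies the same bound, is
  not used.\<close>
definition offdiag_le :: "('a::euclidean_space L2 \<Rightarrow>\<^sub>L 'a L2) \<Rightarrow> 'a set \<Rightarrow> 'a set \<Rightarrow> real \<Rightarrow> bool" where
  "offdiag_le S A B t \<longleftrightarrow> (\<forall>F.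
     norm (blinfun_apply (cutoff A) (blinfun_apply S (blinfun_apply (cutoff B) F))) \<le> t * norm F \<and>
     norm (blinfun_apply (cutoff B) (blinfun_apply S (blinfun_apply (cutoff A) F))) \<le> t * norm F)"

lemma offdiag_le_commute: "offdiag_le S A B t \<longleftrightarrow> offdiag_le S B A t"
  unfolding offdiag_le_def by blast

lemma offdiag_le_weaken:
  assumes "offdiag_le S A B t" "0 \<le> t" "t \<le> t'"
  shows "offdiag_le S A B t'"
  using assms unfolding offdiag_le_def by (meson order_trans mult_right_mono norm_ge_zero)

lemma offdiag_le_mono_right:
  assumes "offdiag_le S A B t" "0 \<le> t" "A \<in> sets borel" "B \<in> sets borel" "B' \<in> sets borel" "B' \<subseteq> B"
  shows "offdiag_le S A B' t"
  unfolding offdiag_le_def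
proof (intro allI conjI)
  fix F
  have eq: "blinfun_apply (cutoff B') G = blinfun_apply (cutoff B) (blinfun_apply (cutoff B') G)"
    "blinfun_apply (cutoff B') G = blinfun_apply (cutoff B') (blinfun_apply (cutoff B) G)" for G
    using assms by (simp_all add: cutoff_cutoff Int_absorb1 Int_absorb2)
  have "norm (blinfun_apply (cutoff A) (blinfun_apply S (blinfun_apply (cutoff B) (blinfun_apply (cutoff B') F))))
      \<le> t * norm (blinfun_apply (cutoff B') F)"
    using assms(1) by (auto simp: offdiag_le_def)
  also have "\<dots> \<le> t * norm F"
    by (intro mult_left_mono norm_cutoff_le assms)
  finally show "norm (blinfun_apply (cutoff A) (blinfun_apply S (blinfun_apply (cutoff B') F))) \<le> t * norm F"
    by (simp flip: eq(1))
  have "norm (blinfun_apply (cutoff B') (blinfun_apply (cutoff B) (blinfun_apply S (blinfun_apply (cutoff A) F))))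
      \<le> norm (blinfun_apply (cutoff B) (blinfun_apply S (blinfun_apply (cutoff A) F)))"
    by (intro norm_cutoff_le assms)
  also have "\<dots> \<le> t * norm F"
    using assms(1) by (auto simp: offdiag_le_def)
  finally show "norm (blinfun_apply (cutoff B') (blinfun_apply S (blinfun_apply (cutoff A) F))) \<le> t * norm F"
    by (simp flip: eq(2))
qed

lemma offdiag_le_mono:
  assumes "offdiag_le S A B t" "0 \<le> t" "A \<in> sets borel" "B \<in> sets borel"
    "A' \<in> sets borel" "A' \<subseteq> A" "B' \<in> sets borel" "B' \<subseteq> B"
  shows "offdiag_le S A' B' t"
  by (meson assms offdiag_le_mono_right offdiag_le_commute)

lemma offdiag_le_Un_right:
  assumes "offdiag_le S A B t" "offdiag_le S A B' t'" "0 \<le> t'"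
    "A \<in> sets borel" "B \<in> sets borel" "B' \<in> sets borel"
  shows "offdiag_le S A (B \<union> B') (t + t')"
proof -
  \<comment> \<open>Cutoffs add only over disjoint sets, so \<open>B\<close> is removed from
    \<open>B'\<close>.\<close>
  have *: "offdiag_le S A (B' - B) t'"
    using assms by (intro offdiag_le_mono_right[OF assms(2)]) auto
  have eq: "blinfun_apply (cutoff (B \<union> B')) F = blinfun_apply (cutoff B) F + blinfun_apply (cutoff (B' - B)) F" for F
    using cutoff_disjoint_Un[of B "B' - B" F] assms by auto
  show ?thesis
    unfolding offdiag_le_def eq blinfun.add_right
    using assms(1) * unfolding offdiag_le_def distrib_right
    by (auto intro!: norm_triangle_mono)
qed

text \<open>The cutoffs converge strongly, in general not in norm. This suffices because the bound
  is stated separately for each \<open>F\<close>.\<close>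

lemma offdiag_le_limit:
  assumes "\<And>n. offdiag_le S A (B n) t" "\<And>n. B n \<in> sets borel" "B' \<in> sets borel"
    "\<And>x. \<forall>\<^sub>F n in sequentially. x \<in> B n \<longleftrightarrow> x \<in> B'"
  shows "offdiag_le S A B' t"
  unfolding offdiag_le_def
proof (intro allI conjI)
  fix F
  note lim = cutoff_tendsto[OF assms(2-4)]
  have "(\<lambda>n. norm (blinfun_apply (cutoff A) (blinfun_apply S (blinfun_apply (cutoff (B n)) F))))
      \<longlonglongrightarrow> norm (blinfun_apply (cutoff A) (blinfun_apply S (blinfun_apply (cutoff B') F)))"
    by (intro tendsto_norm blinfun.tendsto tendsto_const lim)
  then show "norm (blinfun_apply (cutoff A) (blinfun_apply S (blinfun_apply (cutoff B') F))) \<le> t * norm F"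
    by (rule LIMSEQ_le_const2) (use assms(1) in \<open>auto simp: offdiag_le_def\<close>)
  have "(\<lambda>n. norm (blinfun_apply (cutoff (B n)) (blinfun_apply S (blinfun_apply (cutoff A) F))))
      \<longlonglongrightarrow> norm (blinfun_apply (cutoff B') (blinfun_apply S (blinfun_apply (cutoff A) F)))"
    by (intro tendsto_norm lim)
  then show "norm (blinfun_apply (cutoff B') (blinfun_apply S (blinfun_apply (cutoff A) F))) \<le> t * norm F"
    by (rule LIMSEQ_le_const2) (use assms(1) in \<open>auto simp: offdiag_le_def\<close>)
qed

lemma eventually_mem_Int_ball:
  "\<forall>\<^sub>F n in sequentially. (x \<in> E \<inter> ball 0 (real n)) \<longleftrightarrow> x \<in> E"
  for x :: "'a::real_normed_vector"
proof -
  have "\<forall>\<^sub>F n in sequentially. norm x < real n"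
    using filterlim_real_sequentially by (simp add: filterlim_at_top_dense)
  then show ?thesis by eventually_elim simp
qed

lemma nn_integral_norm_power2:
  "square_integrable f \<Longrightarrow> (\<integral>\<^sup>+x. ennreal ((cmod (f x))\<^sup>2) \<partial>lborel) = ennreal ((norm (abs_L2 f))\<^sup>2)"
  by (simp add: norm_abs_L2 nn_integral_eq_integral square_integrable_def)

section \<open>From integral bounds on the majorant to operator bounds\<close>

context off_diagonal_kernel
begin

text \<open>The product of \<open>cmod (g x)\<close> and \<open>cmod (f y)\<close> is split by
  \<open>2 * (a * b) \<le> s * a\<^sup>2 + 1 / s * b\<^sup>2\<close>, and one half of the Schur test
  is applied to each term. The weight \<open>s\<close> stays free for the later
  optimisation.\<close>

lemma majorant_form_le:
  assumes [measurable]: "A \<in> sets borel" "B \<in> sets borel"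
    and \<alpha>: "\<And>x. x \<in> A \<Longrightarrow> (\<integral>\<^sup>+y. ennreal (majorant x y) * indicator B y \<partial>lborel) \<le> ennreal \<alpha>" "0 \<le> \<alpha>"
    and \<beta>: "\<And>y. y \<in> B \<Longrightarrow> (\<integral>\<^sup>+x. ennreal (majorant x y) * indicator A x \<partial>lborel) \<le> ennreal \<beta>" "0 \<le> \<beta>"
    and s: "s > 0"
    and g: "square_integrable g" "\<And>x. x \<notin> A \<Longrightarrow> g x = 0"
    and f: "square_integrable f" "\<And>x. x \<notin> B \<Longrightarrow> f x = 0"
  shows "2 * majorant_form g f \<le> ennreal (\<alpha> * (s * (norm (abs_L2 g))\<^sup>2) + \<beta> * (1 / s * (norm (abs_L2 f))\<^sup>2))"
proof -
  have [measurable]: "g \<in> borel_measurable borel" "f \<in> borel_measurable borel"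
    using f g by (auto intro: square_integrable_measurable)
  let ?H = "\<lambda>z. ennreal (majorant (fst z) (snd z))"
  have "2 * (a * b) \<le> s * a\<^sup>2 + 1 / s * b\<^sup>2" for a b :: real
  proof -
    have "0 \<le> (s * a - b)\<^sup>2 / s" using s by simp
    also have "\<dots> = s * a\<^sup>2 + 1 / s * b\<^sup>2 - 2 * (a * b)"
      using s by (simp add: power2_eq_square field_simps)
    finally show ?thesis by simp
  qed
  then have amgm: "majorant x y * (2 * (a * b)) \<le> majorant x y * (s * a\<^sup>2 + 1 / s * b\<^sup>2)" for x y a b
    by (intro mult_left_mono majorant_nonneg)
  have ennreal_distrib: "ennreal (a * (b + b')) = ennreal a * ennreal b + ennreal a * ennreal b'"
    if "0 \<le> a" "0 \<le> b" "0 \<le> b'" for a b b' :: real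
    using that by (simp add: distrib_left ennreal_mult)
  have "2 * majorant_form g f
      = (\<integral>\<^sup>+z. 2 * ennreal (majorant (fst z) (snd z) * (cmod (g (fst z)) * cmod (f (snd z)))) \<partial>(lborel \<Otimes>\<^sub>M lborel))"
    unfolding majorant_form_def by (subst nn_integral_cmult) auto
  also have "\<dots> \<le> (\<integral>\<^sup>+z. (?H z * indicator B (snd z)) * ennreal (s * (cmod (g (fst z)))\<^sup>2)
      + (?H z * indicator A (fst z)) * ennreal (1 / s * (cmod (f (snd z)))\<^sup>2) \<partial>(lborel \<Otimes>\<^sub>M lborel))"
  proof (intro nn_integral_mono)
    fix z :: "'a \<times> 'a"
    obtain x y where z: "z = (x, y)" by (cases z)
    show "2 * ennreal (majorant (fst z) (snd z) * (cmod (g (fst z)) * cmod (f (snd z))))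
      \<le> (?H z * indicator B (snd z)) * ennreal (s * (cmod (g (fst z)))\<^sup>2)
      + (?H z * indicator A (fst z)) * ennreal (1 / s * (cmod (f (snd z)))\<^sup>2)"
    proof (cases "x \<in> A \<and> y \<in> B")
      case True
      have "2 * ennreal (majorant x y * (cmod (g x) * cmod (f y))) = ennreal (majorant x y * (2 * (cmod (g x) * cmod (f y))))"
        by (simp add: ennreal_mult' mult_ac flip: ennreal_numeral)
      also have "\<dots> \<le> ennreal (majorant x y * (s * (cmod (g x))\<^sup>2 + 1 / s * (cmod (f y))\<^sup>2))"
        by (intro ennreal_leI amgm)
      also have "\<dots> = ennreal (majorant x y) * ennreal (s * (cmod (g x))\<^sup>2) + ennreal (majorant x y) * ennreal (1 / s * (cmod (f y))\<^sup>2)"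
        using s by (intro ennreal_distrib majorant_nonneg) auto
      finally show ?thesis using True by (simp add: z)
    next
      case False
      then show ?thesis using f(2) g(2) by (auto simp: z)
    qed
  qed
  also have "\<dots> = (\<integral>\<^sup>+z. (?H z * indicator B (snd z)) * ennreal (s * (cmod (g (fst z)))\<^sup>2) \<partial>(lborel \<Otimes>\<^sub>M lborel))
      + (\<integral>\<^sup>+z. (?H z * indicator A (fst z)) * ennreal (1 / s * (cmod (f (snd z)))\<^sup>2) \<partial>(lborel \<Otimes>\<^sub>M lborel))"
    by (rule nn_integral_add) measurable
  also have "\<dots> \<le> ennreal \<alpha> * (\<integral>\<^sup>+x. ennreal (s * (cmod (g x))\<^sup>2) \<partial>lborel)
      + ennreal \<beta> * (\<integral>\<^sup>+x. ennreal (1 / s * (cmod (f x))\<^sup>2) \<partial>lborel)"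
  proof (rule add_mono)
    show "(\<integral>\<^sup>+z. (?H z * indicator B (snd z)) * ennreal (s * (cmod (g (fst z)))\<^sup>2) \<partial>(lborel \<Otimes>\<^sub>M lborel))
        \<le> ennreal \<alpha> * (\<integral>\<^sup>+x. ennreal (s * (cmod (g x))\<^sup>2) \<partial>lborel)"
      by (rule Schur_test[where A = A]) (use \<alpha> g in \<open>auto\<close>)
    show "(\<integral>\<^sup>+z. (?H z * indicator A (fst z)) * ennreal (1 / s * (cmod (f (snd z)))\<^sup>2) \<partial>(lborel \<Otimes>\<^sub>M lborel))
        \<le> ennreal \<beta> * (\<integral>\<^sup>+x. ennreal (1 / s * (cmod (f x))\<^sup>2) \<partial>lborel)"
      by (rule Schur_test_snd[where B = B]) (use \<beta> f in \<open>auto\<close>)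
  qed
  also have "\<dots> = ennreal \<alpha> * ennreal (s * (norm (abs_L2 g))\<^sup>2) + ennreal \<beta> * ennreal (1 / s * (norm (abs_L2 f))\<^sup>2)"
    using s g(1) f(1)
    by (simp only: ennreal_mult less_imp_le divide_nonneg_pos zero_le_one zero_le_power2)
      (simp add: nn_integral_cmult nn_integral_norm_power2)
  also have "\<dots> = ennreal (\<alpha> * (s * (norm (abs_L2 g))\<^sup>2) + \<beta> * (1 / s * (norm (abs_L2 f))\<^sup>2))"
    using s \<alpha>(2) \<beta>(2) by (simp flip: ennreal_mult ennreal_plus)
  finally show ?thesis .
qed

lemma pairing_Schur:
  assumes bd: "bounded A" "bounded B" and AB: "A \<in> sets borel" "B \<in> sets borel"
    and d: "d > 0" "\<And>x y. x \<in> A \<Longrightarrow> y \<in> B \<Longrightarrow> d \<le> dist x y"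
    and \<alpha>: "\<And>x. x \<in> A \<Longrightarrow> (\<integral>\<^sup>+y. ennreal (majorant x y) * indicator B y \<partial>lborel) \<le> ennreal \<alpha>" "0 < \<alpha>"
    and \<beta>: "\<And>y. y \<in> B \<Longrightarrow> (\<integral>\<^sup>+x. ennreal (majorant x y) * indicator A x \<partial>lborel) \<le> ennreal \<beta>" "0 < \<beta>"
    and t: "t > 0" "\<alpha> * \<beta> \<le> t\<^sup>2"
    and g: "square_integrable g" "\<And>x. x \<notin> A \<Longrightarrow> g x = 0"
    and f: "square_integrable f" "\<And>x. x \<notin> B \<Longrightarrow> f x = 0"
  shows "cmod (pairing g (blinfun_apply S (abs_L2 f))) \<le> t * norm (abs_L2 g) * norm (abs_L2 f)"
proof -
  let ?p = "cmod (pairing g (blinfun_apply S (abs_L2 f)))" and ?G = "norm (abs_L2 g)" and ?F = "norm (abs_L2 f)"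
  consider "?G = 0" | "?F = 0" | "?G > 0" "?F > 0" by (auto simp: less_le)
  then show ?thesis
  proof cases
    case 1
    then show ?thesis using norm_pairing_le[OF g(1), of "blinfun_apply S (abs_L2 f)"] by simp
  next
    case 2
    then show ?thesis using norm_pairing_le[OF g(1), of "blinfun_apply S (abs_L2 f)"] by simp
  next
    case 3
    \<comment> \<open>This weight turns the first term into \<open>t * ?G * ?F\<close> and the
      second into \<open>\<alpha> * \<beta> * (?G * ?F / t)\<close>, which is at most the same
      because \<open>\<alpha> * \<beta> \<le> t\<^sup>2\<close>. Zero norms were split off
      beforehand to keep \<open>s\<close> positive.\<close>
    define s where "s = t * ?F / (\<alpha> * ?G)"
    have s: "s > 0" using 3 t \<alpha>(2) by (simp add: s_def)
    have "ennreal (2 * ?p) = 2 * ennreal ?p" by (simp add: ennreal_mult')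
    also have "\<dots> \<le> 2 * majorant_form g f"
      by (intro mult_left_mono pairing_bound[OF bd d g f]) auto
    also have "\<dots> \<le> ennreal (\<alpha> * (s * ?G\<^sup>2) + \<beta> * (1 / s * ?F\<^sup>2))"
      by (rule majorant_form_le[OF AB \<alpha>(1) _ \<beta>(1) _ s g f]) (use \<alpha>(2) \<beta>(2) in auto)
    finally have "2 * ?p \<le> \<alpha> * (s * ?G\<^sup>2) + \<beta> * (1 / s * ?F\<^sup>2)"
      using s \<alpha>(2) \<beta>(2) by (subst (asm) ennreal_le_iff) auto
    moreover have "\<alpha> * (s * ?G\<^sup>2) = t * ?G * ?F"
      using 3 \<alpha>(2) by (simp add: s_def power2_eq_square)
    moreover have "\<beta> * (1 / s * ?F\<^sup>2) = (\<alpha> * \<beta>) * (?G * ?F / t)"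
      using 3 \<alpha>(2) t by (simp add: s_def power2_eq_square field_simps)
    moreover have "(\<alpha> * \<beta>) * (?G * ?F / t) \<le> t\<^sup>2 * (?G * ?F / t)"
      using t by (intro mult_right_mono) auto
    moreover have "t\<^sup>2 * (?G * ?F / t) = t * ?G * ?F"
      using t by (simp add: power2_eq_square)
    ultimately show ?thesis by linarith
  qed
qed

lemma cutoff_Schur_bounded:
  assumes bd: "bounded A" "bounded B" and AB: "A \<in> sets borel" "B \<in> sets borel"
    and d: "d > 0" "\<And>x y. x \<in> A \<Longrightarrow> y \<in> B \<Longrightarrow> d \<le> dist x y"
    and \<alpha>: "\<And>x. x \<in> A \<Longrightarrow> (\<integral>\<^sup>+y. ennreal (majorant x y) * indicator B y \<partial>lborel) \<le> ennreal \<alpha>" "0 < \<alpha>"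
    and \<beta>: "\<And>y. y \<in> B \<Longrightarrow> (\<integral>\<^sup>+x. ennreal (majorant x y) * indicator A x \<partial>lborel) \<le> ennreal \<beta>" "0 < \<beta>"
    and t: "t > 0" "\<alpha> * \<beta> \<le> t\<^sup>2"
  shows "norm (blinfun_apply (cutoff A) (blinfun_apply S (blinfun_apply (cutoff B) F))) \<le> t * norm F"
proof -
  define f where "f x = indicator B x * rep_L2 F x" for x
  have f: "square_integrable f" "\<And>x. x \<notin> B \<Longrightarrow> f x = 0"
    unfolding f_def by (auto intro: square_integrable_indicator_mult AB square_integrable_rep_L2)
  have fF: "blinfun_apply (cutoff B) F = abs_L2 f"
    using cutoff_apply[OF AB(2) square_integrable_rep_L2[of F]] by (simp add: f_def[abs_def])
  define u where "u = rep_L2 (blinfun_apply S (abs_L2 f))"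
  have u: "square_integrable u" "blinfun_apply S (abs_L2 f) = abs_L2 u"
    unfolding u_def by (simp_all add: square_integrable_rep_L2)
  \<comment> \<open>Duality: since \<open>pairing\<close> is bilinear, testing against the conjugate
    of \<open>u\<close> cut to \<open>A\<close> yields \<open>?N\<^sup>2\<close>, while the norm of
    \<open>g\<close> is \<open>?N\<close>; one factor \<open>?N\<close> then cancels.\<close>
  define g where "g x = indicator A x * cnj (u x)" for x
  have "square_integrable (\<lambda>x. cnj (u x))"
  proof (rule square_integrable_mono[OF u(1)])
    have "cnj \<in> borel_measurable borel"
      by (intro borel_measurable_continuous_onI continuous_intros)
    then show "(\<lambda>x. cnj (u x)) \<in> borel_measurable borel"
      by (rule measurable_compose[OF square_integrable_measurable[OF u(1)]])
  qed simp
  then have g: "square_integrable g" "\<And>x. x \<notin> A \<Longrightarrow> g x = 0"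
    unfolding g_def by (auto intro: square_integrable_indicator_mult AB)
  have Au: "square_integrable (\<lambda>x. indicator A x * u x)"
    by (intro square_integrable_indicator_mult AB u)
  let ?N = "norm (abs_L2 (\<lambda>x. indicator A x * u x))"
  have gN: "norm (abs_L2 g) = ?N"
    unfolding norm_abs_L2[OF g(1)] norm_abs_L2[OF Au] by (simp add: g_def norm_mult)
  have cnj_mult: "cnj v * v = complex_of_real ((cmod v)\<^sup>2)" for v
    by (simp only: complex_norm_square mult.commute)
  have "pairing g (blinfun_apply S (abs_L2 f)) = (\<integral>x. complex_of_real ((cmod (indicator A x * u x))\<^sup>2) \<partial>lborel)"
    unfolding pairing_def u_def[symmetric]
    by (intro Bochner_Integration.integral_cong)
      (auto simp: g_def indicator_def cnj_mult simp del: of_real_power)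
  also have "\<dots> = complex_of_real (\<integral>x. (cmod (indicator A x * u x))\<^sup>2 \<partial>lborel)"
    by (rule integral_complex_of_real)
  also have "(\<integral>x. (cmod (indicator A x * u x))\<^sup>2 \<partial>lborel) = ?N\<^sup>2"
    by (simp add: norm_abs_L2[OF Au])
  finally have "cmod (pairing g (blinfun_apply S (abs_L2 f))) = ?N\<^sup>2" by (simp add: norm_power)
  then have "?N\<^sup>2 \<le> t * ?N * norm (abs_L2 f)"
    using pairing_Schur[OF bd AB d \<alpha> \<beta> t g f] by (simp add: gN)
  then have "?N * ?N \<le> ?N * (t * norm (abs_L2 f))" by (simp add: power2_eq_square mult_ac)
  then have "?N \<le> t * norm (abs_L2 f)"
    using t(1) by (cases "?N = 0") auto
  also have "\<dots> \<le> t * norm F"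
    using t(1) norm_cutoff_le[OF AB(2), of F] by (simp add: fF)
  finally show ?thesis by (simp add: fF u(2) cutoff_apply[OF AB(1) u(1)])
qed

text \<open>Intersecting with balls preserves the integral bounds with the same constants, so the
  bounded case passes to the strong limit. For the reverse order \<open>\<alpha>\<close> and
  \<open>\<beta>\<close> change places, as the majorant is symmetric.\<close>

lemma offdiag_le_Schur:
  assumes AB: "A \<in> sets borel" "B \<in> sets borel"
    and d: "d > 0" "\<And>x y. x \<in> A \<Longrightarrow> y \<in> B \<Longrightarrow> d \<le> dist x y"
    and \<alpha>: "\<And>x. x \<in> A \<Longrightarrow> (\<integral>\<^sup>+y. ennreal (majorant x y) * indicator B y \<partial>lborel) \<le> ennreal \<alpha>" "0 < \<alpha>"
    and \<beta>: "\<And>y. y \<in> B \<Longrightarrow> (\<integral>\<^sup>+x. ennreal (majorant x y) * indicator A x \<partial>lborel) \<le> ennreal \<beta>" "0 < \<beta>"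
    and t: "t > 0" "\<alpha> * \<beta> \<le> t\<^sup>2"
  shows "offdiag_le S A B t"
proof -
  have le: "(\<integral>\<^sup>+y. ennreal (majorant x y) * indicator (E \<inter> E') y \<partial>lborel) \<le> ennreal a"
    if "(\<integral>\<^sup>+y. ennreal (majorant x y) * indicator E y \<partial>lborel) \<le> ennreal a" for x E E' a
    by (rule order_trans[OF nn_integral_mono that]) (auto simp: indicator_def)
  have bounded: "offdiag_le S (A \<inter> ball 0 r) (B \<inter> ball 0 r') t" for r r'
    unfolding offdiag_le_def
  proof (intro allI conjI)
    fix F
    show "norm (blinfun_apply (cutoff (A \<inter> ball 0 r)) (blinfun_apply S (blinfun_apply (cutoff (B \<inter> ball 0 r')) F))) \<le> t * norm F"
    proof (rule cutoff_Schur_bounded[OF _ _ _ _ d(1) _ _ \<alpha>(2) _ \<beta>(2) t])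
      fix y assume "y \<in> B \<inter> ball 0 r'"
      then show "(\<integral>\<^sup>+x. ennreal (majorant x y) * indicator (A \<inter> ball 0 r) x \<partial>lborel) \<le> ennreal \<beta>"
        using le[of y A \<beta> "ball 0 r"] \<beta>(1)[of y] by (simp add: majorant_commute[of y])
    qed (use AB d(2) le \<alpha>(1) in auto)
    show "norm (blinfun_apply (cutoff (B \<inter> ball 0 r')) (blinfun_apply S (blinfun_apply (cutoff (A \<inter> ball 0 r)) F))) \<le> t * norm F"
    proof (rule cutoff_Schur_bounded[OF _ _ _ _ d(1) _ _ \<beta>(2) _ \<alpha>(2) t(1)])
      fix y assume "y \<in> B \<inter> ball 0 r'"
      then show "(\<integral>\<^sup>+x. ennreal (majorant y x) * indicator (A \<inter> ball 0 r) x \<partial>lborel) \<le> ennreal \<beta>"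
        using le[of y A \<beta> "ball 0 r"] \<beta>(1)[of y] by (simp add: majorant_commute[of y])
    next
      fix x assume "x \<in> A \<inter> ball 0 r"
      then show "(\<integral>\<^sup>+y. ennreal (majorant y x) * indicator (B \<inter> ball 0 r') y \<partial>lborel) \<le> ennreal \<alpha>"
        using le[of x B \<alpha> "ball 0 r'"] \<alpha>(1)[of x] by (simp add: majorant_commute[of x])
    next
      fix y x assume "y \<in> B \<inter> ball 0 r'" "x \<in> A \<inter> ball 0 r"
      then show "d \<le> dist y x" using d(2)[of x y] by (simp add: dist_commute)
    qed (use AB t(2) in \<open>auto simp: mult.commute\<close>)
  qed
  \<comment> \<open>The two exhaustions are carried out one after the other, first in
    \<open>B\<close> and then in \<open>A\<close>.\<close>
  have "offdiag_le S (A \<inter> ball 0 r) B t" for r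
    by (rule offdiag_le_limit[OF bounded[of r "real n" for n] _ _ eventually_mem_Int_ball]) (use AB in auto)
  then show ?thesis
    by (subst offdiag_le_commute)
      (rule offdiag_le_limit[where B = "\<lambda>n. A \<inter> ball 0 (real n)"],
        use AB in \<open>auto simp: offdiag_le_commute[of S B] intro: eventually_mem_Int_ball[simplified]\<close>)
qed

end

section \<open>Thin sets\<close>

definition nbhd :: "'a::metric_space set \<Rightarrow> real \<Rightarrow> 'a set" where
  "nbhd L e = (\<Union>a\<in>L. ball a e)"

lemma open_nbhd [simp]: "open (nbhd L e)"
  by (auto simp: nbhd_def)

lemma borel_nbhd [simp]: "nbhd L e \<in> sets borel"
  by simp

lemma nbhd_mono: "e \<le> e' \<Longrightarrow> nbhd L e \<subseteq> nbhd L e'"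
  unfolding nbhd_def by (intro UN_mono subset_ball) auto

text \<open>On the dyadic shell from \<open>R * 2 ^ k\<close> to \<open>R * 2 ^ Suc k\<close> the
  integrand is at most its value at the inner radius, and the shell lies in the ball of the outer
  radius. The resulting series is geometric with ratio \<open>q = 2 powr (n - m)\<close>, where
  \<open>n\<close> is the dimension, and \<open>q < 1\<close> since \<open>m > n\<close>.\<close>

lemma nn_integral_powr_tail:
  fixes m :: real
  assumes m: "m > real DIM('a::euclidean_space)"
  obtains C where "0 \<le> C" "\<And>R (x :: 'a). R > 0 \<Longrightarrow>
    (\<integral>\<^sup>+y. ennreal (norm (x - y) powr (- m)) * indicator (- ball x R) y \<partial>lborel)
      \<le> ennreal (C * R powr (real DIM('a) - m))"
proof -
  let ?n = "DIM('a)"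
  let ?V = "unit_ball_vol (real ?n)"
  define q where "q = 2 powr (real ?n - m)"
  have q: "0 < q" "q < 1" using m by (simp_all add: q_def powr_less_one)
  define C where "C = ?V * 2 ^ ?n / (1 - q)"
  show thesis
  proof (rule that)
    show "0 \<le> C" using q by (simp add: C_def)
    fix R :: real and x :: 'a
    assume R: "R > 0"
    have term_eq: "(R * 2 ^ k) powr (- m) * (?V * (R * 2 ^ Suc k) ^ ?n) = ?V * 2 ^ ?n * R powr (real ?n - m) * q ^ k" for k
    proof -
      have 1: "(R * 2 ^ Suc k) ^ ?n = R powr real ?n * 2 ^ ?n * (2 ^ k) powr real ?n"
        using R by (simp add: power_mult_distrib powr_realpow)
      have 2: "(R * 2 ^ k) powr (- m) = R powr (- m) * (2 ^ k) powr (- m)"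
        using R by (simp add: powr_mult)
      have 3: "(2 ^ k) powr (- m) * (2 ^ k) powr real ?n = q ^ k"
        by (simp add: q_def powr_power powr_powr powr_add[symmetric] algebra_simps flip: powr_realpow)
      have 4: "R powr (- m) * R powr real ?n = R powr (real ?n - m)"
        by (simp flip: powr_add)
      have "(R * 2 ^ k) powr (- m) * (?V * (R * 2 ^ Suc k) ^ ?n) = ?V * 2 ^ ?n * (R powr (- m) * R powr real ?n)
          * ((2 ^ k) powr (- m) * (2 ^ k) powr real ?n)"
        unfolding 1 2 by (simp only: mult_ac)
      then show ?thesis unfolding 3 4 .
    qed
    have "(\<integral>\<^sup>+y. ennreal (norm (x - y) powr (- m)) * indicator (- ball x R) y \<partial>lborel)
        \<le> (\<integral>\<^sup>+y. (\<Sum>k. ennreal ((R * 2 ^ k) powr (- m)) * indicator (ball x (R * 2 ^ Suc k)) y) \<partial>lborel)"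
    proof (intro nn_integral_mono)
      fix y
      let ?t = "\<lambda>k. ennreal ((R * 2 ^ k) powr (- m)) * indicator (ball x (R * 2 ^ Suc k)) y"
      show "ennreal (norm (x - y) powr (- m)) * indicator (- ball x R) y \<le> (\<Sum>k. ?t k)"
      proof (cases "y \<in> ball x R")
        case False
        then have yR: "R \<le> dist x y" by simp
        \<comment> \<open>The least such \<open>n\<close> is not 0, as
          \<open>R \<le> dist x y\<close>; its predecessor is the index of the shell containing
          \<open>y\<close>.\<close>
        define n where "n = (LEAST n. dist x y < R * 2 ^ n)"
        obtain n0 where "dist x y / R < 2 ^ n0"
          using real_arch_pow[of 2 "dist x y / R"] by auto
        then have "dist x y < R * 2 ^ n0" using R by (simp add: field_simps)
        then have n: "dist x y < R * 2 ^ n" unfolding n_def by (rule LeastI)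
        with yR obtain k where k: "n = Suc k" by (cases n) auto
        then have "k < (LEAST n. dist x y < R * 2 ^ n)" by (simp flip: n_def)
        then have "\<not> dist x y < R * 2 ^ k" by (rule not_less_Least)
        then have "norm (x - y) powr (- m) \<le> (R * 2 ^ k) powr (- m)"
          using R m by (intro powr_mono2') (auto simp: dist_norm)
        then have "ennreal (norm (x - y) powr (- m)) * indicator (- ball x R) y \<le> ?t k"
          using n k False by (simp add: ennreal_leI)
        also have "f k \<le> suminf f" for f :: "nat \<Rightarrow> ennreal"
          using sum_le_suminf[of f "{k}"] by simp
        finally show ?thesis .
      qed simp
    qed
    also have "\<dots> = (\<Sum>k. \<integral>\<^sup>+y. ennreal ((R * 2 ^ k) powr (- m)) * indicator (ball x (R * 2 ^ Suc k)) y \<partial>lborel)"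
    proof (rule nn_integral_suminf)
      fix k
      have "ball x (R * 2 ^ Suc k) \<in> sets lborel" by simp
      then show "(\<lambda>y. ennreal ((R * 2 ^ k) powr (- m)) * indicator (ball x (R * 2 ^ Suc k)) y) \<in> borel_measurable lborel"
        by (intro borel_measurable_times_ennreal borel_measurable_const borel_measurable_indicator)
    qed
    also have "\<dots> = (\<Sum>k. ennreal ((R * 2 ^ k) powr (- m)) * emeasure lborel (ball x (R * 2 ^ Suc k)))"
      by (simp only: nn_integral_cmult_indicator sets_lborel borel_open open_ball)
    also have "\<dots> = (\<Sum>k. ennreal (?V * 2 ^ ?n * R powr (real ?n - m) * q ^ k))"
      using R by (intro suminf_cong) (simp only: emeasure_ball ennreal_mult'[symmetric] term_eq[symmetric]
          powr_ge_zero mult_nonneg_nonneg zero_le_power less_imp_le zero_less_numeral)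
    also have "\<dots> = ennreal (\<Sum>k. ?V * 2 ^ ?n * R powr (real ?n - m) * q ^ k)"
      using q by (intro suminf_ennreal2) (auto intro!: summable_mult summable_geometric)
    also have "(\<Sum>k. ?V * 2 ^ ?n * R powr (real ?n - m) * q ^ k) = C * R powr (real ?n - m)"
      using q by (subst suminf_mult) (auto simp: C_def suminf_geometric intro!: summable_geometric)
    finally show "(\<integral>\<^sup>+y. ennreal (norm (x - y) powr (- m)) * indicator (- ball x R) y \<partial>lborel)
      \<le> ennreal (C * R powr (real ?n - m))" .
  qed
qed

text \<open>Packing: balls of radius \<open>e / 2\<close> around points of \<open>L\<close> are
  disjoint, and those around points of \<open>ball x R\<close> lie in \<open>ball x (R + e)\<close>.
  Comparing volumes gives a bound that does not depend on \<open>x\<close>.\<close>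

lemma uniform_discrete_card_le:
  fixes L :: "'a::euclidean_space set"
  assumes "e > 0" "\<And>x y. x \<in> L \<Longrightarrow> y \<in> L \<Longrightarrow> dist x y < e \<Longrightarrow> x = y" "R \<ge> 0"
  shows "finite (L \<inter> ball x R) \<and> card (L \<inter> ball x R) \<le> nat \<lfloor>((R + e) / (e / 2)) ^ DIM('a)\<rfloor>"
proof (rule finite_if_finite_subsets_card_bdd)
  fix F assume F: "F \<subseteq> L \<inter> ball x R" "finite F"
  let ?V = "unit_ball_vol (real DIM('a))"
  have disj: "disjoint_family_on (\<lambda>a. ball a (e / 2)) F"
    unfolding disjoint_family_on_def
  proof (intro ballI impI)
    fix a b assume ab: "a \<in> F" "b \<in> F" "a \<noteq> b"
    then have "e \<le> dist a b" using assms(2)[of a b] F(1) by force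
    moreover have "dist a b < e" if "x \<in> ball a (e / 2)" "x \<in> ball b (e / 2)" for x
      using that dist_triangle2[of a b x] by simp
    ultimately show "ball a (e / 2) \<inter> ball b (e / 2) = {}"
      by force
  qed
  have "real (card F) * (?V * (e / 2) ^ DIM('a)) = (\<Sum>a\<in>F. measure lborel (ball a (e / 2)))"
    using assms(1) by (simp add: content_ball)
  also have "\<dots> = measure lborel (\<Union>a\<in>F. ball a (e / 2))"
    using F(2) disj emeasure_lborel_ball_finite
    by (intro measure_finite_Union[symmetric]) (auto simp: less_top)
  also have "\<dots> \<le> measure lborel (ball x (R + e))"
  proof (rule measure_mono_fmeasurable)
    show "(\<Union>a\<in>F. ball a (e / 2)) \<subseteq> ball x (R + e)"
    proof safe
      fix a y assume "a \<in> F" "y \<in> ball a (e / 2)"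
      then have "dist x a < R" "dist a y < e / 2" using F(1) by auto
      then show "y \<in> ball x (R + e)" using dist_triangle[of x y a] assms(1) by simp
    qed
    show "(\<Union>a\<in>F. ball a (e / 2)) \<in> sets lborel" by (simp add: borel_open open_UN)
    show "ball x (R + e) \<in> fmeasurable lborel"
      by (rule fmeasurableI) (use emeasure_lborel_ball_finite[of x "R + e"] in auto)
  qed
  also have "\<dots> = ?V * (R + e) ^ DIM('a)"
    using assms by (simp add: content_ball)
  finally have "?V * (real (card F) * (e / 2) ^ DIM('a)) \<le> ?V * (R + e) ^ DIM('a)"
    by (simp add: mult_ac)
  then have "real (card F) * (e / 2) ^ DIM('a) \<le> (R + e) ^ DIM('a)"
    using unit_ball_vol_pos[of "real DIM('a)"] by simp
  then have "real (card F) \<le> ((R + e) / (e / 2)) ^ DIM('a)"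
    unfolding power_divide using assms(1) by (subst pos_le_divide_eq) auto
  then show "card F \<le> nat \<lfloor>((R + e) / (e / 2)) ^ DIM('a)\<rfloor>"
    by (simp add: le_nat_floor)
qed

text \<open>For \<open>\<epsilon> \<le> 1\<close> only points of \<open>L\<close> in
  \<open>ball x (R + 1)\<close> contribute. Their number is bounded uniformly in \<open>x\<close>,
  and each ball has volume at most a constant times \<open>\<epsilon>\<close>, the dimension being
  at least 1.\<close>

lemma emeasure_nbhd_Int_ball:
  fixes L :: "'a::euclidean_space set"
  assumes "uniform_discrete L" "R > 0"
  obtains N where "0 \<le> N" "\<And>\<epsilon> x. 0 < \<epsilon> \<Longrightarrow> \<epsilon> \<le> 1 \<Longrightarrow> emeasure lborel (nbhd L \<epsilon> \<inter> ball x R) \<le> ennreal (N * \<epsilon>)"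
proof -
  obtain e where e: "e > 0" "\<And>x y. x \<in> L \<Longrightarrow> y \<in> L \<Longrightarrow> dist x y < e \<Longrightarrow> x = y"
    using assms(1) unfolding uniform_discrete_def by blast
  let ?V = "unit_ball_vol (real DIM('a))"
  let ?K = "nat \<lfloor>((R + 1 + e) / (e / 2)) ^ DIM('a)\<rfloor>"
  show thesis
  proof (rule that)
    show "0 \<le> real ?K * ?V" by simp
    fix \<epsilon> :: real and x :: 'a
    assume \<epsilon>: "0 < \<epsilon>" "\<epsilon> \<le> 1"
    let ?F = "L \<inter> ball x (R + 1)"
    have F: "finite ?F" "card ?F \<le> ?K"
      using uniform_discrete_card_le[OF e, of L "R + 1" x] assms(2) by auto
    have "nbhd L \<epsilon> \<inter> ball x R \<subseteq> (\<Union>a\<in>?F. ball a \<epsilon>)"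
    proof
      fix y assume "y \<in> nbhd L \<epsilon> \<inter> ball x R"
      then obtain a where a: "a \<in> L" "dist a y < \<epsilon>" "dist x y < R" by (auto simp: nbhd_def)
      then have "dist x a < R + 1" using dist_triangle2[of x a y] \<epsilon>(2) by linarith
      with a show "y \<in> (\<Union>a\<in>?F. ball a \<epsilon>)" by auto
    qed
    then have "emeasure lborel (nbhd L \<epsilon> \<inter> ball x R) \<le> emeasure lborel (\<Union>a\<in>?F. ball a \<epsilon>)"
      by (intro emeasure_mono) (simp_all add: borel_open open_UN)
    also have "\<dots> \<le> (\<Sum>a\<in>?F. emeasure lborel (ball a \<epsilon>))"
      using F(1) by (intro emeasure_subadditive_finite) auto
    also have "\<dots> = ennreal (real (card ?F) * (?V * \<epsilon> ^ DIM('a)))"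
      using \<epsilon>(1) by (simp add: emeasure_ball ennreal_mult ennreal_of_nat_eq_real_of_nat)
    also have "\<dots> \<le> ennreal (real ?K * ?V * \<epsilon>)"
    proof (rule ennreal_leI)
      have "\<epsilon> ^ DIM('a) \<le> \<epsilon> ^ 1" using \<epsilon> by (intro power_decreasing) (auto simp: Suc_leI)
      then show "real (card ?F) * (?V * \<epsilon> ^ DIM('a)) \<le> real ?K * ?V * \<epsilon>"
        using F(2) \<epsilon>(1) unfolding mult.assoc by (intro mult_mono) (auto simp del: of_nat_nat)
    qed
    finally show "emeasure lborel (nbhd L \<epsilon> \<inter> ball x R) \<le> ennreal (real ?K * ?V * \<epsilon>)" .
  qed
qed

section \<open>Small off-diagonal blocks of \<open>S\<close>\<close>

context off_diagonal_kernel
begin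

lemma majorant_tail:
  obtains C where "0 \<le> C" "\<And>d x E. d > 0 \<Longrightarrow> (\<And>y. y \<in> E \<Longrightarrow> d \<le> dist x y) \<Longrightarrow>
    (\<integral>\<^sup>+y. ennreal (majorant x y) * indicator E y \<partial>lborel) \<le> ennreal (C * d powr (real DIM('a) - m))"
proof -
  obtain C where C: "0 \<le> C" "\<And>R (x :: 'a). R > 0 \<Longrightarrow>
    (\<integral>\<^sup>+y. ennreal (norm (x - y) powr (- m)) * indicator (- ball x R) y \<partial>lborel)
      \<le> ennreal (C * R powr (real DIM('a) - m))"
    by (rule nn_integral_powr_tail[OF m]) blast
  show thesis
  proof (rule that)
    show "0 \<le> c * C" using c C(1) by simp
    fix d :: real and x and E :: "'a set" assume d: "d > 0" "\<And>y. y \<in> E \<Longrightarrow> d \<le> dist x y"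
    have "(\<integral>\<^sup>+y. ennreal (majorant x y) * indicator E y \<partial>lborel)
        \<le> (\<integral>\<^sup>+y. ennreal c * (ennreal (norm (x - y) powr (- m)) * indicator (- ball x d) y) \<partial>lborel)"
      using d(2) c by (intro nn_integral_mono) (force simp: majorant_def ennreal_mult indicator_def)
    also have "\<dots> = ennreal c * (\<integral>\<^sup>+y. ennreal (norm (x - y) powr (- m)) * indicator (- ball x d) y \<partial>lborel)"
      by (rule nn_integral_cmult) auto
    also have "\<dots> \<le> ennreal c * ennreal (C * d powr (real DIM('a) - m))"
      by (intro mult_left_mono C d) auto
    also have "\<dots> = ennreal (c * C * d powr (real DIM('a) - m))"
      using c C(1) by (simp add: ennreal_mult'[symmetric] mult.assoc)
    finally show "(\<integral>\<^sup>+y. ennreal (majorant x y) * indicator E y \<partial>lborel) \<le> ennreal (c * C * d powr (real DIM('a) - m))" .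
  qed
qed

lemma majorant_tail_small:
  assumes "\<eta> > 0"
  obtains R where "R > 0" "\<And>x E. (\<And>y. y \<in> E \<Longrightarrow> R \<le> dist x y) \<Longrightarrow>
    (\<integral>\<^sup>+y. ennreal (majorant x y) * indicator E y \<partial>lborel) \<le> ennreal \<eta>"
proof -
  obtain C where C: "0 \<le> C" "\<And>d x E. d > 0 \<Longrightarrow> (\<And>y. y \<in> E \<Longrightarrow> d \<le> dist x y) \<Longrightarrow>
    (\<integral>\<^sup>+y. ennreal (majorant x y) * indicator E y \<partial>lborel) \<le> ennreal (C * d powr (real DIM('a) - m))"
    by (rule majorant_tail) blast
  have "((\<lambda>R. C * R powr (real DIM('a) - m)) \<longlongrightarrow> C * 0) at_top"
    using m by (intro tendsto_intros tendsto_neg_powr filterlim_ident) auto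
  then have "\<forall>\<^sub>F R in at_top. C * R powr (real DIM('a) - m) < \<eta>"
    using assms by (auto dest: order_tendstoD(2))
  then have "\<forall>\<^sub>F R in at_top. C * R powr (real DIM('a) - m) < \<eta> \<and> R > 0"
    by (intro eventually_conj eventually_gt_at_top)
  then obtain R where R: "C * R powr (real DIM('a) - m) < \<eta>" "R > 0"
    using eventually_happens'[OF trivial_limit_at_top_linorder] by blast
  show thesis
    by (rule that[OF R(2)]) (use C(2)[OF R(2)] R(1) in \<open>meson ennreal_leI less_imp_le order_trans\<close>)
qed

text \<open>Only the product of the two Schur integrals has to be small. The one over the complement
  of \<open>nbhd L \<delta>\<close> is a tail, at most the fixed \<open>\<beta>\<close>. The one
  over \<open>nbhd L \<epsilon>\<close> is brought below \<open>\<alpha>\<close>: beyond radius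
  \<open>R\<close> it is a tail of at most \<open>\<alpha> / 2\<close>; within it the majorant is at
  most \<open>D\<close> and the measure at most \<open>N * \<epsilon>\<close>.\<close>

lemma offdiag_le_nbhd:
  assumes L: "uniform_discrete L" and \<delta>: "\<delta> > 0" and \<eta>: "\<eta> > 0"
  obtains \<epsilon> where "\<epsilon> > 0" "offdiag_le S (- nbhd L \<delta>) (nbhd L \<epsilon>) \<eta>"
proof -
  obtain C where C: "0 \<le> C" "\<And>d x E. d > 0 \<Longrightarrow> (\<And>y. y \<in> E \<Longrightarrow> d \<le> dist x y) \<Longrightarrow>
    (\<integral>\<^sup>+y. ennreal (majorant x y) * indicator E y \<partial>lborel) \<le> ennreal (C * d powr (real DIM('a) - m))"
    by (rule majorant_tail) blast
  \<comment> \<open>The summand 1 makes \<open>\<beta>\<close> positive even when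
    \<open>C = 0\<close>, so that it may divide.\<close>
  define \<beta> where "\<beta> = C * (\<delta> / 2) powr (real DIM('a) - m) + 1"
  have \<beta>: "\<beta> > 0" using C(1) by (simp add: \<beta>_def add_nonneg_pos)
  define \<alpha> where "\<alpha> = \<eta>\<^sup>2 / \<beta>"
  have \<alpha>: "\<alpha> > 0" using \<eta> \<beta> by (simp add: \<alpha>_def)
  obtain R where R: "R > 0" "\<And>x E. (\<And>y. y \<in> E \<Longrightarrow> R \<le> dist x y) \<Longrightarrow>
    (\<integral>\<^sup>+y. ennreal (majorant x y) * indicator E y \<partial>lborel) \<le> ennreal (\<alpha> / 2)"
    by (rule majorant_tail_small[OF half_gt_zero[OF \<alpha>]]) blast
  obtain N where N: "0 \<le> N" "\<And>\<epsilon> x. 0 < \<epsilon> \<Longrightarrow> \<epsilon> \<le> 1 \<Longrightarrow> emeasure lborel (nbhd L \<epsilon> \<inter> ball x R) \<le> ennreal (N * \<epsilon>)"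
    by (rule emeasure_nbhd_Int_ball[OF L R(1)]) blast
  define D where "D = c * (\<delta> / 2) powr (- m)"
  have D: "D \<ge> 0" using c by (simp add: D_def)
  \<comment> \<open>The bound 1 is for the measure estimate, \<open>\<delta> / 2\<close> keeps the
    two sets at distance \<open>\<delta> / 2\<close>, and the last term gives
    \<open>D * (N * \<epsilon>) \<le> \<alpha> / 2\<close>; adding 1 there avoids division by
    0.\<close>
  define \<epsilon> where "\<epsilon> = min (min 1 (\<delta> / 2)) (\<alpha> / (2 * (D * N + 1)))"
  have DN: "D * N + 1 > 0" using D N(1) by (simp add: add_nonneg_pos)
  have \<epsilon>: "0 < \<epsilon>" "\<epsilon> \<le> 1" "\<epsilon> \<le> \<delta> / 2" "\<epsilon> \<le> \<alpha> / (2 * (D * N + 1))"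
  proof -
    have "0 < \<alpha> / (2 * (D * N + 1))" using \<alpha> DN by simp
    then show "0 < \<epsilon>" "\<epsilon> \<le> 1" "\<epsilon> \<le> \<delta> / 2" "\<epsilon> \<le> \<alpha> / (2 * (D * N + 1))"
      using \<delta> unfolding \<epsilon>_def by linarith+
  qed
  have "D * (N * \<epsilon>) \<le> (D * N + 1) * \<epsilon>" using \<epsilon>(1) by (simp add: algebra_simps)
  also have "\<dots> \<le> \<alpha> / 2"
    using \<epsilon>(4) DN by (simp add: field_simps)
  finally have DN\<epsilon>: "D * (N * \<epsilon>) \<le> \<alpha> / 2" .
  have dist: "\<delta> / 2 \<le> dist x y" if x: "x \<in> - nbhd L \<delta>" and y: "y \<in> nbhd L \<epsilon>" for x y
  proof -
    obtain a where a: "a \<in> L" "dist a y < \<epsilon>" using y by (auto simp: nbhd_def)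
    have "\<delta> \<le> dist a x" using x a(1) by (force simp: nbhd_def)
    then show ?thesis using dist_triangle[of a x y] a(2) \<epsilon>(3) by (simp add: dist_commute)
  qed
  have "offdiag_le S (- nbhd L \<delta>) (nbhd L \<epsilon>) \<eta>"
  proof (rule offdiag_le_Schur[where d = "\<delta> / 2" and \<alpha> = \<alpha> and \<beta> = \<beta>])
    show "\<alpha> * \<beta> \<le> \<eta>\<^sup>2" using \<beta> by (simp add: \<alpha>_def)
    fix x assume x: "x \<in> - nbhd L \<delta>"
    have "(\<integral>\<^sup>+y. ennreal (majorant x y) * indicator (nbhd L \<epsilon>) y \<partial>lborel)
        \<le> (\<integral>\<^sup>+y. ennreal D * indicator (nbhd L \<epsilon> \<inter> ball x R) y + ennreal (majorant x y) * indicator (- ball x R) y \<partial>lborel)"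
    proof (intro nn_integral_mono)
      fix y
      have "majorant x y \<le> D" if "y \<in> nbhd L \<epsilon>"
        unfolding majorant_def D_def using dist[OF x that] \<delta> m
        by (intro mult_left_mono c powr_mono2') (auto simp: dist_norm)
      then show "ennreal (majorant x y) * indicator (nbhd L \<epsilon>) y
        \<le> ennreal D * indicator (nbhd L \<epsilon> \<inter> ball x R) y + ennreal (majorant x y) * indicator (- ball x R) y"
        by (auto simp: indicator_def ennreal_leI)
    qed
    also have "\<dots> = ennreal D * emeasure lborel (nbhd L \<epsilon> \<inter> ball x R)
        + (\<integral>\<^sup>+y. ennreal (majorant x y) * indicator (- ball x R) y \<partial>lborel)"
    proof -
      have [measurable]: "nbhd L \<epsilon> \<inter> ball x R \<in> sets borel" by (intro sets.Int) auto
      show ?thesis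
        by (subst nn_integral_add) (auto simp: nn_integral_cmult_indicator majorant_def)
    qed
    also have "\<dots> \<le> ennreal D * ennreal (N * \<epsilon>) + ennreal (\<alpha> / 2)"
      by (intro add_mono mult_left_mono N(2) \<epsilon> R(2)) auto
    also have "\<dots> = ennreal (D * (N * \<epsilon>) + \<alpha> / 2)"
      using D N(1) \<epsilon>(1) \<alpha> by (simp add: ennreal_mult)
    also have "\<dots> \<le> ennreal \<alpha>"
      using DN\<epsilon> by (intro ennreal_leI) simp
    finally show "(\<integral>\<^sup>+y. ennreal (majorant x y) * indicator (nbhd L \<epsilon>) y \<partial>lborel) \<le> ennreal \<alpha>" .
  next
    fix y assume y: "y \<in> nbhd L \<epsilon>"
    have "(\<integral>\<^sup>+x. ennreal (majorant x y) * indicator (- nbhd L \<delta>) x \<partial>lborel)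
        \<le> ennreal (C * (\<delta> / 2) powr (real DIM('a) - m))"
      unfolding majorant_commute[of _ y]
      by (rule C(2)) (use dist[OF _ y] \<delta> in \<open>auto simp: dist_commute\<close>)
    also have "\<dots> \<le> ennreal \<beta>" by (intro ennreal_leI) (simp add: \<beta>_def)
    finally show "(\<integral>\<^sup>+x. ennreal (majorant x y) * indicator (- nbhd L \<delta>) x \<partial>lborel) \<le> ennreal \<beta>" .
  qed (use \<alpha> \<beta> \<delta> \<eta> dist in auto)
  then show thesis using that \<epsilon>(1) by blast
qed

text \<open>Far from \<open>N\<close> both Schur integrals are tails of the majorant, each at most
  \<open>\<eta>\<close>.\<close>

lemma offdiag_le_bounded:
  assumes N: "bounded N" "N \<in> sets borel" and \<eta>: "\<eta> > 0"
  obtains R where "offdiag_le S (- ball 0 R) N \<eta>"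
proof -
  obtain R where R: "R > 0" "\<And>x E. (\<And>y. y \<in> E \<Longrightarrow> R \<le> dist x y) \<Longrightarrow>
    (\<integral>\<^sup>+y. ennreal (majorant x y) * indicator E y \<partial>lborel) \<le> ennreal \<eta>"
    by (rule majorant_tail_small[OF \<eta>]) blast
  obtain r where r: "\<And>y. y \<in> N \<Longrightarrow> norm y \<le> r" using N(1) by (auto simp: bounded_iff)
  have dist: "R \<le> dist x y" if "x \<in> - ball 0 (R + r)" "y \<in> N" for x y
    using that r[of y] norm_triangle_ineq2[of x y] by (auto simp: dist_norm)
  have "offdiag_le S (- ball 0 (R + r)) N \<eta>"
  proof (rule offdiag_le_Schur[where d = R and \<alpha> = \<eta> and \<beta> = \<eta>])
    fix y assume "y \<in> N"
    then show "(\<integral>\<^sup>+x. ennreal (majorant x y) * indicator (- ball 0 (R + r)) x \<partial>lborel) \<le> ennreal \<eta>"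
      unfolding majorant_commute[of _ y] by (intro R(2)) (use dist in \<open>auto simp: dist_commute\<close>)
  qed (use N \<eta> R dist in \<open>auto simp: power2_eq_square\<close>)
  then show thesis by (rule that)
qed

end

section \<open>Construction of a thin set \<open>M\<close> for a given thin set
  \<open>N\<close>\<close>

lemma thin_nbhd: "thin L N \<longleftrightarrow> (\<forall>\<epsilon>>0. \<exists>r. N - ball 0 r \<subseteq> nbhd L \<epsilon>)"
  by (simp add: thin_def nbhd_def)

context off_diagonal_kernel
begin

lemma thin_offdiag_le:
  assumes L: "uniform_discrete L" and N: "N \<in> sets borel" "thin L N" and \<eta>: "\<eta> > 0"
  obtains M where "M \<in> sets borel" "thin L M" "offdiag_le S (- M) N \<eta>"
proof -
  define \<delta> where "\<delta> j = 1 / real (Suc j)" for j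
  \<comment> \<open>The error allowed for shell \<open>j\<close>. It is halved below because leaving
    \<open>M\<close> can mean leaving a neighbourhood of \<open>L\<close> or leaving a ball.\<close>
  define t where "t j = \<eta> / 2 ^ (j + 1)" for j :: nat
  have \<delta>: "\<delta> j > 0" and t: "t j > 0" for j using \<eta> by (auto simp: \<delta>_def t_def)
  \<comment> \<open>The index is shifted: \<open>\<epsilon> j\<close> serves shell
    \<open>Suc j\<close>, since shell 0 is merely bounded and need not be close to
    \<open>L\<close>.\<close>
  have "\<exists>\<epsilon>>0. offdiag_le S (- nbhd L (\<delta> j)) (nbhd L \<epsilon>) (t (Suc j) / 2)" for j
    using offdiag_le_nbhd[OF L \<delta> half_gt_zero[OF t]] by blast
  then obtain \<epsilon> where \<epsilon>: "\<epsilon> j > 0" "offdiag_le S (- nbhd L (\<delta> j)) (nbhd L (\<epsilon> j)) (t (Suc j) / 2)" for j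
    by metis
  have "\<exists>r. N - ball 0 r \<subseteq> nbhd L (\<epsilon> j)" for j
    using N(2) \<epsilon>(1) unfolding thin_nbhd by blast
  then obtain r where r: "N - ball 0 (r j) \<subseteq> nbhd L (\<epsilon> j)" for j
    by metis
  \<comment> \<open>The sum makes \<open>\<rho>\<close> increasing and at least each
    \<open>r j\<close>; the summand \<open>real j\<close> makes the balls exhaust the space.\<close>
  define \<rho> where "\<rho> j = real j + (\<Sum>i\<le>j. \<bar>r i\<bar>)" for j
  have r_le: "r j \<le> \<rho> j" for j
    using member_le_sum[of j "{..j}" "\<lambda>i. \<bar>r i\<bar>"] by (simp add: \<rho>_def)
  have \<rho>_ge: "real j \<le> \<rho> j" for j by (simp add: \<rho>_def sum_nonneg)
  have \<rho>_Suc: "\<rho> j \<le> \<rho> (Suc j)" for j by (simp add: \<rho>_def)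
  define shell where "shell j = (case j of 0 \<Rightarrow> N \<inter> ball 0 (\<rho> 0) | Suc i \<Rightarrow> N \<inter> ball 0 (\<rho> j) - ball 0 (\<rho> i))" for j
  have shell_sets: "shell j \<in> sets borel" for j
    using N(1) by (auto simp: shell_def split: nat.split)
  have shell_bounded: "bounded (shell j)" for j
    by (rule bounded_subset[OF bounded_ball[of 0 "\<rho> j"]]) (auto simp: shell_def split: nat.splits)
  have shell_sub: "shell (Suc j) \<subseteq> nbhd L (\<epsilon> j)" for j
    using r[of j] subset_ball[OF r_le[of j], of 0] by (auto simp: shell_def)
  have "\<exists>R. offdiag_le S (- ball 0 R) (shell j) (t j / 2)" for j
    using offdiag_le_bounded[OF shell_bounded shell_sets half_gt_zero[OF t]] by blast
  then obtain R where R: "offdiag_le S (- ball 0 (R j)) (shell j) (t j / 2)" for j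
    by metis
  \<comment> \<open>Shell 0 is handled by the ball of radius \<open>R 0\<close> alone, shell
    \<open>Suc j\<close> by the piece with index \<open>j\<close>.\<close>
  define M where "M = ball 0 (R 0) \<union> (\<Union>j. nbhd L (\<delta> j) \<inter> ball 0 (R (Suc j)))"
  have "open M" unfolding M_def by (intro open_Un open_UN ballI open_Int open_ball open_nbhd)
  then have M: "M \<in> sets borel" "- M \<in> sets borel" by auto
  have nbhdC: "- nbhd L e \<in> sets borel" for e by (intro borel_comp) simp
  have ballC: "- ball 0 e \<in> sets borel" for e :: real by (intro borel_comp) simp
  have shell_le: "offdiag_le S (- M) (shell j) (t j)" for j
  proof (cases j)
    case 0
    have "offdiag_le S (- M) (shell j) (t j / 2)"
      by (rule offdiag_le_mono[OF R[of j] _ ballC shell_sets M(2) _ shell_sets])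
        (use t[of j] 0 in \<open>auto simp: M_def\<close>)
    then show ?thesis by (rule offdiag_le_weaken) (use t[of j] in auto)
  next
    case (Suc i)
    have "offdiag_le S (- nbhd L (\<delta> i)) (shell j) (t j / 2)"
      unfolding Suc
      by (rule offdiag_le_mono_right[OF \<epsilon>(2) _ nbhdC borel_nbhd shell_sets shell_sub]) (use t[of "Suc i"] in auto)
    \<comment> \<open>A point outside \<open>M\<close> is outside \<open>nbhd L (\<delta> i)\<close>
      or outside \<open>ball 0 (R j)\<close>, so the two half bounds add up to
      \<open>t j\<close>.\<close>
    then have "offdiag_le S (shell j) (- nbhd L (\<delta> i) \<union> - ball 0 (R j)) (t j / 2 + t j / 2)"
      using R[of j] t[of j] nbhdC ballC shell_sets
      by (intro offdiag_le_Un_right) (auto simp: offdiag_le_commute[of S "shell j"])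
    then have "offdiag_le S (shell j) (- nbhd L (\<delta> i) \<union> - ball 0 (R j)) (t j)" by simp
    then have "offdiag_le S (shell j) (- M) (t j)"
      by (rule offdiag_le_mono_right) (use t[of j] nbhdC ballC shell_sets M(2) Suc in \<open>auto simp: M_def\<close>)
    then show ?thesis by (simp add: offdiag_le_commute)
  qed
  \<comment> \<open>The geometric sum \<open>t 0 + ... + t J\<close> equals
    \<open>\<eta> - t J\<close>.\<close>
  have "offdiag_le S (- M) (N \<inter> ball 0 (\<rho> J)) (\<eta> - t J)" for J
  proof (induction J)
    case 0
    have "\<eta> - t 0 = t 0" by (simp add: t_def)
    then show ?case using shell_le[of 0] by (simp add: shell_def)
  next
    case (Suc J)
    have "N \<inter> ball 0 (\<rho> J) \<union> shell (Suc J) = N \<inter> ball 0 (\<rho> (Suc J))"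
      using subset_ball[OF \<rho>_Suc[of J], of 0] by (auto simp: shell_def)
    moreover have "\<eta> - t J + t (Suc J) = \<eta> - t (Suc J)" by (simp add: t_def)
    moreover have "offdiag_le S (- M) (N \<inter> ball 0 (\<rho> J) \<union> shell (Suc J)) (\<eta> - t J + t (Suc J))"
      using t[of "Suc J"] N(1) shell_sets M(2)
      by (intro offdiag_le_Un_right Suc.IH shell_le) auto
    ultimately show ?case by (simp only:)
  qed
  moreover have "0 \<le> \<eta> - t J" for J
    using \<eta> one_le_power[of "2 :: real" "J + 1"] by (simp add: t_def divide_le_eq mult_le_cancel_left1)
  ultimately have "offdiag_le S (- M) (N \<inter> ball 0 (\<rho> J)) \<eta>" for J
    by (rule offdiag_le_weaken) (use t[of J] in simp)
  then have "offdiag_le S (- M) N \<eta>"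
  proof (rule offdiag_le_limit)
    fix x :: 'a
    have "\<forall>\<^sub>F J in sequentially. norm x < real J"
      using filterlim_real_sequentially by (simp add: filterlim_at_top_dense)
    then show "\<forall>\<^sub>F J in sequentially. (x \<in> N \<inter> ball 0 (\<rho> J)) \<longleftrightarrow> x \<in> N"
      by eventually_elim (use \<rho>_ge in \<open>auto intro: less_le_trans\<close>)
  qed (use N(1) in auto)
  moreover have "thin L M"
    unfolding thin_nbhd
  proof (intro allI impI)
    fix e :: real assume "e > 0"
    then obtain J where J: "\<delta> J < e"
      unfolding \<delta>_def using reals_Archimedean by (metis inverse_eq_divide)
    \<comment> \<open>Outside \<open>ball 0 s\<close> only the pieces of \<open>M\<close> with index
      \<open>j \<ge> J\<close> remain, and these lie in \<open>nbhd L (\<delta> J)\<close>.\<close>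
    define s where "s = (\<Sum>i\<le>J. \<bar>R i\<bar>)"
    have R_le: "R i \<le> s" if "i \<le> J" for i
      using member_le_sum[of i "{..J}" "\<lambda>i. \<bar>R i\<bar>"] that by (simp add: s_def)
    have "x \<in> nbhd L e" if x: "x \<in> M" "x \<notin> ball 0 s" for x
    proof -
      have "x \<notin> ball 0 (R 0)" using x(2) R_le[of 0] by auto
      then obtain j where j: "x \<in> nbhd L (\<delta> j)" "x \<in> ball 0 (R (Suc j))"
        using x(1) by (auto simp: M_def)
      have "J \<le> j"
      proof (rule ccontr)
        assume "\<not> J \<le> j"
        then show False using R_le[of "Suc j"] j(2) x(2) by auto
      qed
      then have "\<delta> j \<le> \<delta> J" by (simp add: \<delta>_def frac_le)
      then show ?thesis using j(1) J nbhd_mono[of "\<delta> j" e L] by auto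
    qed
    then show "\<exists>r. M - ball 0 r \<subseteq> nbhd L e" by blast
  qed
  ultimately show thesis using that M(1) by blast
qed

end

section \<open>Approximation of \<open>S\<close> composed with \<open>mult_op \<phi>\<close>, in
  both orders\<close>

lemma L2_operators_compose: "T \<in> L2_operators \<Longrightarrow> U \<in> L2_operators \<Longrightarrow> T o\<^sub>L U \<in> L2_operators"
  by (simp add: L2_operators_def)

lemma mult_op_mult_op:
  assumes \<phi>: "\<phi> \<in> borel_measurable borel" "bounded (range \<phi>)" and \<psi>: "\<psi> \<in> borel_measurable borel" "bounded (range \<psi>)"
  shows "blinfun_apply (mult_op \<phi>) (blinfun_apply (mult_op \<psi>) F) = abs_L2 (\<lambda>x. \<phi> x * \<psi> x * rep_L2 F x)"
  using mult_op_apply[OF \<psi> square_integrable_rep_L2[of F]]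
    mult_op_apply[OF \<phi> square_integrable_bounded_mult[OF \<psi> square_integrable_rep_L2[of F]]]
  by (simp add: mult.assoc)

lemma mult_op_in_L2_operators:
  assumes "\<phi> \<in> borel_measurable borel" "bounded (range \<phi>)"
  shows "mult_op \<phi> \<in> L2_operators"
proof -
  have "blinfun_apply (mult_op \<phi>) (blinfun_apply (mult_op (\<lambda>_. t)) F)
      = blinfun_apply (mult_op (\<lambda>_. t)) (blinfun_apply (mult_op \<phi>) F)" for t F
    by (subst (1 2) mult_op_mult_op) (auto simp: assms mult.commute)
  then show ?thesis by (simp add: L2_operators_def mult_op.rep_eq)
qed

lemma norm_mult_op_cutoff:
  assumes \<phi>: "\<phi> \<in> borel_measurable borel" "bounded (range \<phi>)" and E: "E \<in> sets borel"
    and b: "\<And>x. x \<in> E \<Longrightarrow> cmod (\<phi> x) \<le> b" "0 \<le> b"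
  shows "norm (blinfun_apply (mult_op \<phi>) (blinfun_apply (cutoff E) F)) \<le> b * norm F"
    and "norm (blinfun_apply (cutoff E) (blinfun_apply (mult_op \<phi>) F)) \<le> b * norm F"
proof -
  note ind = borel_measurable_indicator[OF E] bounded_range_indicator
  have eq: "blinfun_apply (mult_op \<phi>) (blinfun_apply (cutoff E) F) = abs_L2 (\<lambda>x. \<phi> x * indicator E x * rep_L2 F x)"
    unfolding cutoff_def by (rule mult_op_mult_op[OF \<phi> ind])
  have sq: "square_integrable (\<lambda>x. \<phi> x * indicator E x * rep_L2 F x)"
    unfolding mult.assoc by (intro square_integrable_bounded_mult \<phi> ind square_integrable_rep_L2)
  have sqb: "square_integrable (\<lambda>x. complex_of_real b * rep_L2 F x)"
    by (rule square_integrable_scaleC[OF square_integrable_rep_L2])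
  have "norm (abs_L2 (\<lambda>x. \<phi> x * indicator E x * rep_L2 F x)) \<le> norm (abs_L2 (\<lambda>x. complex_of_real b * rep_L2 F x))"
    by (rule norm_abs_L2_mono[OF sq sqb]) (use b in \<open>auto simp: norm_mult indicator_def intro: mult_right_mono\<close>)
  also have "\<dots> = b * norm (abs_L2 (rep_L2 F))"
    unfolding norm_abs_L2[OF sqb] norm_abs_L2[OF square_integrable_rep_L2]
    using b(2) by (simp add: norm_mult power_mult_distrib real_sqrt_mult)
  finally show le: "norm (blinfun_apply (mult_op \<phi>) (blinfun_apply (cutoff E) F)) \<le> b * norm F"
    by (simp add: eq)
  have "blinfun_apply (cutoff E) (blinfun_apply (mult_op \<phi>) F) = abs_L2 (\<lambda>x. indicator E x * \<phi> x * rep_L2 F x)"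
    unfolding cutoff_def by (rule mult_op_mult_op[OF ind \<phi>])
  then show "norm (blinfun_apply (cutoff E) (blinfun_apply (mult_op \<phi>) F)) \<le> b * norm F"
    using le eq by (simp add: mult.commute)
qed

lemma cutoff_UNIV: "blinfun_apply (cutoff UNIV) F = F"
  using cutoff_apply[of UNIV "rep_L2 F"] by (simp add: square_integrable_rep_L2)

lemma cutoff_add_Compl:
  assumes "E \<in> sets borel"
  shows "blinfun_apply (cutoff E) F + blinfun_apply (cutoff (- E)) F = F"
  using cutoff_disjoint_Un[of E "- E" F] assms
  by (simp add: cutoff_UNIV Compl_partition borel_comp)

text \<open>This makes \<open>cutoff M\<close> an admissible operator \<open>mult_op \<psi>\<close>
  whenever \<open>M\<close> is Borel and thin.\<close>

lemma indicator_in_B_space: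
  assumes "M \<in> sets borel" "thin L M"
  shows "indicator M \<in> B_space L"
proof -
  have "thin L {x. t \<le> cmod (indicator M x)}" if "t > 0" for t
    by (rule thin_subset[OF assms(2)]) (use that in \<open>auto simp: indicator_def split: if_splits\<close>)
  then show ?thesis
    using assms(1) bounded_range_indicator by (auto simp: B_space_def tendsto_thin_filter_iff)
qed

context off_diagonal_kernel
begin

text \<open>Cutting \<open>S o\<^sub>L mult_op \<phi>\<close> on the left, or
  \<open>mult_op \<phi> o\<^sub>L S\<close> on the right, with \<open>cutoff M\<close> gives a
  single generator of the span in question. Only the norms of the parts cut off have to be
  small.\<close>

lemma decay_preserving:
  assumes L: "uniform_discrete L"
  shows "decay_preserving L S"
  unfolding decay_preserving_def
proof
  fix \<phi> assume "\<phi> \<in> B_space L"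
  then have \<phi>: "\<phi> \<in> borel_measurable borel" "bounded (range \<phi>)"
    and \<phi>_thin: "\<And>t. t > 0 \<Longrightarrow> thin L {x. t \<le> cmod (\<phi> x)}"
    by (auto simp: B_space_def tendsto_thin_filter_iff)
  have \<phi>_op: "mult_op \<phi> \<in> L2_operators" by (rule mult_op_in_L2_operators[OF \<phi>])
  obtain b where b: "b > 0" "\<And>x. cmod (\<phi> x) \<le> b"
    using \<phi>(2) by (auto simp: bounded_pos)
  have approx: "\<exists>M. M \<in> sets borel \<and> thin L M \<and>
      norm (cutoff (- M) o\<^sub>L (S o\<^sub>L mult_op \<phi>)) < e \<and> norm ((mult_op \<phi> o\<^sub>L S) o\<^sub>L cutoff (- M)) < e"
    if e: "e > 0" for e
  proof -
    \<comment> \<open>The part of \<open>\<phi>\<close> below \<open>\<theta>\<close> contributes at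
      most \<open>norm S * \<theta> \<le> e / 4\<close>; the part on \<open>N\<close> will
      contribute \<open>\<eta> * b = e / 4\<close>. The total \<open>e / 2\<close> leaves room for
      the strict inequality, and \<open>norm S + 1\<close> covers \<open>S = 0\<close>.\<close>
    define \<theta> where "\<theta> = e / (4 * (norm S + 1))"
    have S1: "norm S + 1 > 0" by (simp add: add_nonneg_pos)
    then have \<theta>: "\<theta> > 0" using e by (simp add: \<theta>_def)
    have "u * (e / (4 * u)) = e / 4" if "u > 0" for u :: real using that by simp
    from this[OF S1] have "(norm S + 1) * \<theta> = e / 4" unfolding \<theta>_def .
    then have S\<theta>: "norm S * \<theta> \<le> e / 4" using \<theta> by (simp add: distrib_right)
    define N where "N = {x. \<theta> \<le> cmod (\<phi> x)}"
    have N: "N \<in> sets borel" "thin L N" "- N \<in> sets borel"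
      unfolding N_def using \<phi>(1) \<phi>_thin[OF \<theta>] by (auto simp: borel_comp)
    define \<eta> where "\<eta> = e / (4 * b)"
    have \<eta>: "\<eta> > 0" "\<eta> * b = e / 4" using e b(1) by (simp_all add: \<eta>_def)
    obtain M where M: "M \<in> sets borel" "thin L M" "offdiag_le S (- M) N \<eta>"
      using thin_offdiag_le[OF L N(1,2) \<eta>(1)] .
    have MC: "- M \<in> sets borel" using M(1) by (simp add: borel_comp)
    have small: "cmod (\<phi> x) \<le> \<theta>" if "x \<in> - N" for x using that by (simp add: N_def)
    note bounds = norm_mult_op_cutoff[OF \<phi> N(3) small less_imp_le[OF \<theta>]]
    have \<phi>_le: "norm (blinfun_apply (mult_op \<phi>) F) \<le> b * norm F" for F
      using norm_mult_op_cutoff(1)[OF \<phi>, of UNIV b F] b by (simp add: cutoff_UNIV less_imp_le)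
    have "norm (blinfun_apply (cutoff (- M) o\<^sub>L (S o\<^sub>L mult_op \<phi>)) F) \<le> e / 2 * norm F" for F
    proof -
      let ?G = "blinfun_apply (mult_op \<phi>) F"
      \<comment> \<open>The function is split along \<open>N\<close> before \<open>S\<close> acts:
        on \<open>N\<close> the off-diagonal bound applies, off \<open>N\<close> the smallness of
        \<open>\<phi>\<close>.\<close>
      have "blinfun_apply (cutoff (- M) o\<^sub>L (S o\<^sub>L mult_op \<phi>)) F
          = blinfun_apply (cutoff (- M)) (blinfun_apply S (blinfun_apply (cutoff N) ?G + blinfun_apply (cutoff (- N)) ?G))"
        by (simp add: cutoff_add_Compl[OF N(1)])
      also have "norm \<dots> \<le> norm (blinfun_apply (cutoff (- M)) (blinfun_apply S (blinfun_apply (cutoff N) ?G)))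
          + norm (blinfun_apply (cutoff (- M)) (blinfun_apply S (blinfun_apply (cutoff (- N)) ?G)))"
        unfolding blinfun.add_right by (rule norm_triangle_ineq)
      also have "\<dots> \<le> \<eta> * norm ?G + norm S * norm (blinfun_apply (cutoff (- N)) ?G)"
        using M(3) unfolding offdiag_le_def
        by (intro add_mono order_trans[OF norm_cutoff_le[OF MC] norm_blinfun]) auto
      also have "\<dots> \<le> \<eta> * (b * norm F) + norm S * (\<theta> * norm F)"
        using \<eta>(1) by (intro add_mono mult_left_mono \<phi>_le bounds(2)) auto
      also have "\<dots> = (\<eta> * b + norm S * \<theta>) * norm F" by (simp add: algebra_simps)
      also have "\<dots> \<le> e / 2 * norm F"
        using \<eta>(2) S\<theta> by (intro mult_right_mono) auto
      finally show ?thesis .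
    qed
    then have "norm (cutoff (- M) o\<^sub>L (S o\<^sub>L mult_op \<phi>)) \<le> e / 2"
      using e by (intro norm_blinfun_bound) auto
    moreover
    have "norm (blinfun_apply ((mult_op \<phi> o\<^sub>L S) o\<^sub>L cutoff (- M)) F) \<le> e / 2 * norm F" for F
    proof -
      let ?G = "blinfun_apply S (blinfun_apply (cutoff (- M)) F)"
      \<comment> \<open>In this order the split along \<open>N\<close> comes after \<open>S\<close>,
        and the other half of \<open>offdiag_le\<close> is used.\<close>
      have "blinfun_apply ((mult_op \<phi> o\<^sub>L S) o\<^sub>L cutoff (- M)) F
          = blinfun_apply (mult_op \<phi>) (blinfun_apply (cutoff N) ?G + blinfun_apply (cutoff (- N)) ?G)"
        by (simp add: cutoff_add_Compl[OF N(1)])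
      also have "norm \<dots> \<le> norm (blinfun_apply (mult_op \<phi>) (blinfun_apply (cutoff N) ?G))
          + norm (blinfun_apply (mult_op \<phi>) (blinfun_apply (cutoff (- N)) ?G))"
        unfolding blinfun.add_right by (rule norm_triangle_ineq)
      also have "\<dots> \<le> b * norm (blinfun_apply (cutoff N) ?G) + \<theta> * norm ?G"
        by (intro add_mono \<phi>_le bounds(1))
      also have "\<dots> \<le> b * (\<eta> * norm F) + \<theta> * (norm S * norm F)"
      proof (intro add_mono mult_left_mono)
        show "norm (blinfun_apply (cutoff N) ?G) \<le> \<eta> * norm F"
          using M(3) unfolding offdiag_le_def by blast
        show "norm ?G \<le> norm S * norm F"
          by (rule order_trans[OF norm_blinfun]) (intro mult_left_mono norm_cutoff_le[OF MC], simp)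
      qed (use b(1) \<theta> in auto)
      also have "\<dots> = (\<eta> * b + norm S * \<theta>) * norm F" by (simp add: algebra_simps)
      also have "\<dots> \<le> e / 2 * norm F"
        using \<eta>(2) S\<theta> by (intro mult_right_mono) auto
      finally show ?thesis .
    qed
    then have "norm ((mult_op \<phi> o\<^sub>L S) o\<^sub>L cutoff (- M)) \<le> e / 2"
      using e by (intro norm_blinfun_bound) auto
    ultimately show ?thesis using M(1,2) e by (intro exI[of _ M]) auto
  qed
  have split: "T - (cutoff M o\<^sub>L T) = cutoff (- M) o\<^sub>L T" "T - (T o\<^sub>L cutoff M) = T o\<^sub>L cutoff (- M)"
    if "M \<in> sets borel" for M :: "'a set" and T :: "'a L2 \<Rightarrow>\<^sub>L 'a L2"
  proof -
    have "blinfun_apply (cutoff (- M)) F = F - blinfun_apply (cutoff M) F" for F :: "'a L2"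
      using cutoff_add_Compl[OF that, of F] by (simp add: eq_diff_eq add.commute)
    then show "T - (cutoff M o\<^sub>L T) = cutoff (- M) o\<^sub>L T" "T - (T o\<^sub>L cutoff M) = T o\<^sub>L cutoff (- M)"
      by (auto intro!: blinfun_eqI simp: blinfun.diff_left blinfun.diff_right)
  qed
  show "S o\<^sub>L mult_op \<phi> \<in> closed_span {mult_op \<psi> o\<^sub>L T | \<psi> T. \<psi> \<in> B_space L \<and> T \<in> L2_operators} \<and>
     mult_op \<phi> o\<^sub>L S \<in> closed_span {T o\<^sub>L mult_op \<psi> | \<psi> T. \<psi> \<in> B_space L \<and> T \<in> L2_operators}"
    unfolding closed_span_def closure_approachable
  proof (intro conjI allI impI)
    fix e :: real assume "e > 0"
    then obtain M where M: "M \<in> sets borel" "thin L M"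
      "norm (cutoff (- M) o\<^sub>L (S o\<^sub>L mult_op \<phi>)) < e" "norm ((mult_op \<phi> o\<^sub>L S) o\<^sub>L cutoff (- M)) < e"
      using approx by blast
    note ind = indicator_in_B_space[OF M(1,2)]
    show "\<exists>y\<in>op_C.span {mult_op \<psi> o\<^sub>L T | \<psi> T. \<psi> \<in> B_space L \<and> T \<in> L2_operators}. dist y (S o\<^sub>L mult_op \<phi>) < e"
    proof (intro bexI)
      show "dist (cutoff M o\<^sub>L (S o\<^sub>L mult_op \<phi>)) (S o\<^sub>L mult_op \<phi>) < e"
        using M(3) by (simp add: dist_norm norm_minus_commute split(1)[OF M(1)])
      show "cutoff M o\<^sub>L (S o\<^sub>L mult_op \<phi>) \<in> op_C.span {mult_op \<psi> o\<^sub>L T | \<psi> T. \<psi> \<in> B_space L \<and> T \<in> L2_operators}"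
        using ind L2_operators_compose[OF S \<phi>_op] unfolding cutoff_def by (intro op_C.span_base) blast
    qed
    show "\<exists>y\<in>op_C.span {T o\<^sub>L mult_op \<psi> | \<psi> T. \<psi> \<in> B_space L \<and> T \<in> L2_operators}. dist y (mult_op \<phi> o\<^sub>L S) < e"
    proof (intro bexI)
      show "dist ((mult_op \<phi> o\<^sub>L S) o\<^sub>L cutoff M) (mult_op \<phi> o\<^sub>L S) < e"
        using M(4) by (simp add: dist_norm norm_minus_commute split(2)[OF M(1)])
      show "(mult_op \<phi> o\<^sub>L S) o\<^sub>L cutoff M \<in> op_C.span {T o\<^sub>L mult_op \<psi> | \<psi> T. \<psi> \<in> B_space L \<and> T \<in> L2_operators}"
        using ind L2_operators_compose[OF \<phi>_op S] unfolding cutoff_def by (intro op_C.span_base) blast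
    qed
  qed
qed

end

theorem proposition6p7:
  fixes L :: "(real ^ 'n) set"
    and S :: "(real ^ 'n) L2 \<Rightarrow>\<^sub>L (real ^ 'n) L2"
    and K :: "((real ^ 'n) \<times> (real ^ 'n) \<Rightarrow> complex) \<Rightarrow> complex"
    and k :: "(real ^ 'n) \<times> (real ^ 'n) \<Rightarrow> complex"
    and c m :: real
  assumes "uniform_discrete L"
    and "S \<in> L2_operators"
    and "distribution_kernel S K"
    and "is_function_on K {(x, y). x \<noteq> y} k"
    and "m > real CARD('n)"
    and "\<And>x y. x \<noteq> y \<Longrightarrow> cmod (k (x, y)) \<le> c * norm (x - y) powr (- m)"
  shows "decay_preserving L S"
proof -
  \<comment> \<open>Passing to the absolute value of \<open>c\<close> only weakens the kernel bound
    and supplies the nonnegative constant that the locale asks for.\<close>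
  interpret off_diagonal_kernel S K k "\<bar>c\<bar>" m
  proof
    fix x y :: "real ^ 'n"
    assume "x \<noteq> y"
    from assms(6)[OF this] show "cmod (k (x, y)) \<le> \<bar>c\<bar> * norm (x - y) powr (- m)"
      by (rule order_trans) (intro mult_right_mono, auto)
  qed (use assms(2-5) in auto)
  show ?thesis by (rule decay_preserving[OF assms(1)])
qed

end
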